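(* For every $\rho\in\mathscr X_{>0}$ it holds that $\rho\in\mathscr I$ and the subdifferential $\partial F(\rho)\subset\mathscr X^*$ is non-empty.
   Context: $\mathbb{T}$ is the one-dimensional torus $[0,1]$ with $0,1$ identified; $N\ge1$. $\mathcal{H}=(L^2(\mathbb{T})\otimes\mathbb{C}^2)^{\wedge N}$, $\mathscr{W}=\{\Psi\in(H^1(\mathbb{T})\otimes\mathbb{C}^2)^{\wedge N}:\|\Psi\|_{\mathcal H}=1\}$, $T(\Psi)=\frac12\sum_j\|\nabla_j\Psi\|^2$, $\rho_\Psi(x)=N\sum_{\sigma}\int|\Psi(x\sigma_1,x_2\sigma_2,\dots)|^2dx_2\cdots dx_N$. A form $B$ is kinetically bounded if $|B(\Psi,\Psi)|\le aT(\Psi)+b$ on $\mathscr W$ for some $a,b\ge0$; the infimum of such $a$ is the relative kinetic bound. $W$ is a positive quadratic form on $(H^1(\mathbb{T})\otimes\mathbb{C}^2)^{\wedge N}$, kinetically bounded with relative bound $<1$; $\langle\Psi,H_0\Psi\rangle=T(\Psi)+W(\Psi,\Psi)$. $\mathscr X=\{\rho\in H^1(\mathbb{T})\mid\int\rho=N\}$, $\mathscr X_{>0}=\{\rho\in\mathscr X\mid\rho(x)>0\ \forall x\in\mathbb{T}\}$ (continuous representative), $\mathscr I=\{\rho\in L^1(\mathbb{T})\mid\nabla\sqrt\rho\in L^2,\rho\ge0,\int\rho=N\}$, and $\mathscr X^*$ is $H^{-1}(\mathbb{T})=\{f+\nabla g: f,g\in L^2(\mathbb{T})\}$ modulo additive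 constants, with pairing $\langle v,\rho\rangle=\int f\rho-\int g\nabla\rho$. For $v\in\mathscr X^*$ let $E(v)=\inf_{\Psi\in\mathscr W}\{\langle\Psi,H_0\Psi\rangle+\langle v,\rho_\Psi\rangle\}$, and for $\rho\in\mathscr X$ let $F(\rho)=\sup_{v\in\mathscr X^*}\{E(v)-\langle v,\rho\rangle\}$. The subdifferential is $\partial F(\rho)=\{u\in\mathscr X^*\mid\forall\rho'\in\mathscr X: F(\rho)-F(\rho')\le\langle u,\rho-\rho'\rangle\}$. *)

theory Defs
  imports "HOL-Analysis.Analysis"
begin

text \<open>The torus T = [0,1] with 0 ~ 1. Functions on T (resp. T^N) are represented by
  functions on the reals (resp. on real^'n), of which only the values on [0,1]
  (resp. the unit cube) matter; periodicity (the torus) is encoded through the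
  periodic test functions used to define weak derivatives. The number of particles
  is N = CARD('n) for a finite type 'n of particle labels; spin states are
  functions 'n => bool (bool standing for the two spin values of C^2).\<close>

type_synonym 'n wf = "real^'n \<Rightarrow> ('n \<Rightarrow> bool) \<Rightarrow> complex"

definition cube :: "(real^'n) set" where
  "cube = cbox 0 One"

definition L2r :: "(real \<Rightarrow> real) \<Rightarrow> bool" where
  "L2r f \<longleftrightarrow> f measurable_on {0..1} \<and> (\<lambda>x. (f x)\<^sup>2) integrable_on {0..1}"

definition test1 :: "(real \<Rightarrow> real) \<Rightarrow> (real \<Rightarrow> real) \<Rightarrow> bool" where
  "test1 \<phi> d \<longleftrightarrow> (\<forall>x. \<phi> (x + 1) = \<phi> x) \<and> continuous_on UNIV d \<and>
     (\<forall>x. (\<phi> has_real_derivative d x) (at x))"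

definition weak_deriv1 :: "(real \<Rightarrow> real) \<Rightarrow> (real \<Rightarrow> real) \<Rightarrow> bool" where
  "weak_deriv1 u g \<longleftrightarrow> (\<forall>\<phi> d. test1 \<phi> d \<longrightarrow>
     integral {0..1} (\<lambda>x. u x * d x) = - integral {0..1} (\<lambda>x. g x * \<phi> x))"

definition H1r :: "(real \<Rightarrow> real) \<Rightarrow> bool" where
  "H1r u \<longleftrightarrow> L2r u \<and> (\<exists>g. L2r g \<and> weak_deriv1 u g)"

definition dr :: "(real \<Rightarrow> real) \<Rightarrow> real \<Rightarrow> real" where
  "dr u = (SOME g. L2r g \<and> weak_deriv1 u g)"

definition L2c :: "(real^'n \<Rightarrow> complex) \<Rightarrow> bool" where
  "L2c u \<longleftrightarrow> u measurable_on cube \<and> (\<lambda>x. (cmod (u x))\<^sup>2) integrable_on cube"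

definition testN :: "(real^'n::finite \<Rightarrow> real) \<Rightarrow> ('n \<Rightarrow> real^'n \<Rightarrow> real) \<Rightarrow> bool" where
  "testN \<phi> d \<longleftrightarrow> (\<forall>x i. \<phi> (x + axis i 1) = \<phi> x) \<and>
     (\<forall>i. continuous_on UNIV (d i) \<and>
        (\<forall>x. ((\<lambda>t. \<phi> (x + t *\<^sub>R axis i 1)) has_real_derivative d i x) (at 0)))"

definition weak_pderiv :: "'n::finite \<Rightarrow> (real^'n \<Rightarrow> complex) \<Rightarrow> (real^'n \<Rightarrow> complex) \<Rightarrow> bool" where
  "weak_pderiv i u g \<longleftrightarrow> (\<forall>\<phi> d. testN \<phi> d \<longrightarrow>
     integral cube (\<lambda>x. of_real (d i x) * u x) = - integral cube (\<lambda>x. of_real (\<phi> x) * g x))"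

definition transp :: "'n \<Rightarrow> 'n \<Rightarrow> 'n \<Rightarrow> 'n" where
  "transp i j k = (if k = i then j else if k = j then i else k)"

definition antisym_wf :: "'n::finite wf \<Rightarrow> bool" where
  "antisym_wf \<Psi> \<longleftrightarrow> (\<forall>i j x \<sigma>. i \<noteq> j \<longrightarrow>
     \<Psi> (\<chi> k. x $ transp i j k) (\<sigma> \<circ> transp i j) = - \<Psi> x \<sigma>)"

text \<open>Elements of (H^1(T) \<otimes> C^2)^{\<and>N}.\<close>
definition H1wf :: "'n::finite wf \<Rightarrow> bool" where
  "H1wf \<Psi> \<longleftrightarrow> antisym_wf \<Psi> \<and>
     (\<forall>\<sigma>. L2c (\<lambda>x. \<Psi> x \<sigma>) \<and> (\<forall>i. \<exists>g. L2c g \<and> weak_pderiv i (\<lambda>x. \<Psi> x \<sigma>) g))"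

definition grad :: "'n::finite \<Rightarrow> 'n wf \<Rightarrow> 'n wf" where
  "grad i \<Psi> = (\<lambda>x \<sigma>. (SOME g. L2c g \<and> weak_pderiv i (\<lambda>y. \<Psi> y \<sigma>) g) x)"

definition norm2_wf :: "'n::finite wf \<Rightarrow> real" where
  "norm2_wf \<Psi> = (\<Sum>\<sigma>\<in>UNIV. integral cube (\<lambda>x. (cmod (\<Psi> x \<sigma>))\<^sup>2))"

definition Wset :: "'n::finite wf set" where
  "Wset = {\<Psi>. H1wf \<Psi> \<and> norm2_wf \<Psi> = 1}"

definition kin :: "'n::finite wf \<Rightarrow> real" where
  "kin \<Psi> = 1/2 * (\<Sum>i\<in>UNIV. \<Sum>\<sigma>\<in>UNIV. integral cube (\<lambda>x. (cmod (grad i \<Psi> x \<sigma>))\<^sup>2))"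

text \<open>One-body density, written in the (for antisymmetric Psi equivalent) symmetric form
  rho(t) = sum_i sum_sigma int |Psi(x with x_i := t, sigma)|^2 over the other coordinates;
  integrating additionally over the dummy coordinate x_i in [0,1] contributes a factor 1.\<close>
definition dens :: "'n::finite wf \<Rightarrow> real \<Rightarrow> real" where
  "dens \<Psi> t = (\<Sum>i\<in>UNIV. \<Sum>\<sigma>\<in>UNIV.
      integral cube (\<lambda>y. (cmod (\<Psi> (\<chi> k. if k = i then t else y $ k) \<sigma>))\<^sup>2))"

definition admissible_W :: "('n::finite wf \<Rightarrow> 'n wf \<Rightarrow> complex) \<Rightarrow> bool" where
  "admissible_W W \<longleftrightarrow>
    \<comment> \<open>well defined on L^2 classes\<close>
    (\<forall>\<Psi> \<Psi>' \<Phi>. H1wf \<Psi> \<and> H1wf \<Psi>' \<and> H1wf \<Phi> \<and>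
        (\<forall>\<sigma>. negligible {x \<in> cube. \<Psi> x \<sigma> \<noteq> \<Psi>' x \<sigma>}) \<longrightarrow>
        W \<Psi> \<Phi> = W \<Psi>' \<Phi> \<and> W \<Phi> \<Psi> = W \<Phi> \<Psi>') \<and>
    \<comment> \<open>sesquilinear and Hermitian\<close>
    (\<forall>\<Phi> \<Psi>1 \<Psi>2. H1wf \<Phi> \<and> H1wf \<Psi>1 \<and> H1wf \<Psi>2 \<longrightarrow>
        W \<Phi> (\<lambda>x \<sigma>. \<Psi>1 x \<sigma> + \<Psi>2 x \<sigma>) = W \<Phi> \<Psi>1 + W \<Phi> \<Psi>2) \<and>
    (\<forall>\<Phi> \<Psi> c. H1wf \<Phi> \<and> H1wf \<Psi> \<longrightarrow> W \<Phi> (\<lambda>x \<sigma>. c * \<Psi> x \<sigma>) = c * W \<Phi> \<Psi>) \<and>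
    (\<forall>\<Phi> \<Psi>. H1wf \<Phi> \<and> H1wf \<Psi> \<longrightarrow> W \<Phi> \<Psi> = cnj (W \<Psi> \<Phi>)) \<and>
    \<comment> \<open>positive\<close>
    (\<forall>\<Psi>. H1wf \<Psi> \<longrightarrow> 0 \<le> Re (W \<Psi> \<Psi>)) \<and>
    \<comment> \<open>kinetically bounded with relative bound < 1\<close>
    (\<exists>a b. 0 \<le> a \<and> a < 1 \<and> 0 \<le> b \<and> (\<forall>\<Psi>\<in>Wset. cmod (W \<Psi> \<Psi>) \<le> a * kin \<Psi> + b))"

definition Xstar :: "((real \<Rightarrow> real) \<times> (real \<Rightarrow> real)) set" where
  "Xstar = {(f, g). L2r f \<and> L2r g}"

definition pairing :: "(real \<Rightarrow> real) \<times> (real \<Rightarrow> real) \<Rightarrow> (real \<Rightarrow> real) \<Rightarrow> real" where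
  "pairing v \<rho> = integral {0..1} (\<lambda>x. fst v x * \<rho> x) - integral {0..1} (\<lambda>x. snd v x * dr \<rho> x)"

definition Xset :: "nat \<Rightarrow> (real \<Rightarrow> real) set" where
  "Xset N = {\<rho>. H1r \<rho> \<and> integral {0..1} \<rho> = real N}"

definition Xpos :: "nat \<Rightarrow> (real \<Rightarrow> real) set" where
  "Xpos N = {\<rho> \<in> Xset N. \<exists>r. continuous_on {0..1} r \<and>
      negligible {x \<in> {0..1}. \<rho> x \<noteq> r x} \<and> (\<forall>x\<in>{0..1}. 0 < r x)}"

definition Iset :: "nat \<Rightarrow> (real \<Rightarrow> real) set" where
  "Iset N = {\<rho>. \<rho> absolutely_integrable_on {0..1} \<and>
      (\<exists>g. L2r g \<and> weak_deriv1 (\<lambda>x. sqrt (\<rho> x)) g) \<and>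
      negligible {x \<in> {0..1}. \<rho> x < 0} \<and> integral {0..1} \<rho> = real N}"

definition Efun :: "('n::finite wf \<Rightarrow> 'n wf \<Rightarrow> complex) \<Rightarrow> (real \<Rightarrow> real) \<times> (real \<Rightarrow> real) \<Rightarrow> ereal" where
  "Efun W v = (INF \<Psi>\<in>Wset. ereal (kin \<Psi> + Re (W \<Psi> \<Psi>) + pairing v (dens \<Psi>)))"

definition Ffun :: "('n::finite wf \<Rightarrow> 'n wf \<Rightarrow> complex) \<Rightarrow> (real \<Rightarrow> real) \<Rightarrow> ereal" where
  "Ffun W \<rho> = (SUP v\<in>Xstar. Efun W v - ereal (pairing v \<rho>))"

definition subdiff :: "('n::finite wf \<Rightarrow> 'n wf \<Rightarrow> complex) \<Rightarrow> (real \<Rightarrow> real)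
     \<Rightarrow> ((real \<Rightarrow> real) \<times> (real \<Rightarrow> real)) set" where
  "subdiff W \<rho> = {u \<in> Xstar. \<forall>\<rho>' \<in> Xset CARD('n).
      Ffun W \<rho> - Ffun W \<rho>' \<le> ereal (pairing u (\<lambda>x. \<rho> x - \<rho>' x))}"

end

theory Submission
  imports Defs "HOL-Probability.Probability_Measure"
begin

text \<open>
  If the supremum defining \<open>F(\<rho>)\<close> is attained at \<open>v\<close>, then \<open>-v\<close> is a subgradient at \<open>\<rho>\<close>, so the point is
  attainment.  On the circle every \<open>v\<close> is, modulo constants, the derivative of a mean-zero \<open>L\<^sup>2\<close> function \<open>w\<close>,
  and \<open>w \<mapsto> E(v) - \<langle>v, \<rho>\<rangle>\<close> is an infimum of continuous affine functions because the density of a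
  finite-energy state is in \<open>H\<^sup>1\<close>.  It is coercive: since \<open>\<rho>\<close> is bounded away from zero,
  \<open>\<rho> + s \<integral>w / \<parallel>w\<parallel>\<close> is for small \<open>s\<close> still a positive density, realised by a Slater determinant of Harriman
  orbitals with kinetic energy bounded independently of \<open>w\<close>, whence
  \<open>E(v) - \<langle>v, \<rho>\<rangle> \<le> C - s \<parallel>w\<parallel>\<close>.  Completeness of \<open>L\<^sup>2\<close> and the parallelogram law then produce a maximiser.
\<close>

section \<open>Absolutely continuous functions on the unit interval\<close>

text \<open>A convex function bounded above near a point has a subgradient there; the coercive
  estimate is that local bound seen from the dual side. This is why upper bounds from trial states
  suffice, and \<open>Ffun\<close> never has to be identified with a minimisation over states of
  given density. Dimension one enters through the sup norm: a density is fixed by its derivative and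
  its integral, and the primitive of \<open>h\<close> from 0 is bounded by the L2 norm of
  \<open>h\<close>, so a small L2 change of the derivative cannot destroy positivity. The obstacle
  is that weak derivatives are known only through C1 periodic test functions, that \<open>dr\<close>
  and \<open>grad\<close> are arbitrary choices among them, and that functions matter only almost
  everywhere. Everything is therefore moved to \<open>ac_pair\<close>, an identity between actual
  values on the closed interval: there products, square roots and boundary values make sense, and
  periodicity is the equality of the values at 0 and 1. The same is done on almost every coordinate
  line of the cube.\<close>

definition ac_pair :: "(real \<Rightarrow> 'a::{euclidean_space,real_normed_field}) \<Rightarrow> (real \<Rightarrow> 'a) \<Rightarrow> bool" where
  "ac_pair w g \<longleftrightarrow> g absolutely_integrable_on {0..1} \<and>
     (\<forall>t\<in>{0..1}. w t = w 0 + integral {0..t} g)"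

lemma ac_pair_eq: "ac_pair w g \<Longrightarrow> 0 \<le> t \<Longrightarrow> t \<le> 1 \<Longrightarrow> w t = w 0 + integral {0..t} g"
  unfolding ac_pair_def by (meson atLeastAtMost_iff)

lemma ac_pair_absint: "ac_pair w g \<Longrightarrow> g absolutely_integrable_on {0..1}"
  by (simp add: ac_pair_def)

lemma ac_pair_integrable:
  assumes "ac_pair w g" "0 \<le> s" "t \<le> 1"
  shows "g integrable_on {s..t}"
  by (rule integrable_on_subinterval[of _ "{0..1}"])
     (use assms ac_pair_absint[OF assms(1)] in \<open>auto simp: absolutely_integrable_on_def\<close>)

text \<open>Cutting \<open>{0..t}\<close> into equal pieces shorter than \<open>d\<close> and
  telescoping gives \<open>norm (D t - D 0) \<le> e * (A t - A 0)\<close> for every positive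
  \<open>e\<close>. In the calculus rules below this takes the place of a differentiation theorem
  for integrals.\<close>

lemma const_if_locally_small_variation:
  fixes D :: "real \<Rightarrow> 'a::real_normed_vector" and A :: "real \<Rightarrow> real"
  assumes loc: "\<And>e. e > 0 \<Longrightarrow> \<exists>d>0. \<forall>s t. 0 \<le> s \<and> s \<le> t \<and> t \<le> 1 \<and> t - s < d \<longrightarrow>
                   norm (D t - D s) \<le> e * (A t - A s)"
    and t: "t \<in> {0..1}"
  shows "D t = D 0"
proof -
  have bound: "norm (D t - D 0) \<le> e * (A t - A 0)" if "e > 0" for e
  proof -
    obtain d where d: "d > 0" and D: "\<And>s t. \<lbrakk>0 \<le> s; s \<le> t; t \<le> 1; t - s < d\<rbrakk> \<Longrightarrow>
        norm (D t - D s) \<le> e * (A t - A s)"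
      using loc[OF \<open>e > 0\<close>] by blast
    obtain n :: nat where n: "1 / d < real n" using reals_Archimedean2 by blast
    then have n0: "0 < real n" using d by (meson divide_pos_pos less_trans zero_less_one)
    have step: "t / n < d"
    proof -
      have "t / n \<le> 1 / n" using t n0 by (simp add: divide_right_mono)
      also have "\<dots> < d" using n d n0 by (simp add: field_simps)
      finally show ?thesis .
    qed
    have "norm (D (t * k / n) - D 0) \<le> e * (A (t * k / n) - A 0)" if "k \<le> n" for k :: nat
      using that
    proof (induction k)
      case (Suc k)
      have le: "t * real (Suc k) / n \<le> 1"
      proof -
        have "t * real (Suc k) \<le> 1 * real n"
          using Suc.prems t by (intro mult_mono) auto
        then show ?thesis using n0 by (simp add: field_simps)
      qed
      have "norm (D (t * real (Suc k) / n) - D (t * k / n))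
              \<le> e * (A (t * real (Suc k) / n) - A (t * k / n))"
      proof (rule D)
        show "0 \<le> t * real k / real n" using t by auto
        show "t * real k / real n \<le> t * real (Suc k) / real n"
          using t by (intro divide_right_mono mult_left_mono) auto
        show "t * real (Suc k) / real n - t * real k / real n < d"
          using step by (simp add: algebra_simps add_divide_distrib)
      qed (rule le)
      moreover have "norm (D (t * real (Suc k) / n) - D 0)
          \<le> norm (D (t * real (Suc k) / n) - D (t * k / n)) + norm (D (t * k / n) - D 0)"
        using norm_triangle_ineq[of "D (t * real (Suc k) / n) - D (t * k / n)" "D (t * k / n) - D 0"] by simp
      ultimately show ?case using Suc by (simp add: algebra_simps)
    qed auto
    from this[of n] show ?thesis using n0 by simp
  qed
  show ?thesis
  proof (rule ccontr)
    assume "D t \<noteq> D 0"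
    then have pos: "norm (D t - D 0) > 0" by simp
    \<comment> \<open>The bound with \<open>e = 1\<close> makes the increment of \<open>A\<close>
      positive, so it may be divided by; the \<open>e\<close> chosen next turns the bound into half
      of the norm itself.\<close>
    have "A t - A 0 > 0" using less_le_trans[OF pos bound[OF zero_less_one]] by simp
    then have "norm (D t - D 0) \<le> norm (D t - D 0) / 2"
      using bound[of "norm (D t - D 0) / (2 * (A t - A 0))"] pos by (simp add: field_simps)
    then show False using pos by simp
  qed
qed

lemma ac_pair_diff:
  assumes "ac_pair w g" "0 \<le> s" "s \<le> t" "t \<le> 1"
  shows "w t - w s = integral {s..t} g"
proof -
  have g: "g integrable_on {0..t}"
    using assms by (auto intro: ac_pair_integrable)
  have "integral {0..s} g + integral {s..t} g = integral {0..t} g"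
    by (rule Henstock_Kurzweil_Integration.integral_combine) (use assms g in auto)
  moreover have "w t = w 0 + integral {0..t} g" "w s = w 0 + integral {0..s} g"
    using assms by (auto intro: ac_pair_eq)
  ultimately show ?thesis by (simp add: algebra_simps)
qed

lemma ac_pair_continuous:
  assumes "ac_pair w g"
  shows "continuous_on {0..1} w"
proof -
  have "continuous_on {0..1} (\<lambda>t. w 0 + integral {0..t} g)"
    using ac_pair_integrable[OF assms]
    by (intro continuous_intros indefinite_integral_continuous_1) auto
  then show ?thesis
    by (rule continuous_on_eq) (use assms in \<open>auto simp flip: ac_pair_eq\<close>)
qed

lemma absolutely_integrable_continuous_mult:
  fixes w g :: "real \<Rightarrow> 'a::{euclidean_space,real_normed_field}"
  assumes "continuous_on {a..b} w" "g absolutely_integrable_on {a..b}"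
  shows "(\<lambda>t. w t * g t) absolutely_integrable_on {a..b}"
proof (rule absolutely_integrable_bounded_measurable_product[where h = "(*)"])
  show "bilinear ((*) :: 'a \<Rightarrow> 'a \<Rightarrow> 'a)"
    by (simp add: bilinear_conv_bounded_bilinear bounded_bilinear_mult)
  show "w \<in> borel_measurable (lebesgue_on {a..b})"
    by (rule continuous_imp_measurable_on_sets_lebesgue) (use assms in auto)
  show "bounded (w ` {a..b})"
    using assms(1) by (intro compact_imp_bounded compact_continuous_image) auto
qed (use assms in auto)

text \<open>The integral identity need only hold on short intervals, with an error that is a small
  multiple of the mass of one fixed integrable \<open>h\<close>: summed over a partition, the errors
  stay below the same small multiple of the total mass.\<close>

lemma ac_pairI_local:
  fixes w g :: "real \<Rightarrow> 'a::{euclidean_space,real_normed_field}"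
  assumes g: "g absolutely_integrable_on {0..1}" and h: "h absolutely_integrable_on {0..1}"
    and loc: "\<And>e. e > 0 \<Longrightarrow> \<exists>d>0. \<forall>s t. 0 \<le> s \<and> s \<le> t \<and> t \<le> 1 \<and> t - s < d \<longrightarrow>
                norm (w t - w s - integral {s..t} g) \<le> e * integral {s..t} (h :: real \<Rightarrow> real)"
  shows "ac_pair w g"
proof -
  have comb: "integral {0..t} k = integral {0..s} k + integral {s..t} k"
    if "k integrable_on {0..1}" "0 \<le> s" "s \<le> t" "t \<le> 1"
    for k :: "real \<Rightarrow> 'b::euclidean_space" and s t
  proof -
    have "k integrable_on {0..t}"
      using that by (auto intro: integrable_on_subinterval)
    from Henstock_Kurzweil_Integration.integral_combine[OF that(2,3) this] show ?thesis by simp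
  qed
  have gi: "g integrable_on {0..1}" and hi: "h integrable_on {0..1}"
    using g h by (auto simp: absolutely_integrable_on_def)
  let ?D = "\<lambda>t. w t - integral {0..t} g"
  have D0: "?D t = ?D 0" if t: "t \<in> {0..1}" for t
  proof (rule const_if_locally_small_variation[where A = "\<lambda>t. integral {0..t} h", OF _ t])
    fix e :: real assume "e > 0"
    from loc[OF this] obtain d where d: "d > 0" and D: "\<And>s t. \<lbrakk>0 \<le> s; s \<le> t; t \<le> 1; t - s < d\<rbrakk> \<Longrightarrow>
        norm (w t - w s - integral {s..t} g) \<le> e * integral {s..t} h" by blast
    show "\<exists>d>0. \<forall>s t. 0 \<le> s \<and> s \<le> t \<and> t \<le> 1 \<and> t - s < d \<longrightarrow>
        norm (?D t - ?D s) \<le> e * (integral {0..t} h - integral {0..s} h)"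
    proof (intro exI conjI allI impI)
      fix s t assume "0 \<le> s \<and> s \<le> t \<and> t \<le> 1 \<and> t - s < d"
      then show "norm (?D t - ?D s) \<le> e * (integral {0..t} h - integral {0..s} h)"
        using D[of s t] comb[OF gi, of s t] comb[OF hi, of s t] by (simp add: algebra_simps)
    qed (rule d)
  qed
  have "w t = w 0 + integral {0..t} g" if t: "t \<in> {0..1}" for t
    using D0[OF t] by (metis diff_eq_eq diff_zero integral_refl interval_cbox)
  then show ?thesis using g unfolding ac_pair_def by blast
qed

lemma uniformly_close_on_unit_interval:
  fixes w :: "real \<Rightarrow> 'a::metric_space"
  assumes "continuous_on {0..1} w" "e > 0"
  obtains d where "d > 0" "\<And>s t. \<lbrakk>s \<in> {0..1}; t \<in> {0..1}; \<bar>t - s\<bar> < d\<rbrakk> \<Longrightarrow> dist (w t) (w s) < e"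
proof -
  have "uniformly_continuous_on {0..1} w"
    using assms(1) by (intro compact_uniformly_continuous) auto
  then show ?thesis using assms(2) that unfolding uniformly_continuous_on_def dist_real_def by metis
qed

text \<open>On a short interval both factors are nearly constant by uniform continuity, so freezing
  them costs at most \<open>e\<close> times the mass of
  \<open>norm (g1 t) + norm (g2 t)\<close>.\<close>

lemma ac_pair_mult:
  fixes w1 w2 :: "real \<Rightarrow> 'a::{euclidean_space,real_normed_field}"
  assumes 1: "ac_pair w1 g1" and 2: "ac_pair w2 g2"
  shows "ac_pair (\<lambda>t. w1 t * w2 t) (\<lambda>t. g1 t * w2 t + w1 t * g2 t)"
proof (rule ac_pairI_local[where h = "\<lambda>t. norm (g1 t) + norm (g2 t)"])
  have g1: "g1 absolutely_integrable_on {0..1}" and g2: "g2 absolutely_integrable_on {0..1}"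
    using 1 2 by (auto dest: ac_pair_absint)
  have i1: "(\<lambda>t. w * g1 t) absolutely_integrable_on {0..1}" for w
    by (rule absolutely_integrable_continuous_mult) (auto simp: g1)
  have i2: "(\<lambda>t. w2 t * g1 t) absolutely_integrable_on {0..1}"
    by (rule absolutely_integrable_continuous_mult[OF ac_pair_continuous[OF 2] g1])
  have i3: "(\<lambda>t. w * g2 t) absolutely_integrable_on {0..1}" for w
    by (rule absolutely_integrable_continuous_mult) (auto simp: g2)
  have i4: "(\<lambda>t. w1 t * g2 t) absolutely_integrable_on {0..1}"
    by (rule absolutely_integrable_continuous_mult[OF ac_pair_continuous[OF 1] g2])
  show sm: "(\<lambda>t. g1 t * w2 t + w1 t * g2 t) absolutely_integrable_on {0..1}"
    using set_integral_add(1)[OF i2 i4] by (simp add: mult.commute)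
  show h: "(\<lambda>t. norm (g1 t) + norm (g2 t)) absolutely_integrable_on {0..1}"
    using set_integral_add(1)[OF absolutely_integrable_norm[OF g1] absolutely_integrable_norm[OF g2]]
    by (simp add: o_def)
  fix e :: real assume e: "e > 0"
  obtain d1 where d1: "d1 > 0" "\<And>s t. \<lbrakk>s \<in> {0..1}; t \<in> {0..1}; \<bar>t - s\<bar> < d1\<rbrakk> \<Longrightarrow> dist (w1 t) (w1 s) < e"
    using uniformly_close_on_unit_interval[OF ac_pair_continuous[OF 1] e] by metis
  obtain d2 where d2: "d2 > 0" "\<And>s t. \<lbrakk>s \<in> {0..1}; t \<in> {0..1}; \<bar>t - s\<bar> < d2\<rbrakk> \<Longrightarrow> dist (w2 t) (w2 s) < e"
    using uniformly_close_on_unit_interval[OF ac_pair_continuous[OF 2] e] by metis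
  show "\<exists>d>0. \<forall>s t. 0 \<le> s \<and> s \<le> t \<and> t \<le> 1 \<and> t - s < d \<longrightarrow>
      norm (w1 t * w2 t - w1 s * w2 s - integral {s..t} (\<lambda>t. g1 t * w2 t + w1 t * g2 t))
        \<le> e * integral {s..t} (\<lambda>t. norm (g1 t) + norm (g2 t))"
  proof (intro exI[of _ "min d1 d2"] conjI allI impI)
    fix s t assume st: "0 \<le> s \<and> s \<le> t \<and> t \<le> 1 \<and> t - s < min d1 d2"
    have sub: "k integrable_on {s..t}" if "k absolutely_integrable_on {0..1}" for k :: "real \<Rightarrow> 'b::euclidean_space"
      by (rule integrable_on_subinterval[of _ "{0..1}"])
         (use that st in \<open>auto simp: absolutely_integrable_on_def\<close>)
    note subs = i1[THEN sub] i2[THEN sub] i3[THEN sub] i4[THEN sub] sm[THEN sub] h[THEN sub]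
    \<comment> \<open>One factor is frozen at \<open>s\<close> and the other at \<open>t\<close>,
      which makes the product rule for increments exact.\<close>
    have "w1 t * w2 t - w1 s * w2 s = w2 s * (w1 t - w1 s) + w1 t * (w2 t - w2 s)"
      by (simp add: algebra_simps)
    also have "\<dots> = w2 s * integral {s..t} g1 + w1 t * integral {s..t} g2"
      using ac_pair_diff[OF 1, of s t] ac_pair_diff[OF 2, of s t] st by simp
    also have "\<dots> = integral {s..t} (\<lambda>r. w2 s * g1 r + w1 t * g2 r)"
      using subs by (simp add: integral_add)
    finally have "w1 t * w2 t - w1 s * w2 s - integral {s..t} (\<lambda>t. g1 t * w2 t + w1 t * g2 t)
        = integral {s..t} (\<lambda>r. (w2 s * g1 r + w1 t * g2 r) - (g1 r * w2 r + w1 r * g2 r))"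
      using subs by (subst integral_diff) (auto intro!: integrable_add)
    also have "norm \<dots> \<le> integral {s..t} (\<lambda>r. e * (norm (g1 r) + norm (g2 r)))"
    proof (rule integral_norm_bound_integral)
      show "(\<lambda>r. (w2 s * g1 r + w1 t * g2 r) - (g1 r * w2 r + w1 r * g2 r)) integrable_on {s..t}"
        by (rule integrable_diff[OF integrable_add[OF subs(1,3)] sm[THEN sub]])
      show "(\<lambda>r. e * (norm (g1 r) + norm (g2 r))) integrable_on {s..t}"
        using subs by (intro integrable_on_mult_right) auto
      fix r assume r: "r \<in> {s..t}"
      have "(w2 s * g1 r + w1 t * g2 r) - (g1 r * w2 r + w1 r * g2 r)
          = (w2 s - w2 r) * g1 r + (w1 t - w1 r) * g2 r" by (simp add: algebra_simps)
      also have "norm \<dots> \<le> norm (w2 s - w2 r) * norm (g1 r) + norm (w1 t - w1 r) * norm (g2 r)"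
        by (metis norm_mult norm_triangle_ineq)
      also have "\<dots> \<le> e * norm (g1 r) + e * norm (g2 r)"
        using d1(2)[of r t] d2(2)[of r s] st r
        by (intro add_mono mult_right_mono) (auto simp: dist_norm)
      finally show "norm ((w2 s * g1 r + w1 t * g2 r) - (g1 r * w2 r + w1 r * g2 r))
          \<le> e * (norm (g1 r) + norm (g2 r))" by (simp add: algebra_simps)
    qed
    finally show "norm (w1 t * w2 t - w1 s * w2 s - integral {s..t} (\<lambda>t. g1 t * w2 t + w1 t * g2 t))
        \<le> e * integral {s..t} (\<lambda>t. norm (g1 t) + norm (g2 t))" by simp
  qed (use d1 d2 in auto)
qed

text \<open>An increment of a square root is the increment of its argument divided by the sum of two
  roots; here that divisor is compared with the \<open>2 * sqrt\<close> of the derivative formula.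
  Over the common denominator, which is at least \<open>4 * m\<^sup>2\<close>, the numerator is a
  sum of two small differences.\<close>

lemma inverse_sum_close:
  fixes x y z m e :: real
  assumes "m > 0" "m \<le> x" "m \<le> y" "m \<le> z"
    and "\<bar>z - x\<bar> < e * (2 * m\<^sup>2)" "\<bar>z - y\<bar> < e * (2 * m\<^sup>2)"
  shows "\<bar>1 / (x + y) - 1 / (2 * z)\<bar> \<le> e"
proof -
  have pos: "x + y > 0" "z > 0" using assms by auto
  then have eq: "1 / (x + y) - 1 / (2 * z) = ((z - x) + (z - y)) / ((x + y) * (2 * z))"
    by (simp add: divide_simps)
  have "m * m \<le> x * z" "m * m \<le> y * z" using assms by (auto intro!: mult_mono)
  then have le: "4 * m\<^sup>2 \<le> (x + y) * (2 * z)" by (simp add: power2_eq_square algebra_simps)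
  have "0 < e * (2 * m\<^sup>2)" using assms(5) by (smt (verit))
  then have e: "0 \<le> e" using assms(1) by (simp add: zero_less_mult_iff)
  have "\<bar>(z - x) + (z - y)\<bar> \<le> e * (4 * m\<^sup>2)" using assms(5,6) by (auto simp: abs_if split: if_splits)
  also have "\<dots> \<le> e * ((x + y) * (2 * z))" using le e by (rule mult_left_mono)
  finally show ?thesis
    unfolding eq using pos by (simp add: abs_mult divide_le_eq)
qed

text \<open>Continuity on a compact interval bounds the root below by some \<open>m > 0\<close>,
  which keeps the quotient in the derivative integrable and makes the local error uniform.\<close>

lemma ac_pair_sqrt:
  fixes r g :: "real \<Rightarrow> real"
  assumes r: "ac_pair r g" and pos: "\<And>t. t \<in> {0..1} \<Longrightarrow> r t > 0"
  shows "ac_pair (\<lambda>t. sqrt (r t)) (\<lambda>t. g t / (2 * sqrt (r t)))"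
proof -
  let ?q = "\<lambda>t. sqrt (r t)"
  have cq: "continuous_on {0..1} ?q"
    by (intro continuous_intros ac_pair_continuous[OF r])
  obtain x where x: "x \<in> {0..1}" "\<And>t. t \<in> {0..1} \<Longrightarrow> ?q x \<le> ?q t"
    using continuous_attains_inf[OF compact_Icc _ cq] by auto
  define m where "m = ?q x"
  have m: "m > 0" "\<And>t. t \<in> {0..1} \<Longrightarrow> m \<le> ?q t" using x pos[of x] by (auto simp: m_def)
  have g: "g absolutely_integrable_on {0..1}" using r by (rule ac_pair_absint)
  have ci: "continuous_on {0..1} (\<lambda>t. 1 / (2 * ?q t))"
    using m by (intro continuous_intros cq) force
  show ?thesis
  proof (rule ac_pairI_local[where h = "\<lambda>t. \<bar>g t\<bar>"])
    show ai: "(\<lambda>t. g t / (2 * ?q t)) absolutely_integrable_on {0..1}"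
      using absolutely_integrable_continuous_mult[OF ci g] by simp
    show ag: "(\<lambda>t. \<bar>g t\<bar>) absolutely_integrable_on {0..1}"
      using absolutely_integrable_norm[OF g] by (simp add: o_def)
    fix e :: real assume e: "e > 0"
    then have "e * (2 * m\<^sup>2) > 0" using m by simp
    then obtain d where d: "d > 0" "\<And>s t. \<lbrakk>s \<in> {0..1}; t \<in> {0..1}; \<bar>t - s\<bar> < d\<rbrakk> \<Longrightarrow> dist (?q t) (?q s) < e * (2 * m\<^sup>2)"
      using uniformly_close_on_unit_interval[OF cq] by metis
    show "\<exists>d>0. \<forall>s t. 0 \<le> s \<and> s \<le> t \<and> t \<le> 1 \<and> t - s < d \<longrightarrow>
        norm (?q t - ?q s - integral {s..t} (\<lambda>t. g t / (2 * ?q t))) \<le> e * integral {s..t} (\<lambda>t. \<bar>g t\<bar>)"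
    proof (intro exI[of _ d] conjI allI impI)
      fix s t assume st: "0 \<le> s \<and> s \<le> t \<and> t \<le> 1 \<and> t - s < d"
      have sub: "k integrable_on {s..t}" if "k absolutely_integrable_on {0..1}" for k :: "real \<Rightarrow> real"
        by (rule integrable_on_subinterval[of _ "{0..1}"])
           (use that st in \<open>auto simp: absolutely_integrable_on_def\<close>)
      define c where "c = 1 / (?q t + ?q s)"
      have mt: "m \<le> ?q t" "m \<le> ?q s" using m st by auto
      have rp: "r t > 0" "r s > 0" using pos st by auto
      have "(?q t - ?q s) * (?q t + ?q s) = r t - r s"
        using rp by (simp add: algebra_simps)
      then have "?q t - ?q s = c * (r t - r s)"
        using mt m(1) by (simp add: c_def field_simps)
      also have "\<dots> = integral {s..t} (\<lambda>p. c * g p)"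
        using ac_pair_diff[OF r, of s t] st by simp
      finally have "?q t - ?q s - integral {s..t} (\<lambda>t. g t / (2 * ?q t))
          = integral {s..t} (\<lambda>p. c * g p - g p / (2 * ?q p))"
        using sub[OF ai] sub[OF g] by (subst integral_diff) (auto intro: integrable_on_mult_right)
      also have "norm \<dots> \<le> integral {s..t} (\<lambda>p. e * \<bar>g p\<bar>)"
      proof (rule integral_norm_bound_integral)
        show "(\<lambda>p. c * g p - g p / (2 * ?q p)) integrable_on {s..t}"
          using sub[OF ai] sub[OF g] by (intro integrable_diff integrable_on_mult_right)
        show "(\<lambda>p. e * \<bar>g p\<bar>) integrable_on {s..t}"
          using sub[OF ag] by (intro integrable_on_mult_right)
        fix p assume p: "p \<in> {s..t}"
        have mp: "m \<le> ?q p" using m(2)[of p] p st by auto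
        have "\<bar>c - 1 / (2 * ?q p)\<bar> \<le> e"
          unfolding c_def
          by (rule inverse_sum_close[OF m(1) mt mp])
             (use d(2)[of t p] d(2)[of s p] st p in \<open>auto simp: dist_real_def\<close>)
        then have "\<bar>c - 1 / (2 * ?q p)\<bar> * \<bar>g p\<bar> \<le> e * \<bar>g p\<bar>" by (rule mult_right_mono) simp
        moreover have "c * g p - g p / (2 * ?q p) = (c - 1 / (2 * ?q p)) * g p" by (simp add: algebra_simps)
        ultimately show "norm (c * g p - g p / (2 * ?q p)) \<le> e * \<bar>g p\<bar>" by (simp add: abs_mult)
      qed
      finally show "norm (?q t - ?q s - integral {s..t} (\<lambda>t. g t / (2 * ?q t))) \<le> e * integral {s..t} (\<lambda>t. \<bar>g t\<bar>)"
        by simp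
    qed (rule d)
  qed
qed

lemma ac_pair_C1:
  assumes "continuous_on {0..1} d" "\<And>t. t \<in> {0..1} \<Longrightarrow> (w has_vector_derivative d t) (at t within {0..1})"
  shows "ac_pair w d"
  unfolding ac_pair_def
proof (intro conjI ballI)
  show "d absolutely_integrable_on {0..1}"
    using assms(1) by (rule absolutely_integrable_continuous_real)
  fix t :: real assume t: "t \<in> {0..1}"
  have "(d has_integral w t - w 0) {0..t}"
  proof (rule fundamental_theorem_of_calculus)
    show "(w has_vector_derivative d x) (at x within {0..t})" if "x \<in> {0..t}" for x
      by (rule has_vector_derivative_within_subset[OF assms(2)]) (use that t in auto)
  qed (use t in auto)
  then show "w t = w 0 + integral {0..t} d" by (simp add: integral_unique)
qed

lemma ac_pair_bounded_linear:
  assumes "ac_pair w g" "bounded_linear L"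
  shows "ac_pair (\<lambda>t. L (w t)) (\<lambda>t. L (g t))"
  unfolding ac_pair_def
proof (intro conjI ballI)
  interpret bounded_linear L by fact
  show "(\<lambda>t. L (g t)) absolutely_integrable_on {0..1}"
    using absolutely_integrable_linear[OF ac_pair_absint[OF assms(1)] assms(2)] by (simp add: o_def)
  fix t :: real assume t: "t \<in> {0..1}"
  have g: "g integrable_on {0..t}"
    using assms t by (auto intro: ac_pair_integrable)
  have "w t = w 0 + integral {0..t} g" using ac_pair_eq[OF assms(1), of t] t by auto
  then have "L (w t) = L (w 0) + L (integral {0..t} g)" by (metis add)
  then show "L (w t) = L (w 0) + integral {0..t} (\<lambda>t. L (g t))"
    using integral_linear[OF g assms(2)] by (simp add: o_def)
qed

lemma ac_pair_integral:
  assumes "ac_pair w g"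
  shows "integral {0..1} g = w 1 - w 0"
  using ac_pair_eq[OF assms, of 1] by simp

lemma test1_ac_pair:
  assumes "test1 \<phi> d"
  shows "ac_pair \<phi> d"
proof (rule ac_pair_C1)
  show "continuous_on {0..1} d"
    by (rule continuous_on_subset[of UNIV]) (use assms in \<open>auto simp: test1_def\<close>)
  show "(\<phi> has_vector_derivative d t) (at t within {0..1})" for t
    by (rule has_vector_derivative_at_within)
       (use assms in \<open>auto simp: test1_def has_real_derivative_iff_has_vector_derivative\<close>)
qed

text \<open>The boundary hypothesis concerns only the product, so it covers two periodic factors as
  well as one factor that vanishes at both ends.\<close>

lemma ac_pair_by_parts:
  fixes u g :: "real \<Rightarrow> 'a::{euclidean_space,real_normed_field}"
  assumes "ac_pair u g" "ac_pair \<phi> d" "u 0 * \<phi> 0 = u 1 * \<phi> 1"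
  shows "integral {0..1} (\<lambda>x. u x * d x) = - integral {0..1} (\<lambda>x. g x * \<phi> x)"
proof -
  have "(\<lambda>x. \<phi> x * g x) absolutely_integrable_on {0..1}" "(\<lambda>x. u x * d x) absolutely_integrable_on {0..1}"
    by (intro absolutely_integrable_continuous_mult ac_pair_continuous[OF assms(1)] ac_pair_continuous[OF assms(2)]
        ac_pair_absint[OF assms(1)] ac_pair_absint[OF assms(2)])+
  then have "integral {0..1} (\<lambda>x. g x * \<phi> x + u x * d x)
      = integral {0..1} (\<lambda>x. g x * \<phi> x) + integral {0..1} (\<lambda>x. u x * d x)"
    unfolding absolutely_integrable_on_def by (intro integral_add) (auto simp: mult.commute)
  moreover have "integral {0..1} (\<lambda>x. g x * \<phi> x + u x * d x) = 0"
    using ac_pair_integral[OF ac_pair_mult[OF assms(1,2)]] assms(3) by simp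
  ultimately show ?thesis by (simp add: add_eq_0_iff2)
qed

lemma ac_pair_weak_deriv1:
  assumes "ac_pair u g" "u 0 = u 1"
  shows "weak_deriv1 u g"
  unfolding weak_deriv1_def
proof (intro allI impI)
  fix \<phi> d assume t: "test1 \<phi> d"
  then have "\<phi> 1 = \<phi> 0" unfolding test1_def by (metis add_0)
  with assms show "integral {0..1} (\<lambda>x. u x * d x) = - integral {0..1} (\<lambda>x. g x * \<phi> x)"
    by (intro ac_pair_by_parts test1_ac_pair[OF t]) auto
qed


section \<open>Uniform measures and periodic test functions\<close>

text \<open>A density of \<open>lborel\<close> rather than a restricted measure: the underlying set
  is the whole space and the sigma-algebra is \<open>borel\<close>, so Borel functions, product
  measures and image measures can be used without restricting anything to the set.\<close>

definition uni :: "'a::euclidean_space set \<Rightarrow> 'a measure" where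
  "uni A = density lborel (\<lambda>x. ennreal (indicator A x))"

lemma sets_uni[simp, measurable_cong]: "sets (uni A) = sets borel"
  and space_uni[simp]: "space (uni A) = UNIV"
  by (simp_all add: uni_def)

lemma AE_uni_iff:
  assumes [measurable]: "A \<in> sets borel"
  shows "(AE x in uni A. P x) \<longleftrightarrow> (AE x in lborel. x \<in> A \<longrightarrow> P x)"
  unfolding uni_def by (subst AE_density) (auto simp: indicator_def)

lemma negligible_iff_AE_lborel: "negligible N \<longleftrightarrow> (AE x in lborel. x \<notin> N)"
proof -
  have "(AE x in lebesgue. x \<notin> N) \<longleftrightarrow> N \<in> null_sets lebesgue"
    by (subst completion.AE_iff_null_sets) simp
  then show ?thesis by (simp add: negligible_iff_null_sets AE_completion_iff)
qed

lemma negligible_iff_AE_uni: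
  assumes "A \<in> sets borel"
  shows "negligible {x \<in> A. \<not> P x} \<longleftrightarrow> (AE x in uni A. P x)"
  by (simp add: negligible_iff_AE_lborel AE_uni_iff[OF assms])

text \<open>Bridge between the integrals of the definitions and Bochner integrals. Absolute
  integrability also admits functions that are only Lebesgue measurable, so given functions are
  first replaced by the Borel versions constructed below.\<close>

lemma integrable_uni_iff:
  fixes f :: "'a::euclidean_space \<Rightarrow> 'b::euclidean_space"
  assumes [measurable]: "f \<in> borel_measurable borel" "A \<in> sets borel"
  shows "integrable (uni A) f \<longleftrightarrow> f absolutely_integrable_on A"
  unfolding uni_def set_integrable_def
  by (subst integrable_density) (auto simp: integrable_completion)

lemma integrable_uniD:
  fixes f :: "'a::euclidean_space \<Rightarrow> 'b::euclidean_space"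
  assumes "integrable (uni A) f" "A \<in> sets borel"
  shows "f absolutely_integrable_on A"
proof -
  have "f \<in> borel_measurable borel" using assms(1) by (simp add: borel_measurable_integrable cong: measurable_cong_sets)
  then show ?thesis using assms integrable_uni_iff by blast
qed

lemma integral_uni_eq:
  fixes f :: "'a::euclidean_space \<Rightarrow> 'b::euclidean_space"
  assumes "integrable (uni A) f" and [measurable]: "A \<in> sets borel"
  shows "integral\<^sup>L (uni A) f = integral A f"
proof -
  have [measurable]: "f \<in> borel_measurable borel"
    using assms(1) by (simp add: borel_measurable_integrable cong: measurable_cong_sets)
  have "integral\<^sup>L (uni A) f = (LINT x:A|lborel. f x)"
    unfolding uni_def set_lebesgue_integral_def by (subst integral_density) auto
  also have "\<dots> = integral A f"
    using assms(1) unfolding uni_def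
    by (intro set_borel_integral_eq_integral) (auto simp: set_integrable_def integrable_density)
  finally show ?thesis .
qed

lemma completion_ex_borel_measurable_euclidean_space:
  fixes g :: "'a \<Rightarrow> 'b::euclidean_space"
  assumes [measurable]: "g \<in> borel_measurable (completion M)"
  shows "\<exists>g'\<in>borel_measurable M. (AE x in M. g x = g' x)"
proof -
  have "\<forall>b. \<exists>h. h \<in> borel_measurable M \<and> (AE x in M. g x \<bullet> b = h x)"
    using completion_ex_borel_measurable_real[of "\<lambda>x. g x \<bullet> _" M] by (auto simp: Bex_def)
  then obtain h where h: "\<And>b. h b \<in> borel_measurable M" "\<And>b. AE x in M. g x \<bullet> b = h b x"
    by metis
  have "AE x in M. \<forall>b\<in>Basis. g x \<bullet> b = h b x"
    by (intro AE_finite_allI) (auto simp: h)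
  then have "AE x in M. g x = (\<Sum>b\<in>Basis. h b x *\<^sub>R b)"
  proof eventually_elim
    case (elim x)
    then have "(\<Sum>b\<in>Basis. h b x *\<^sub>R b) = (\<Sum>b\<in>Basis. (g x \<bullet> b) *\<^sub>R b)"
      by (intro sum.cong) auto
    then show ?case by (simp add: euclidean_representation)
  qed
  moreover have "(\<lambda>x. \<Sum>b\<in>Basis. h b x *\<^sub>R b) \<in> borel_measurable M"
    by (intro borel_measurable_sum borel_measurable_scaleR h(1) borel_measurable_const)
  ultimately show ?thesis by (rule rev_bexI[rotated])
qed

lemma measurable_on_borel_version:
  fixes f :: "'a::euclidean_space \<Rightarrow> 'b::euclidean_space"
  assumes "f measurable_on A" and A: "A \<in> sets borel"
  obtains f' where "f' \<in> borel_measurable borel" "AE x in uni A. f x = f' x"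
proof -
  have Al: "A \<in> sets lebesgue" using A by simp
  have "(\<lambda>x. if x \<in> A then f x else 0) \<in> borel_measurable lebesgue"
    by (rule iffD2[OF borel_measurable_if[OF Al] measurable_on_iff_borel_measurable[OF Al, THEN iffD1, OF assms(1)]])
  then obtain f' where f': "f' \<in> borel_measurable lborel" "AE x in lborel. (if x \<in> A then f x else 0) = f' x"
    using completion_ex_borel_measurable_euclidean_space by blast
  from f'(2) have "AE x in uni A. f x = f' x" unfolding AE_uni_iff[OF A] by eventually_elim auto
  then show ?thesis using f'(1) that by simp
qed

lemma absolutely_integrable_borel_version:
  fixes f :: "'a::euclidean_space \<Rightarrow> 'b::euclidean_space"
  assumes "f absolutely_integrable_on A" and A: "A \<in> sets borel"
  obtains f' where "f' \<in> borel_measurable borel" "AE x in uni A. f x = f' x" "integrable (uni A) f'"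
proof -
  have "f measurable_on A"
    using assms absolutely_integrable_measurable[of A f] by (simp add: measurable_on_iff_borel_measurable)
  then obtain f' where f': "f' \<in> borel_measurable borel" "AE x in uni A. f x = f' x"
    using measurable_on_borel_version[OF _ A] by blast
  have n: "negligible {x \<in> A. f x \<noteq> f' x}" using f'(2) negligible_iff_AE_uni[OF A, of "\<lambda>x. f x = f' x"] by simp
  have "f' absolutely_integrable_on A"
    by (rule absolutely_integrable_spike[OF assms(1) n]) auto
  then show ?thesis using f' that integrable_uni_iff[OF f'(1) A] by blast
qed

lemma integral_cong_AE_uni:
  assumes "AE x in uni A. f x = g x" "A \<in> sets borel"
  shows "integral A f = integral A g"
proof -
  have "negligible {x \<in> A. f x \<noteq> g x}" using assms negligible_iff_AE_uni[of A "\<lambda>x. f x = g x"] by simp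
  then show ?thesis by (rule integral_spike) auto
qed

section \<open>The fundamental lemma of the calculus of variations on the circle\<close>

text \<open>Boxes generate the Borel sets and are stable under intersection, and the sets over which
  \<open>f\<close> integrates to zero form a Dynkin system, complements being supplied by
  \<open>f0\<close>. Hence all Borel integrals vanish, and each component of \<open>f\<close> is the
  density of the zero measure.\<close>

lemma AE_zero_if_box_integrals_zero:
  fixes f :: "'a::euclidean_space \<Rightarrow> 'b::euclidean_space"
  assumes M: "sets M = sets borel" and f: "integrable M f" and f0: "integral\<^sup>L M f = 0"
    and box: "\<And>l u. (\<integral>x. indicator (box l u) x *\<^sub>R f x \<partial>M) = 0"
  shows "AE x in M. f x = 0"
proof -
  note [measurable_cong] = M
  have sp: "space M = UNIV" using M sets_eq_imp_space_eq[OF M] by simp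
  have ind: "integrable M (\<lambda>x. indicator A x *\<^sub>R f x)" if "A \<in> sets borel" for A
    using f that M by (intro integrable_mult_indicator) auto
  have zero: "(\<integral>x. indicator A x *\<^sub>R f x \<partial>M) = 0" if "A \<in> sets borel" for A
  proof -
    let ?E = "range (\<lambda>(a, b). box a b::'a set)"
    have "Int_stable ?E" by (auto simp: Int_stable_def box_Int_box)
    moreover have "?E \<subseteq> Pow UNIV" by auto
    moreover have "A \<in> sigma_sets UNIV ?E" using that by (simp add: borel_eq_box)
    ultimately show ?thesis
    proof (induction rule: sigma_sets_induct_disjoint)
      case (basic A) then show ?case using box by auto
    next
      case empty show ?case by simp
    next
      case (compl A)
      have A: "A \<in> sets borel" using compl by (simp add: borel_eq_box)
      have "(\<integral>x. indicator (UNIV - A) x *\<^sub>R f x \<partial>M) = (\<integral>x. f x - indicator A x *\<^sub>R f x \<partial>M)"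
        by (intro Bochner_Integration.integral_cong) (auto simp: indicator_def)
      then show ?case using f f0 ind[OF A] compl by simp
    next
      case (union A)
      have A: "A i \<in> sets borel" for i using union by (auto simp: borel_eq_box)
      have "(LINT x:(\<Union>i. A i)|M. f x) = (\<Sum>i. (LINT x:(A i)|M. f x))"
      proof (rule lebesgue_integral_countable_add)
        show "set_integrable M (\<Union>i. A i) f" unfolding set_integrable_def using A by (intro ind) auto
      qed (use A M union(1) in \<open>auto simp: disjoint_family_on_def\<close>)
      then show ?case using union(3) by (simp add: set_lebesgue_integral_def)
    qed
  qed
  have "AE x in M. f x \<bullet> b = 0" if "b \<in> Basis" for b
  proof (rule density_unique_real)
    show "integrable M (\<lambda>x. f x \<bullet> b)" "integrable M (\<lambda>x. 0 :: real)" using f by auto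
    fix A assume "A \<in> sets M"
    then have A: "A \<in> sets borel" using M by simp
    have "(LINT x:A|M. f x \<bullet> b) = (\<integral>x. (indicator A x *\<^sub>R f x) \<bullet> b \<partial>M)"
      by (simp add: set_lebesgue_integral_def)
    also have "\<dots> = 0" using ind[OF A] zero[OF A] by (subst integral_inner_left) auto
    finally show "(LINT x:A|M. f x \<bullet> b) = (LINT x:A|M. 0)" by simp
  qed
  then have "AE x in M. \<forall>b\<in>Basis. f x \<bullet> b = 0" by (intro AE_finite_allI) auto
  then show ?thesis by eventually_elim (rule euclidean_eqI, simp)
qed

text \<open>C1 functions of period 1 that approximate the indicator of an interval inside the unit
  interval. Shifting \<open>t\<close> by 1 flips the sign of both sines, so their product is
  periodic; squaring its positive part removes the kink, and \<open>1 - exp (- n * _)\<close>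
  saturates to 1 where that part is positive.\<close>

definition bump :: "real \<Rightarrow> real \<Rightarrow> nat \<Rightarrow> real \<Rightarrow> real" where
  "bump l u n t = 1 - exp (- (real n * (max 0 (sin (pi * (t - l)) * sin (pi * (u - t))))\<^sup>2))"

lemma max_0_square_deriv: "((\<lambda>y::real. (max 0 y)\<^sup>2) has_real_derivative 2 * max 0 y) (at y)"
proof -
  consider "y < 0" | "y > 0" | "y = 0" by linarith
  then show ?thesis
  proof cases
    case 1
    have "((\<lambda>y::real. 0) has_real_derivative 2 * max 0 y) (at y)" using 1 by simp
    then show ?thesis
      by (rule has_field_derivative_transform_within_open[of _ _ _ "{..<0}"]) (use 1 in auto)
  next
    case 2
    have "((\<lambda>y::real. y\<^sup>2) has_real_derivative 2 * max 0 y) (at y)" using 2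
      by (auto intro!: derivative_eq_intros)
    then show ?thesis
      by (rule has_field_derivative_transform_within_open[of _ _ _ "{0<..}"]) (use 2 in auto)
  next
    case 3
    have "((\<lambda>h::real. (max 0 h)\<^sup>2 / h) \<longlongrightarrow> 0) (at 0)"
    proof (rule tendsto_0_le[where K = 1])
      show "((\<lambda>h::real. h) \<longlongrightarrow> 0) (at 0)" by (rule tendsto_ident_at)
      show "\<forall>\<^sub>F h::real in at 0. norm ((max 0 h)\<^sup>2 / h) \<le> norm h * 1"
        by (intro always_eventually allI) (auto simp: max_def power2_eq_square)
    qed
    then show ?thesis using 3 by (simp add: DERIV_def)
  qed
qed

lemma test1_bump: "\<exists>d. test1 (bump l u n) d"
proof -
  let ?s = "\<lambda>t. sin (pi * (t - l)) * sin (pi * (u - t))"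
  let ?s' = "\<lambda>t. pi * cos (pi * (t - l)) * sin (pi * (u - t)) - pi * cos (pi * (u - t)) * sin (pi * (t - l))"
  let ?d = "\<lambda>t. exp (- (real n * (max 0 (?s t))\<^sup>2)) * (real n * (2 * max 0 (?s t) * ?s' t))"
  have per: "bump l u n (t + 1) = bump l u n t" for t
  proof -
    have "sin (pi * (t + 1 - l)) = - sin (pi * (t - l))"
      using sin_periodic_pi[of "pi * (t - l)"] by (simp add: algebra_simps)
    moreover have "sin (pi * (u - (t + 1))) = - sin (pi * (u - t))"
      using sin_periodic_pi[of "pi * (u - (t + 1))"] by (simp add: algebra_simps)
    ultimately show ?thesis by (simp add: bump_def)
  qed
  have s: "(?s has_real_derivative ?s' t) (at t)" for t
    by (auto intro!: derivative_eq_intros simp: algebra_simps)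
  have "((\<lambda>t. (max 0 (?s t))\<^sup>2) has_real_derivative 2 * max 0 (?s t) * ?s' t) (at t)" for t
    using DERIV_chain2[OF max_0_square_deriv s] .
  moreover have "((\<lambda>t. 1 - exp (- (real n * p t))) has_real_derivative exp (- (real n * p t)) * (real n * p')) (at t)"
    if "(p has_real_derivative p') (at t)" for p p' t
    using that by (auto intro!: derivative_eq_intros)
  ultimately have "(bump l u n has_real_derivative ?d t) (at t)" for t
    unfolding bump_def by blast
  moreover have "continuous_on UNIV ?d" by (intro continuous_intros)
  ultimately have "test1 (bump l u n) ?d" using per unfolding test1_def by blast
  then show ?thesis by blast
qed

lemma bump_bounds: "0 \<le> bump l u n t" "bump l u n t \<le> 1"
  by (auto simp: bump_def)

text \<open>On the unit interval the product of the two sines is positive strictly between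
  \<open>l\<close> and \<open>u\<close> and at most zero elsewhere; in the second case the bump is
  exactly 0 for every \<open>n\<close>.\<close>

lemma bump_tendsto:
  assumes "0 \<le> l" "u \<le> 1" "0 \<le> t" "t \<le> 1" "l \<le> u"
  shows "(\<lambda>n. bump l u n t) \<longlonglongrightarrow> indicator {l<..<u} t"
proof (cases "l < t \<and> t < u")
  case True
  let ?p = "(max 0 (sin (pi * (t - l)) * sin (pi * (u - t))))\<^sup>2"
  have "0 < sin (pi * (t - l))" "0 < sin (pi * (u - t))"
    using True assms by (auto intro!: sin_gt_zero)
  then have p: "?p > 0" by simp
  have "filterlim (\<lambda>n. real n * ?p) at_top sequentially"
    using filterlim_tendsto_pos_mult_at_top[OF tendsto_const p filterlim_real_sequentially]
    by (simp add: mult.commute)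
  then have "(\<lambda>n. exp (- (real n * ?p))) \<longlonglongrightarrow> 0"
    using filterlim_compose[OF exp_at_bot] filterlim_uminus_at_top by blast
  then have "(\<lambda>n. 1 - exp (- (real n * ?p))) \<longlonglongrightarrow> 1 - 0" by (intro tendsto_intros)
  then show ?thesis using True by (simp add: bump_def)
next
  case False
  have "sin (pi * (t - l)) * sin (pi * (u - t)) \<le> 0"
  proof (cases "t \<le> l")
    case True
    have "0 \<le> sin (pi * (l - t))" "0 \<le> sin (pi * (u - t))"
      using True assms by (auto intro!: sin_ge_zero mult_nonneg_nonneg simp: mult_le_cancel_left1 simp del: minus_diff_eq)
    moreover have "sin (pi * (t - l)) = - sin (pi * (l - t))" 
      by (metis minus_diff_eq mult_minus_right sin_minus)
    ultimately show ?thesis by simp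
  next
    case F: False
    have "0 \<le> sin (pi * (t - l))" "0 \<le> sin (pi * (t - u))"
      using F False assms by (auto intro!: sin_ge_zero mult_nonneg_nonneg simp: mult_le_cancel_left1 simp del: minus_diff_eq)
    moreover have "sin (pi * (u - t)) = - sin (pi * (t - u))"
      by (metis minus_diff_eq mult_minus_right sin_minus)
    ultimately show ?thesis by simp
  qed
  then have "bump l u n t = 0" for n by (simp add: bump_def)
  then show ?thesis using False by simp
qed

lemma test1_continuous: "test1 \<phi> d \<Longrightarrow> continuous_on UNIV \<phi>"
  unfolding test1_def by (meson DERIV_isCont continuous_at_imp_continuous_on)

lemma test1_measurable: "test1 \<phi> d \<Longrightarrow> \<phi> \<in> borel_measurable borel" "test1 \<phi> d \<Longrightarrow> d \<in> borel_measurable borel"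
  by (erule borel_measurable_continuous_onI[OF test1_continuous])
     (simp add: borel_measurable_continuous_onI test1_def)

lemma periodic_continuous_bounded:
  fixes f :: "real \<Rightarrow> real"
  assumes "continuous_on UNIV f" "\<And>x. f (x + 1) = f x"
  obtains B where "\<And>x. \<bar>f x\<bar> \<le> B"
proof -
  have "bounded (f ` {0..1})"
    using assms(1) by (intro compact_imp_bounded compact_continuous_image) (auto intro: continuous_on_subset)
  then obtain B where "\<forall>y\<in>f ` {0..1}. norm y \<le> B" unfolding bounded_iff by blast
  then have B: "\<bar>f x\<bar> \<le> B" if "x \<in> {0..1}" for x using that by simp
  have n: "f (x + real k) = f x" for x k
  proof (induction k)
    case (Suc k)
    have "f (x + real (Suc k)) = f ((x + real k) + 1)" by (simp add: add_ac)
    also have "\<dots> = f x" using Suc by (simp only: assms(2))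
    finally show ?case .
  qed simp
  have frac: "f x = f (frac x)" for x
  proof (cases "\<lfloor>x\<rfloor> \<ge> 0")
    case True
    then show ?thesis using n[of "frac x" "nat \<lfloor>x\<rfloor>"] by (simp add: frac_def)
  next
    case False
    then show ?thesis using n[of x "nat (-\<lfloor>x\<rfloor>)"] by (simp add: frac_def)
  qed
  have "\<bar>f x\<bar> \<le> B" for x
    unfolding frac[of x] by (rule B) (simp add: frac_ge_0 less_imp_le[OF frac_lt_1])
  then show ?thesis by (rule that)
qed

lemma test1_bounded:
  assumes "test1 \<phi> d" obtains B where "\<And>x. \<bar>\<phi> x\<bar> \<le> B"
  using periodic_continuous_bounded[OF test1_continuous[OF assms]] assms unfolding test1_def by metis

lemma test1_const: "test1 (\<lambda>x. c) (\<lambda>x. 0)"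
  by (auto simp: test1_def)


abbreviation "u01 \<equiv> uni {0..1::real}"

lemma AE_u01: "AE x in u01. 0 < x \<and> x < 1"
proof -
  have "AE x in lborel. x \<noteq> (0::real)" "AE x in lborel. x \<noteq> (1::real)" by (rule AE_lborel_singleton)+
  then have "AE x in lborel. x \<in> {0..1} \<longrightarrow> 0 < x \<and> x < (1::real)"
    by eventually_elim auto
  then show ?thesis by (subst AE_uni_iff) auto
qed

text \<open>The constant test function gives total integral zero, and bumps give the integrals over
  intervals by dominated convergence. An arbitrary interval is first clipped to the unit interval,
  which changes nothing almost everywhere.\<close>

lemma AE_zero_if_test1_integrals_zero:
  fixes f :: "real \<Rightarrow> 'b::euclidean_space"
  assumes f: "integrable u01 f"
    and zero: "\<And>\<phi> d. test1 \<phi> d \<Longrightarrow> (\<integral>x. \<phi> x *\<^sub>R f x \<partial>u01) = 0"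
  shows "AE x in u01. f x = 0"
proof (rule AE_zero_if_box_integrals_zero)
  have fm[measurable]: "f \<in> borel_measurable borel"
    using f by (simp add: borel_measurable_integrable cong: measurable_cong_sets)
  show "(\<integral>x. f x \<partial>u01) = 0" using zero[OF test1_const[of 1]] by simp
  have ind: "(\<integral>x. indicator {l<..<u} x *\<^sub>R f x \<partial>u01) = 0" if lu: "0 \<le> l" "l \<le> u" "u \<le> 1" for l u :: real
  proof -
    have [measurable]: "bump l u n \<in> borel_measurable borel" for n
      using test1_bump[of l u n] test1_measurable by blast
    have "(\<lambda>n. \<integral>x. bump l u n x *\<^sub>R f x \<partial>u01) \<longlonglongrightarrow> (\<integral>x. indicator {l<..<u} x *\<^sub>R f x \<partial>u01)"
    proof (rule integral_dominated_convergence[where w = "\<lambda>x. norm (f x)"])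
      show "AE x in u01. (\<lambda>n. bump l u n x *\<^sub>R f x) \<longlonglongrightarrow> indicator {l<..<u} x *\<^sub>R f x"
        using AE_u01 by eventually_elim (intro tendsto_scaleR bump_tendsto tendsto_const, use lu in auto)
      show "AE x in u01. norm (bump l u n x *\<^sub>R f x) \<le> norm (f x)" for n
        using bump_bounds[of l u n] by (auto simp: mult_left_le_one_le)
    qed (use f in auto)
    moreover have "(\<integral>x. bump l u n x *\<^sub>R f x \<partial>u01) = 0" for n
      using test1_bump zero by blast
    ultimately show ?thesis by (simp add: LIMSEQ_const_iff)
  qed
  fix l u :: real
  let ?l = "max 0 l" and ?u = "min 1 u"
  have "(\<integral>x. indicator (box l u) x *\<^sub>R f x \<partial>u01) = (\<integral>x. indicator {?l<..<?u} x *\<^sub>R f x \<partial>u01)"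
  proof (rule integral_cong_AE)
    show "AE x in u01. indicator (box l u) x *\<^sub>R f x = indicator {?l<..<?u} x *\<^sub>R f x"
      using AE_u01 by eventually_elim (auto simp: indicator_def box_real)
  qed auto
  also have "\<dots> = 0"
  proof (cases "?l \<le> ?u")
    case True then show ?thesis by (intro ind) auto
  next
    case False
    then have "{?l<..<?u} = {}" by auto
    then show ?thesis by simp
  qed
  finally show "(\<integral>x. indicator (box l u) x *\<^sub>R f x \<partial>u01) = 0" .
qed (use f in simp_all)

lemma mem_cube: "x \<in> (cube :: (real^'n) set) \<longleftrightarrow> (\<forall>i. 0 \<le> x $ i \<and> x $ i \<le> 1)"
proof -
  have "\<forall>b\<in>Basis. (One :: real^'n) \<bullet> b = 1" by (simp add: inner_sum_left_Basis)
  then show ?thesis by (auto simp: cube_def mem_box Basis_vec_def inner_axis)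
qed

lemma cube_borel[measurable]: "cube \<in> sets borel"
  by (simp add: cube_def)

section \<open>The cube and integration along coordinate lines\<close>

abbreviation "ucube \<equiv> uni (cube :: (real^'n::finite) set)"

lemma vec_nth_borel[measurable]: "(\<lambda>x::real^'n. x $ i) \<in> borel_measurable borel"
  by (intro borel_measurable_continuous_onI continuous_intros)

lemma emeasure_uni:
  assumes [measurable]: "A \<in> sets borel" "B \<in> sets borel"
  shows "emeasure (uni A) B = emeasure lborel (A \<inter> B)"
  unfolding uni_def
  by (subst emeasure_density) (auto simp: indicator_inter_arith[symmetric] ennreal_indicator simp flip: indicator_inter_arith)

text \<open>This is the product structure of \<open>ucube\<close> on a generator. Boxes with an
  empty side need the case distinction, because a product of side lengths with two negative factors
  would be positive.\<close>

lemma emeasure_ucube_cbox: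
  fixes l u :: "real^'n::finite"
  shows "emeasure ucube (cbox l u) = (\<Prod>k\<in>UNIV. emeasure u01 {l $ k..u $ k})"
proof -
  let ?l = "\<chi> k. max 0 (l $ k)" and ?u = "\<chi> k. min 1 (u $ k)"
  have 1: "emeasure u01 {l $ k..u $ k} = ennreal (if ?l $ k \<le> ?u $ k then ?u $ k - ?l $ k else 0)" for k
  proof -
    have "{0..1} \<inter> {l $ k..u $ k} = {?l $ k..?u $ k}" by auto
    then show ?thesis by (simp add: emeasure_uni emeasure_lborel_Icc_eq)
  qed
  have "cube \<inter> cbox l u = cbox ?l ?u"
    by (auto simp: mem_cube mem_box_cart)
  then have "emeasure ucube (cbox l u) = emeasure lborel (cbox ?l ?u)"
    by (simp add: emeasure_uni)
  also have "\<dots> = ennreal (if \<forall>k. ?l $ k \<le> ?u $ k then \<Prod>k\<in>UNIV. ?u $ k - ?l $ k else 0)"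
  proof -
    have ax: "(\<lambda>k. axis k (1::real) :: real^'n) ` UNIV = Basis" "inj (\<lambda>k. axis k (1::real) :: real^'n)"
      by (auto simp: Basis_vec_def inj_def axis_eq_axis)
    have "(\<Prod>b\<in>Basis. (?u - ?l) \<bullet> b) = (\<Prod>k\<in>UNIV. ?u $ k - ?l $ k)"
      unfolding ax(1)[symmetric] by (subst prod.reindex[OF ax(2)]) (simp add: inner_axis)
    moreover have "(\<forall>b\<in>Basis. ?l \<bullet> b \<le> ?u \<bullet> b) \<longleftrightarrow> (\<forall>k. ?l $ k \<le> ?u $ k)"
      unfolding ax(1)[symmetric] by (simp add: inner_axis)
    ultimately show ?thesis by (simp add: emeasure_lborel_cbox_eq)
  qed
  also have "\<dots> = (\<Prod>k\<in>UNIV. ennreal (if ?l $ k \<le> ?u $ k then ?u $ k - ?l $ k else 0))"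
  proof (cases "\<forall>k. ?l $ k \<le> ?u $ k")
    case True
    then have "(\<Prod>k\<in>UNIV. ennreal (if ?l $ k \<le> ?u $ k then ?u $ k - ?l $ k else 0)) = (\<Prod>k\<in>UNIV. ennreal (?u $ k - ?l $ k))"
      by (intro prod.cong) auto
    also have "\<dots> = ennreal (\<Prod>k\<in>UNIV. ?u $ k - ?l $ k)"
      using True by (intro prod_ennreal) auto
    finally show ?thesis using True by simp
  next
    case False
    then obtain k where "\<not> ?l $ k \<le> ?u $ k" by blast
    then have "(\<Prod>k\<in>UNIV. ennreal (if ?l $ k \<le> ?u $ k then ?u $ k - ?l $ k else 0)) = 0"
      by (intro prod_zero bexI[of _ k]) auto
    then show ?thesis using False by (simp only: if_False ennreal_0)
  qed
  finally show ?thesis by (simp only: 1)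
qed

lemma prob_space_u01: "prob_space u01"
  by (rule prob_spaceI) (simp add: emeasure_uni)

lemma prob_space_ucube: "prob_space (ucube :: (real^'n::finite) measure)"
proof (rule prob_spaceI)
  have "emeasure ucube (cube :: (real^'n) set) = (\<Prod>k\<in>(UNIV::'n set). emeasure u01 {0..1})"
  proof -
    have c: "cbox (0 :: real^'n) (\<chi> k. 1) = cube" by (auto simp: mem_cube mem_box_cart)
    show ?thesis using emeasure_ucube_cbox[of "0 :: real^'n" "\<chi> k. 1"] by (simp add: c)
  qed
  then show "emeasure ucube (space (ucube :: (real^'n) measure)) = 1"
    by (simp add: emeasure_uni)
qed

text \<open>Overwriting one coordinate takes the place of splitting the space into a line and its
  complement: the dimension stays the same, in agreement with the dummy coordinate in
  \<open>dens\<close>.\<close>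

definition vupd :: "'n \<Rightarrow> real^'n \<Rightarrow> real \<Rightarrow> real^'n::finite" where
  "vupd i y t = (\<chi> k. if k = i then t else y $ k)"

lemma vupd_nth[simp]: "vupd i y t $ k = (if k = i then t else y $ k)"
  by (simp add: vupd_def)

lemma vupd_vupd[simp]: "vupd i (vupd i y t) s = vupd i y s"
  by (simp add: vec_eq_iff)

lemma vupd_same[simp]: "vupd i y (y $ i) = y"
  by (simp add: vec_eq_iff)

lemma borel_measurable_vec_lambda:
  assumes "\<And>k. (\<lambda>x. f x $ k) \<in> borel_measurable M"
  shows "f \<in> M \<rightarrow>\<^sub>M (borel :: (real^'n::finite) measure)"
  by (subst borel_measurable_euclidean_space) (auto simp: Basis_vec_def inner_axis assms)

lemma vupd_measurable[measurable]:
  assumes [measurable]: "f \<in> M \<rightarrow>\<^sub>M borel" "g \<in> borel_measurable M"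
  shows "(\<lambda>x. vupd i (f x) (g x)) \<in> M \<rightarrow>\<^sub>M borel"
proof (rule borel_measurable_vec_lambda)
  fix k show "(\<lambda>x. vupd i (f x) (g x) $ k) \<in> borel_measurable M"
    by (cases "k = i") (auto intro: measurable_compose[OF assms(1) vec_nth_borel])
qed

interpretation u01: prob_space u01 by (rule prob_space_u01)
interpretation ucube: prob_space "ucube :: (real^'n::finite) measure" by (rule prob_space_ucube)
interpretation u01_ucube: pair_prob_space u01 "ucube :: (real^'n::finite) measure" ..

text \<open>Overwriting one coordinate of a uniform point by an independent uniform number gives
  again a uniform point. It is enough to compare measures of boxes, where both sides are products
  over the coordinates.\<close>

lemma distr_vupd:
  "distr (u01 \<Otimes>\<^sub>M (ucube :: (real^'n::finite) measure)) borel (\<lambda>(t, y). vupd i y t) = ucube"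
proof -
  let ?P = "u01 \<Otimes>\<^sub>M (ucube :: (real^'n) measure)" and ?T = "\<lambda>(t, y). vupd i y t"
  let ?E = "range (\<lambda>(a, b). {a..b} :: (real^'n) set)"
  have T[measurable]: "?T \<in> ?P \<rightarrow>\<^sub>M borel" by measurable
  have "ucube = distr ?P borel ?T"
  proof (rule measure_eqI_generator_eq)
    have Int: "{a..b} \<inter> {c..d} = {(\<chi> k. max (a $ k) (c $ k))..(\<chi> k. min (b $ k) (d $ k))}" for a b c d :: "real^'n"
      by (auto simp: less_eq_vec_def)
    show "Int_stable ?E"
    proof (rule Int_stableI)
      fix X Y :: "(real^'n) set" assume "X \<in> ?E" "Y \<in> ?E"
      then obtain a b c d where "X = {a..b}" "Y = {c..d}" by auto
      then show "X \<inter> Y \<in> ?E" using Int[of a b c d] by (metis (no_types, lifting) case_prod_conv rangeI)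
    qed
    have bs: "sets (borel :: (real^'n) measure) = sigma_sets UNIV ?E"
      by (subst borel_eq_atLeastAtMost) (simp add: sets_measure_of)
    show "?E \<subseteq> Pow UNIV" "sets (ucube :: (real^'n) measure) = sigma_sets UNIV ?E"
      "sets (distr ?P borel ?T) = sigma_sets UNIV ?E"
      unfolding sets_uni sets_distr bs by blast (rule refl)+
    let ?A = "\<lambda>n::nat. cbox (- (real n *\<^sub>R One)) (real n *\<^sub>R One) :: (real^'n) set"
    show "range ?A \<subseteq> ?E"
    proof (rule image_subsetI)
      fix n show "?A n \<in> ?E"
        by (rule range_eqI[where x = "(- (real n *\<^sub>R One), real n *\<^sub>R One)"]) (simp only: case_prod_conv interval_cbox)
    qed
    have "box (- (real n *\<^sub>R One)) (real n *\<^sub>R One) \<subseteq> ?A n" for n by (rule box_subset_cbox)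
    then have "(\<Union>n::nat. box (- (real n *\<^sub>R One)) (real n *\<^sub>R One) :: (real^'n) set) \<subseteq> (\<Union>i. ?A i)" by (rule UN_mono[OF order_refl])
    then show "(\<Union>i. ?A i) = UNIV" unfolding UN_box_eq_UNIV by (rule top.extremum_uniqueI)
    show "emeasure ucube (?A n) \<noteq> \<infinity>" for n using ucube.emeasure_finite by simp
    fix X assume "X \<in> ?E"
    then obtain l u where X: "X = cbox l u" by (auto simp: interval_cbox)
    \<comment> \<open>The discarded coordinate of \<open>y\<close> is left free in the unit
      interval. Since \<open>y\<close> lies in the cube only almost surely, the preimage and the
      rectangle agree only almost everywhere.\<close>
    let ?l = "vupd i l 0" and ?u = "vupd i u 1"
    have "emeasure (distr ?P borel ?T) (cbox l u) = emeasure ?P (?T -` cbox l u \<inter> space ?P)"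
      by (rule emeasure_distr) auto
    also have "\<dots> = emeasure ?P ({l $ i..u $ i} \<times> cbox ?l ?u)"
    proof (rule emeasure_eq_AE)
      have "AE y in (ucube :: (real^'n) measure). y \<in> cube" by (simp add: AE_uni_iff)
      moreover have "{p \<in> space ?P. snd p \<in> (cube :: (real^'n) set)} \<in> sets ?P" by measurable
      ultimately have "AE p in ?P. snd p \<in> (cube :: (real^'n) set)"
        by (intro u01_ucube.AE_pair_measure) simp_all
      then show "AE p in ?P. p \<in> ?T -` cbox l u \<inter> space ?P \<longleftrightarrow> p \<in> {l $ i..u $ i} \<times> cbox ?l ?u"
        by eventually_elim (auto simp: mem_box_cart mem_cube space_pair_measure split: if_splits)
      show "?T -` cbox l u \<inter> space ?P \<in> sets ?P" by (rule measurable_sets[OF T]) simp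
      show "{l $ i..u $ i} \<times> cbox ?l ?u \<in> sets ?P" by (intro pair_measureI) simp_all
    qed
    also have "\<dots> = emeasure u01 {l $ i..u $ i} * emeasure ucube (cbox ?l ?u)"
      by (rule ucube.emeasure_pair_measure_Times) auto
    also have "emeasure ucube (cbox ?l ?u) = (\<Prod>k\<in>UNIV - {i}. emeasure u01 {l $ k..u $ k})"
    proof -
      have "emeasure ucube (cbox ?l ?u) = (\<Prod>k\<in>insert i (UNIV - {i}). emeasure u01 {?l $ k..?u $ k})"
        by (simp add: emeasure_ucube_cbox insert_absorb)
      also have "\<dots> = (\<Prod>k\<in>UNIV - {i}. emeasure u01 {?l $ k..?u $ k})"
        by (subst prod.insert) (auto simp: emeasure_uni)
      also have "\<dots> = (\<Prod>k\<in>UNIV - {i}. emeasure u01 {l $ k..u $ k})"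
        by (rule prod.cong) auto
      finally show ?thesis .
    qed
    also have "emeasure u01 {l $ i..u $ i} * \<dots> = (\<Prod>k\<in>insert i (UNIV - {i}). emeasure u01 {l $ k..u $ k})"
      by (subst prod.insert) auto
    also have "\<dots> = emeasure ucube (cbox l u)" by (simp add: emeasure_ucube_cbox insert_absorb)
    finally show "emeasure ucube X = emeasure (distr ?P borel ?T) X" using X by simp
  qed
  then show ?thesis by simp
qed

lemma AE_vupd:
  fixes P :: "real^'n::finite \<Rightarrow> bool"
  assumes "AE x in ucube. P x"
  shows "AE t in u01. AE y in ucube. P (vupd i y t)" "AE y in ucube. AE t in u01. P (vupd i y t)"
proof -
  have "AE x in distr (u01 \<Otimes>\<^sub>M (ucube :: (real^'n) measure)) borel (\<lambda>(t, y). vupd i y t). P x"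
    using assms unfolding distr_vupd .
  then have *: "AE p in u01 \<Otimes>\<^sub>M (ucube :: (real^'n) measure). P (case p of (t, y) \<Rightarrow> vupd i y t)"
    by (rule AE_distrD[rotated]) measurable
  show "AE t in u01. AE y in ucube. P (vupd i y t)"
    using u01_ucube.AE_pair[OF *] by simp
  interpret Q: pair_sigma_finite "ucube :: (real^'n) measure" u01 ..
  have "AE p in (ucube :: (real^'n) measure) \<Otimes>\<^sub>M u01. P (case (case p of (y, t) \<Rightarrow> (t, y)) of (t, y) \<Rightarrow> vupd i y t)"
  proof (rule AE_distrD[where M' = "u01 \<Otimes>\<^sub>M (ucube :: (real^'n) measure)"])
    show "AE p in distr ((ucube :: (real^'n) measure) \<Otimes>\<^sub>M u01) (u01 \<Otimes>\<^sub>M ucube) (\<lambda>(y, t). (t, y)). P (case p of (t, y) \<Rightarrow> vupd i y t)"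
      using * unfolding u01_ucube.distr_pair_swap[symmetric] .
  qed simp
  from Q.AE_pair[OF this] show "AE y in ucube. AE t in u01. P (vupd i y t)" by simp
qed

text \<open>Fubini for one coordinate against all others, read off from \<open>distr_vupd\<close>;
  the integrand ignores the coordinate \<open>y $ i\<close>, over which a probability measure is
  integrated.\<close>

lemma integral_vupd:
  fixes F :: "real^'n::finite \<Rightarrow> 'b::{banach, second_countable_topology}"
  assumes F: "integrable ucube F"
  shows "integrable (u01 \<Otimes>\<^sub>M (ucube :: (real^'n) measure)) (\<lambda>(t, y). F (vupd i y t))"
    and "integral\<^sup>L ucube F = (\<integral>t. \<integral>y. F (vupd i y t) \<partial>ucube \<partial>u01)"
    and "integral\<^sup>L ucube F = (\<integral>y. \<integral>t. F (vupd i y t) \<partial>u01 \<partial>ucube)"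
    and "AE t in u01. integrable ucube (\<lambda>y. F (vupd i y t))"
    and "AE y in ucube. integrable u01 (\<lambda>t. F (vupd i y t))"
    and "integrable u01 (\<lambda>t. \<integral>y. F (vupd i y t) \<partial>ucube)"
    and "integrable ucube (\<lambda>y. \<integral>t. F (vupd i y t) \<partial>u01)"
proof -
  let ?P = "u01 \<Otimes>\<^sub>M (ucube :: (real^'n) measure)" and ?T = "\<lambda>(t, y). vupd i y t"
  have [measurable]: "F \<in> borel_measurable borel"
    using F by (simp add: borel_measurable_integrable cong: measurable_cong_sets)
  have "integrable (distr ?P borel ?T) F" using F by (simp add: distr_vupd)
  then have "integrable ?P (\<lambda>p. F (?T p))" by (subst (asm) integrable_distr_eq) auto
  then show 1: "integrable ?P (\<lambda>(t, y). F (vupd i y t))" by (simp add: case_prod_beta')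
  have "integral\<^sup>L ucube F = integral\<^sup>L (distr ?P borel ?T) F" by (simp add: distr_vupd)
  also have "\<dots> = (\<integral>p. F (?T p) \<partial>?P)" by (subst integral_distr) auto
  finally have 2: "integral\<^sup>L ucube F = (\<integral>(t, y). F (vupd i y t) \<partial>?P)" by (simp add: case_prod_beta')
  show "integral\<^sup>L ucube F = (\<integral>t. \<integral>y. F (vupd i y t) \<partial>ucube \<partial>u01)"
    using u01_ucube.integral_fst'[OF 1] 2 by simp
  show "integral\<^sup>L ucube F = (\<integral>y. \<integral>t. F (vupd i y t) \<partial>u01 \<partial>ucube)"
    using u01_ucube.integral_snd[OF 1] 2 by simp
  show "AE t in u01. integrable ucube (\<lambda>y. F (vupd i y t))"
    using u01_ucube.AE_integrable_fst'[OF 1] by simp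
  show "AE y in ucube. integrable u01 (\<lambda>t. F (vupd i y t))"
    using u01_ucube.AE_integrable_snd[OF 1] by simp
  show "integrable u01 (\<lambda>t. \<integral>y. F (vupd i y t) \<partial>ucube)"
    using u01_ucube.integrable_fst'[OF 1] by simp
  show "integrable ucube (\<lambda>y. \<integral>t. F (vupd i y t) \<partial>u01)"
    using u01_ucube.integrable_snd[OF 1] by simp
qed


section \<open>Cauchy-Schwarz and functions of product form\<close>

lemma integrable_mult_L2:
  fixes f g :: "'a \<Rightarrow> real"
  assumes [measurable]: "f \<in> borel_measurable M" "g \<in> borel_measurable M"
    and i: "integrable M (\<lambda>x. (f x)\<^sup>2)" "integrable M (\<lambda>x. (g x)\<^sup>2)"
  shows "integrable M (\<lambda>x. f x * g x)"
proof (rule Bochner_Integration.integrable_bound[where f = "\<lambda>x. (f x)\<^sup>2 + (g x)\<^sup>2"])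
  have "\<bar>f x * g x\<bar> \<le> (f x)\<^sup>2 + (g x)\<^sup>2" for x
  proof -
    have "2 * \<bar>f x\<bar> * \<bar>g x\<bar> \<le> \<bar>f x\<bar>\<^sup>2 + \<bar>g x\<bar>\<^sup>2" by (rule sum_squares_bound)
    moreover have "0 \<le> \<bar>f x\<bar> * \<bar>g x\<bar>" by simp
    ultimately show ?thesis unfolding abs_mult power2_abs by linarith
  qed
  then show "AE x in M. norm (f x * g x) \<le> norm ((f x)\<^sup>2 + (g x)\<^sup>2)" by simp
qed (use i in auto)

lemma Cauchy_Schwarz_integral:
  fixes f g :: "'a \<Rightarrow> real"
  assumes m: "f \<in> borel_measurable M" "g \<in> borel_measurable M"
    and i: "integrable M (\<lambda>x. (f x)\<^sup>2)" "integrable M (\<lambda>x. (g x)\<^sup>2)"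
  shows "(\<integral>x. f x * g x \<partial>M)\<^sup>2 \<le> (\<integral>x. (f x)\<^sup>2 \<partial>M) * (\<integral>x. (g x)\<^sup>2 \<partial>M)"
proof -
  define A B C where "A = (\<integral>x. (f x)\<^sup>2 \<partial>M)" and "B = (\<integral>x. f x * g x \<partial>M)" and "C = (\<integral>x. (g x)\<^sup>2 \<partial>M)"
  have fg: "integrable M (\<lambda>x. f x * g x)" by (rule integrable_mult_L2[OF m i])
  have quad: "0 \<le> A - 2 * s * B + s\<^sup>2 * C" for s
  proof -
    have "(\<integral>x. (f x - s * g x)\<^sup>2 \<partial>M) = (\<integral>x. (f x)\<^sup>2 - (2 * s) * (f x * g x) + s\<^sup>2 * (g x)\<^sup>2 \<partial>M)"
      by (intro Bochner_Integration.integral_cong) (auto simp: power2_eq_square algebra_simps)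
    also have "\<dots> = A - 2 * s * B + s\<^sup>2 * C"
      using i fg by (simp add: A_def B_def C_def)
    finally have "(\<integral>x. (f x - s * g x)\<^sup>2 \<partial>M) = A - 2 * s * B + s\<^sup>2 * C" .
    moreover have "0 \<le> (\<integral>x. (f x - s * g x)\<^sup>2 \<partial>M)" by simp
    ultimately show ?thesis by simp
  qed
  have C: "C \<ge> 0" by (simp add: C_def)
  show ?thesis
  proof (cases "C = 0")
    case True
    have "B = 0"
    proof (rule ccontr)
      assume "B \<noteq> 0"
      \<comment> \<open>With \<open>C = 0\<close> the quadratic is affine in \<open>s\<close>, and
        this \<open>s\<close> gives it the value -1.\<close>
      then show False using quad[of "(A + 1) / (2 * B)"] True by simp
    qed
    then show ?thesis using True by (simp add: A_def B_def C_def)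
  next
    case False
    then have "C > 0" using C by simp
    moreover note quad[of "B / C"]
    ultimately have "0 \<le> A - B\<^sup>2 / C" by (simp add: power2_eq_square)
    then have "B\<^sup>2 \<le> A * C" using \<open>C > 0\<close> by (simp add: field_simps)
    then show ?thesis by (simp add: A_def B_def C_def)
  qed
qed

text \<open>Coordinates are independent under \<open>ucube\<close>. The induction splits off one
  coordinate at a time, along which the remaining product is constant because \<open>k\<close> is
  not in \<open>S\<close>.\<close>

lemma integral_prod_ucube:
  fixes f :: "'n::finite \<Rightarrow> real \<Rightarrow> 'a::{real_normed_field, banach, second_countable_topology}"
  assumes f: "\<And>k. k \<in> S \<Longrightarrow> integrable u01 (f k)"
  shows "integrable ucube (\<lambda>x. \<Prod>k\<in>S. f k (x $ k))"
    and "(\<integral>x. (\<Prod>k\<in>S. f k (x $ k)) \<partial>ucube) = (\<Prod>k\<in>S. \<integral>t. f k t \<partial>u01)"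
proof -
  have "finite S" by simp
  from this f have "integrable ucube (\<lambda>x. \<Prod>k\<in>S. f k (x $ k)) \<and>
      (\<integral>x. (\<Prod>k\<in>S. f k (x $ k)) \<partial>ucube) = (\<Prod>k\<in>S. \<integral>t. f k t \<partial>u01)"
  proof (induction S)
    case empty
    then show ?case by (simp add: ucube.prob_space[simplified])
  next
    case (insert k S)
    let ?P = "\<lambda>x :: real^'n. \<Prod>k\<in>S. f k (x $ k)"
    let ?F = "\<lambda>x :: real^'n. f k (x $ k) * ?P x"
    have Pi: "integrable ucube ?P" and Pe: "(\<integral>x. ?P x \<partial>ucube) = (\<Prod>k\<in>S. \<integral>t. f k t \<partial>u01)" using insert by auto
    have fk: "integrable u01 (f k)" using insert by auto
    have m[measurable]: "f k \<in> borel_measurable borel" "?P \<in> borel_measurable borel"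
      using fk Pi by (auto simp: borel_measurable_integrable cong: measurable_cong_sets)
    have "?P (vupd k y t) = ?P y" for y t
      using insert by (intro prod.cong) auto
    then have eq: "?F (vupd k y t) = f k t * ?P y" for y t by simp
    have "integrable (u01 \<Otimes>\<^sub>M ucube) (\<lambda>(t, y). f k t * ?P y)"
    proof (rule u01_ucube.Fubini_integrable)
      show "integrable u01 (\<lambda>t. \<integral>y. norm (case (t, y) of (t, y) \<Rightarrow> f k t * ?P y) \<partial>ucube)"
        using fk by (simp add: norm_mult)
      show "AE t in u01. integrable ucube (\<lambda>y. case (t, y) of (t, y) \<Rightarrow> f k t * ?P y)"
        using Pi by simp
    qed measurable
    then have pair: "integrable (u01 \<Otimes>\<^sub>M ucube) (\<lambda>p. ?F (case p of (t, y) \<Rightarrow> vupd k y t))"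
      by (simp add: case_prod_beta' eq del: vupd_nth)
    have Fm: "?F \<in> borel_measurable borel" by measurable
    have "integrable (distr (u01 \<Otimes>\<^sub>M ucube) borel (\<lambda>(t, y). vupd k y t)) ?F"
      by (subst integrable_distr_eq) (use pair Fm in \<open>simp_all add: case_prod_beta'\<close>)
    then have Fi: "integrable ucube ?F" unfolding distr_vupd .
    have "(\<integral>x. ?F x \<partial>ucube) = (\<integral>t. \<integral>y. f k t * ?P y \<partial>ucube \<partial>u01)"
      by (subst integral_vupd(2)[OF Fi, of k]) (simp only: eq)
    also have "\<dots> = (\<integral>t. f k t \<partial>u01) * (\<integral>x. ?P x \<partial>ucube)" by simp
    finally show ?case using Fi Pe insert.hyps by simp
  qed
  then show "integrable ucube (\<lambda>x. \<Prod>k\<in>S. f k (x $ k))"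
    and "(\<integral>x. (\<Prod>k\<in>S. f k (x $ k)) \<partial>ucube) = (\<Prod>k\<in>S. \<integral>t. f k t \<partial>u01)" by auto
qed

lemma AE_ucube: "AE x in (ucube :: (real^'n::finite) measure). \<forall>i. 0 < x $ i \<and> x $ i < 1"
proof -
  have "AE x in (ucube :: (real^'n) measure). 0 < x $ i \<and> x $ i < 1" for i
  proof -
    have "AE p in u01 \<Otimes>\<^sub>M (ucube :: (real^'n) measure). 0 < fst p \<and> fst p < 1"
    proof (rule u01_ucube.AE_pair_measure)
      show "{p \<in> space (u01 \<Otimes>\<^sub>M (ucube :: (real^'n) measure)). 0 < fst p \<and> fst p < 1} \<in> sets (u01 \<Otimes>\<^sub>M ucube)"
        by measurable
    qed (use AE_u01 in auto)
    then have "AE p in u01 \<Otimes>\<^sub>M (ucube :: (real^'n) measure). 0 < (case p of (t, y) \<Rightarrow> vupd i y t) $ i \<and> (case p of (t, y) \<Rightarrow> vupd i y t) $ i < 1"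
      by eventually_elim auto
    then have "AE x in distr (u01 \<Otimes>\<^sub>M (ucube :: (real^'n) measure)) borel (\<lambda>(t, y). vupd i y t). 0 < x $ i \<and> x $ i < 1"
      by (subst AE_distr_iff) simp_all
    then show ?thesis unfolding distr_vupd .
  qed
  then show ?thesis by (intro AE_finite_allI[of UNIV, simplified]) auto
qed

text \<open>Bumps become indicators one coordinate at a time, by dominated convergence, until the
  test product is the indicator of a box.\<close>

lemma AE_zero_if_product_test_integrals_zero:
  fixes f :: "real^'n::finite \<Rightarrow> 'b::euclidean_space"
  assumes f: "integrable ucube f"
    and zero: "\<And>b. (\<And>i. \<exists>d. test1 (b i) d) \<Longrightarrow> (\<integral>x. (\<Prod>i\<in>UNIV. b i (x $ i)) *\<^sub>R f x \<partial>ucube) = 0"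
  shows "AE x in ucube. f x = 0"
proof (rule AE_zero_if_box_integrals_zero)
  have [measurable]: "f \<in> borel_measurable borel"
    using f by (simp add: borel_measurable_integrable cong: measurable_cong_sets)
  show "(\<integral>x. f x \<partial>ucube) = 0" using zero[of "\<lambda>i x. 1"] test1_const by simp blast
  \<comment> \<open>Invariant of the induction: coordinates in \<open>S\<close> already carry
    indicators, all others still carry arbitrary test functions.\<close>
  have ind: "(\<integral>x. (\<Prod>i\<in>UNIV. b i (x $ i)) *\<^sub>R f x \<partial>ucube) = 0"
    if "finite S" and lu: "\<And>i. i \<in> S \<Longrightarrow> 0 \<le> l $ i \<and> l $ i \<le> u $ i \<and> u $ i \<le> 1"
      and "\<And>i. i \<in> S \<Longrightarrow> b i = indicator {l $ i<..<u $ i}"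
      and "\<And>i. i \<notin> S \<Longrightarrow> \<exists>d. test1 (b i) d" for S and l u :: "real^'n" and b
    using that
  proof (induction S arbitrary: b)
    case empty then show ?case by (intro zero) auto
  next
    case (insert k S)
    define c where "c n = b(k := bump (l $ k) (u $ k) n)" for n
    have c0: "(\<integral>x. (\<Prod>i\<in>UNIV. c n i (x $ i)) *\<^sub>R f x \<partial>ucube) = 0" for n
      using insert.hyps insert.prems test1_bump by (intro insert.IH) (auto simp: c_def)
    \<comment> \<open>The bound is at least 1 so that it also dominates the bump that replaces the
      factor \<open>b k\<close>.\<close>
    have bnd: "\<exists>B\<ge>1. \<forall>t. \<bar>b i t\<bar> \<le> B" for i
    proof (cases "i \<in> insert k S")
      case True then show ?thesis using insert.prems(2) by (intro exI[of _ 1]) (auto simp: indicator_def)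
    next
      case False
      then obtain d where "test1 (b i) d" using insert.prems(3) by blast
      then obtain B where "\<And>x. \<bar>b i x\<bar> \<le> B" using test1_bounded by blast
      then show ?thesis by (intro exI[of _ "max 1 B"]) (auto intro: le_max_iff_disj[THEN iffD2])
    qed
    then obtain B where B: "\<And>i. B i \<ge> 1" "\<And>i t. \<bar>b i t\<bar> \<le> B i" by metis
    have bm[measurable]: "b i \<in> borel_measurable borel" for i
    proof (cases "i \<in> insert k S")
      case True then show ?thesis using insert.prems(2)[OF True] by simp
    next
      case False then show ?thesis using insert.prems(3) test1_measurable by blast
    qed
    have [measurable]: "c n i \<in> borel_measurable borel" for n i
      using test1_bump[of "l $ k" "u $ k" n] test1_measurable bm by (auto simp: c_def)
    have cB: "\<bar>c n i t\<bar> \<le> B i" for n i t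
      using B bump_bounds[of "l $ k" "u $ k" n t] by (auto simp: c_def intro: order_trans)
    have "(\<lambda>n. \<integral>x. (\<Prod>i\<in>UNIV. c n i (x $ i)) *\<^sub>R f x \<partial>ucube) \<longlonglongrightarrow> (\<integral>x. (\<Prod>i\<in>UNIV. b i (x $ i)) *\<^sub>R f x \<partial>ucube)"
    proof (rule integral_dominated_convergence[where w = "\<lambda>x. (\<Prod>i\<in>UNIV. B i) * norm (f x)"])
      show "AE x in ucube. (\<lambda>n. (\<Prod>i\<in>UNIV. c n i (x $ i)) *\<^sub>R f x) \<longlonglongrightarrow> (\<Prod>i\<in>UNIV. b i (x $ i)) *\<^sub>R f x"
        using AE_ucube
      proof eventually_elim
        case (elim x)
        have "(\<lambda>n. c n i (x $ i)) \<longlonglongrightarrow> b i (x $ i)" for i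
          using elim insert.prems(1,2)[of k] bump_tendsto[of "l $ k" "u $ k" "x $ k"]
          by (cases "i = k") (auto simp: c_def less_imp_le)
        then show ?case by (intro tendsto_intros)
      qed
      show "AE x in ucube. norm ((\<Prod>i\<in>UNIV. c n i (x $ i)) *\<^sub>R f x) \<le> (\<Prod>i\<in>UNIV. B i) * norm (f x)" for n
      proof (intro AE_I2)
        fix x
        have "\<bar>\<Prod>i\<in>UNIV. c n i (x $ i)\<bar> \<le> (\<Prod>i\<in>UNIV. B i)"
          unfolding abs_prod using cB by (intro prod_mono) auto
        then show "norm ((\<Prod>i\<in>UNIV. c n i (x $ i)) *\<^sub>R f x) \<le> (\<Prod>i\<in>UNIV. B i) * norm (f x)"
          by (simp add: mult_right_mono)
      qed
    qed (use f in auto)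
    then show ?case by (simp add: c0 LIMSEQ_const_iff)
  qed
  fix l u :: "real^'n"
  let ?l = "(\<chi> i. max 0 (l $ i)) :: real^'n" and ?u = "(\<chi> i. min 1 (u $ i)) :: real^'n"
  have "(\<integral>x. indicator (box l u) x *\<^sub>R f x \<partial>ucube) = (\<integral>x. (\<Prod>i\<in>UNIV. indicator {?l $ i<..<?u $ i} (x $ i)) *\<^sub>R f x \<partial>ucube)"
  proof (rule integral_cong_AE)
    show "AE x in ucube. indicator (box l u) x *\<^sub>R f x = (\<Prod>i\<in>UNIV. indicator {?l $ i<..<?u $ i} (x $ i)) *\<^sub>R f x"
      using AE_ucube
    proof eventually_elim
      case (elim x)
      have "(\<Prod>i\<in>UNIV. indicator {?l $ i<..<?u $ i} (x $ i) :: real) = (if \<forall>i. x $ i \<in> {?l $ i<..<?u $ i} then 1 else 0)"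
        by (auto simp: indicator_def)
      also have "\<dots> = indicator (box l u) x" using elim by (auto simp: indicator_def mem_box_cart)
      finally show ?case by simp
    qed
  qed auto
  also have "\<dots> = 0"
  proof (cases "\<forall>i. ?l $ i \<le> ?u $ i")
    case True then show ?thesis by (intro ind[of UNIV ?l ?u]) auto
  next
    case False
    then obtain i where "\<not> ?l $ i \<le> ?u $ i" by blast
    then have "indicator {?l $ i<..<?u $ i} (x $ i) = (0::real)" for x :: "real^'n" by auto
    then have z: "(\<Prod>i\<in>UNIV. indicator {?l $ i<..<?u $ i} (x $ i) :: real) = 0" for x :: "real^'n"
      by (meson UNIV_I finite prod_zero)
    show ?thesis by (simp only: z) simp
  qed
  finally show "(\<integral>x. indicator (box l u) x *\<^sub>R f x \<partial>ucube) = 0" .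
qed (use f in simp_all)

section \<open>Weak derivatives and absolutely continuous representatives on the circle\<close>

text \<open>Removing the mean makes the primitive periodic: its increment over a period has
  derivative zero and vanishes at 0. With the normalisation \<open>\<phi> 0 = 0\<close> the
  primitive vanishes at both ends, so it can be used in integration by parts against functions not
  known to be periodic.\<close>

lemma test1_antiderivative:
  assumes "test1 b d"
  shows "\<exists>\<phi>. \<phi> 0 = 0 \<and> test1 \<phi> (\<lambda>x. b x - integral {0..1} b)"
proof -
  let ?\<beta> = "\<lambda>x. b x - integral {0..1} b"
  have cb: "continuous_on UNIV b" by (rule test1_continuous[OF assms])
  then have c: "isCont ?\<beta> x" for x by (auto simp: continuous_on_eq_continuous_at intro!: continuous_intros)
  obtain F where F: "\<And>x. (F has_vector_derivative ?\<beta> x) (at x)"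
    using einterval_antiderivative[of "-\<infinity>" "\<infinity>" ?\<beta>] c by auto
  then have F': "(F has_real_derivative ?\<beta> x) (at x)" for x
    by (simp add: has_real_derivative_iff_has_vector_derivative)
  have bi: "b integrable_on {0..1}" by (rule integrable_continuous_interval[OF continuous_on_subset[OF cb]]) simp
  have h1: "(?\<beta> has_integral F 1 - F 0) {0..1}"
    by (rule fundamental_theorem_of_calculus) (auto intro: has_vector_derivative_at_within F)
  have h2: "(?\<beta> has_integral (integral {0..1} b - (1 - 0) *\<^sub>R integral {0..1} b)) {0..1}"
    using has_integral_diff[OF integrable_integral[OF bi] has_integral_const_real[of "integral {0..1} b" 0 1]] by simp
  have F01: "F 1 = F 0" using has_integral_unique[OF h1 h2] by simp
  have per: "b (x + 1) = b x" for x using assms by (simp add: test1_def)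
  have "((\<lambda>x. F (x + 1) - F x) has_real_derivative ?\<beta> (x + 1) - ?\<beta> x) (at x)" for x
    by (intro DERIV_diff F' DERIV_shift[THEN iffD1])
  then have "((\<lambda>x. F (x + 1) - F x) has_real_derivative 0) (at x)" for x by (simp add: per)
  then have "F (x + 1) - F x = F (0 + 1) - F 0" for x
    using DERIV_isconst_all[of "\<lambda>x. F (x + 1) - F x" x 0] by blast
  then have Fp: "F (x + 1) = F x" for x using F01 by simp
  have "test1 (\<lambda>x. F x - F 0) ?\<beta>"
    unfolding test1_def
  proof (intro conjI allI)
    show "((\<lambda>x. F x - F 0) has_real_derivative ?\<beta> x) (at x)" for x
      using DERIV_diff[OF F' DERIV_const[of "F 0"], of x] by simp
    show "continuous_on UNIV ?\<beta>" by (intro continuous_intros cb)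
  qed (simp add: Fp)
  then show ?thesis by (intro exI[of _ "\<lambda>x. F x - F 0"]) auto
qed


lemma test1_integrable_mult:
  fixes f :: "real \<Rightarrow> real"
  assumes "test1 b d" "f absolutely_integrable_on {0..1}"
  shows "(\<lambda>x. f x * b x) absolutely_integrable_on {0..1}"
  using absolutely_integrable_continuous_mult[OF continuous_on_subset[OF test1_continuous[OF assms(1)]] assms(2)]
  by (simp add: mult.commute)

lemma AE_zero_if_test1_HK_integrals_zero:
  fixes f :: "real \<Rightarrow> real"
  assumes f: "f absolutely_integrable_on {0..1}"
    and zero: "\<And>b d. test1 b d \<Longrightarrow> integral {0..1} (\<lambda>x. f x * b x) = 0"
  shows "AE x in u01. f x = 0"
proof -
  obtain f' where f': "f' \<in> borel_measurable borel" "AE x in u01. f x = f' x" "integrable u01 f'"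
    using absolutely_integrable_borel_version[OF f] by auto
  have "AE x in u01. f' x = 0"
  proof (rule AE_zero_if_test1_integrals_zero[OF f'(3)])
    fix b d assume b: "test1 b d"
    obtain B where B: "\<And>x. \<bar>b x\<bar> \<le> B" using test1_bounded[OF b] by blast
    have [measurable]: "b \<in> borel_measurable borel" "f' \<in> borel_measurable borel"
      using test1_measurable[OF b] f' by auto
    have "integrable u01 (\<lambda>x. b x *\<^sub>R f' x)"
    proof (rule Bochner_Integration.integrable_bound[where f = "\<lambda>x. B * f' x"])
      have "\<bar>b x\<bar> * \<bar>f' x\<bar> \<le> \<bar>B\<bar> * \<bar>f' x\<bar>" for x
        using B[of x] by (intro mult_right_mono) auto
      then show "AE x in u01. norm (b x *\<^sub>R f' x) \<le> norm (B * f' x)" by (simp add: abs_mult)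
    qed (use f'(3) in auto)
    then have "(\<integral>x. b x *\<^sub>R f' x \<partial>u01) = integral {0..1} (\<lambda>x. b x *\<^sub>R f' x)" by (rule integral_uni_eq) simp
    also have "\<dots> = integral {0..1} (\<lambda>x. f x * b x)"
      by (rule integral_cong_AE_uni) (use f'(2) in auto)
    finally show "(\<integral>x. b x *\<^sub>R f' x \<partial>u01) = 0" using zero[OF b] by simp
  qed
  with f'(2) show ?thesis by eventually_elim simp
qed

text \<open>The lemma of du Bois-Reymond: up to its mean, every test function is the derivative of
  another one, so \<open>u - G\<close> minus its mean is orthogonal to all test functions.\<close>

lemma weak_deriv1_ac_pair:
  fixes u g :: "real \<Rightarrow> real"
  assumes u: "u absolutely_integrable_on {0..1}" and g: "g absolutely_integrable_on {0..1}"
    and w: "weak_deriv1 u g"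
  obtains r where "ac_pair r g" "r 0 = r 1" "AE x in u01. u x = r x"
proof -
  have ui: "u integrable_on {0..1}" and gi: "g integrable_on {0..1}"
    using u g by (auto simp: absolutely_integrable_on_def)
  \<comment> \<open>Testing with the constant 1 shows that \<open>g\<close> has mean zero, which
    makes its primitive periodic.\<close>
  have g0: "integral {0..1} g = 0"
    using w test1_const[of 1] unfolding weak_deriv1_def by fastforce
  define G where "G t = integral {0..t} g" for t
  have G: "ac_pair G g" using g by (simp add: ac_pair_def G_def)
  have G01: "G 0 = 0" "G 1 = 0" by (simp_all add: G_def g0)
  have Ga: "G absolutely_integrable_on {0..1}"
    by (rule absolutely_integrable_continuous_real[OF ac_pair_continuous[OF G]])
  have uGa: "(\<lambda>x. u x - G x) absolutely_integrable_on {0..1}" using u Ga by (rule set_integral_diff(1))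
  define c where "c = integral {0..1} (\<lambda>x. u x - G x)"
  have fa: "(\<lambda>x. u x - G x - c) absolutely_integrable_on {0..1}"
    by (rule set_integral_diff(1)[OF uGa]) simp
  have zero: "integral {0..1} (\<lambda>x. (u x - G x - c) * b x) = 0" if b: "test1 b d" for b d
  proof -
    let ?m = "integral {0..1} b"
    obtain \<phi> where \<phi>: "test1 \<phi> (\<lambda>x. b x - ?m)" using test1_antiderivative[OF b] by blast
    have cb: "continuous_on {0..1} b" by (rule continuous_on_subset[OF test1_continuous[OF b]]) simp
    have cbm: "continuous_on {0..1} (\<lambda>x. b x - ?m)" by (intro continuous_intros cb)
    have i1: "(\<lambda>x. u x * (b x - ?m)) integrable_on {0..1}" "(\<lambda>x. G x * (b x - ?m)) integrable_on {0..1}"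
      using absolutely_integrable_continuous_mult[OF cbm u] absolutely_integrable_continuous_mult[OF cbm Ga]
      by (simp_all add: absolutely_integrable_on_def mult.commute)
    have i2: "(\<lambda>x. (u x - G x) * b x) integrable_on {0..1}"
      using absolutely_integrable_continuous_mult[OF cb uGa]
      by (simp add: absolutely_integrable_on_def mult.commute)
    have uGi: "(\<lambda>x. u x - G x) integrable_on {0..1}" using uGa by (simp add: absolutely_integrable_on_def)
    have "integral {0..1} (\<lambda>x. u x * (b x - ?m)) = - integral {0..1} (\<lambda>x. g x * \<phi> x)"
      using w \<phi> unfolding weak_deriv1_def by blast
    also have "\<dots> = integral {0..1} (\<lambda>x. G x * (b x - ?m))"
      using ac_pair_by_parts[OF G test1_ac_pair[OF \<phi>]] G01 by simp
    finally have "0 = integral {0..1} (\<lambda>x. u x * (b x - ?m)) - integral {0..1} (\<lambda>x. G x * (b x - ?m))"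
      by simp
    also have "\<dots> = integral {0..1} (\<lambda>x. u x * (b x - ?m) - G x * (b x - ?m))"
      using i1 by (rule integral_diff[symmetric])
    also have "\<dots> = integral {0..1} (\<lambda>x. (u x - G x) * b x - ?m * (u x - G x))"
      by (rule arg_cong[of _ _ "integral {0..1}"]) (auto simp: algebra_simps)
    also have "\<dots> = integral {0..1} (\<lambda>x. (u x - G x) * b x) - ?m * c"
      using i2 uGi by (subst integral_diff) (auto intro: integrable_on_mult_right simp: c_def)
    also have "?m * c = integral {0..1} (\<lambda>x. c * b x)" by (simp add: mult.commute)
    also have "integral {0..1} (\<lambda>x. (u x - G x) * b x) - \<dots> = integral {0..1} (\<lambda>x. (u x - G x) * b x - c * b x)"
      by (intro integral_diff[symmetric] i2 integrable_on_mult_right integrable_continuous_interval cb)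
    also have "\<dots> = integral {0..1} (\<lambda>x. (u x - G x - c) * b x)"
      by (rule arg_cong[of _ _ "integral {0..1}"]) (auto simp: algebra_simps)
    finally show ?thesis by simp
  qed
  have "AE x in u01. u x - G x - c = 0" by (rule AE_zero_if_test1_HK_integrals_zero[OF fa zero])
  then have ae: "AE x in u01. u x = G x + c" by eventually_elim auto
  have "ac_pair (\<lambda>t. G t + c) g" using g by (simp add: ac_pair_def G_def)
  then show ?thesis by (rule that[OF _ _ ae]) (simp add: G01)
qed

section \<open>Square-integrable functions on the circle\<close>

text \<open>The counterpart of \<open>L2r\<close> with a Borel function and the Bochner integral,
  for which inequalities, convergence theorems and Fubini are at hand.\<close>

definition L2b :: "(real \<Rightarrow> real) \<Rightarrow> bool" where
  "L2b g \<longleftrightarrow> g \<in> borel_measurable borel \<and> integrable u01 (\<lambda>x. (g x)\<^sup>2)"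

lemma L2b_measurable: "L2b g \<Longrightarrow> g \<in> borel_measurable borel"
  and L2b_square: "L2b g \<Longrightarrow> integrable u01 (\<lambda>x. (g x)\<^sup>2)"
  by (auto simp: L2b_def)

lemma L2b_mult_integrable:
  assumes "L2b f" "L2b g" shows "integrable u01 (\<lambda>x. f x * g x)"
  using assms by (intro integrable_mult_L2) (auto simp: L2b_def cong: measurable_cong_sets)

lemma L2b_CS: "L2b f \<Longrightarrow> L2b g \<Longrightarrow> (\<integral>x. f x * g x \<partial>u01)\<^sup>2 \<le> (\<integral>x. (f x)\<^sup>2 \<partial>u01) * (\<integral>x. (g x)\<^sup>2 \<partial>u01)"
  by (intro Cauchy_Schwarz_integral) (auto simp: L2b_def cong: measurable_cong_sets)

lemma L2b_lincomb:
  assumes "L2b f" "L2b g"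
  shows "L2b (\<lambda>x. a * f x + b * g x)"
proof -
  have "integrable u01 (\<lambda>x. a\<^sup>2 * (f x)\<^sup>2 + (2 * a * b) * (f x * g x) + b\<^sup>2 * (g x)\<^sup>2)"
    using assms L2b_mult_integrable[OF assms] by (intro Bochner_Integration.integrable_add integrable_mult_right) (auto simp: L2b_def)
  moreover have "(\<lambda>x. a\<^sup>2 * (f x)\<^sup>2 + (2 * a * b) * (f x * g x) + b\<^sup>2 * (g x)\<^sup>2) = (\<lambda>x. (a * f x + b * g x)\<^sup>2)"
    by (auto simp: power2_eq_square algebra_simps)
  ultimately show ?thesis using assms by (auto simp: L2b_def)
qed

lemma L2b_diff: "L2b f \<Longrightarrow> L2b g \<Longrightarrow> L2b (\<lambda>x. f x - g x)"
  using L2b_lincomb[of f g 1 "-1"] by simp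

lemma L2b_const: "L2b (\<lambda>x. c)"
  by (simp add: L2b_def)

lemma L2b_integrable: "L2b g \<Longrightarrow> integrable u01 g"
  using L2b_mult_integrable[OF _ L2b_const[of 1]] by simp

lemma L2b_L1_le:
  assumes "L2b f" shows "(\<integral>x. \<bar>f x\<bar> \<partial>u01)\<^sup>2 \<le> (\<integral>x. (f x)\<^sup>2 \<partial>u01)"
proof -
  have "L2b (\<lambda>x. \<bar>f x\<bar>)" using assms by (auto simp: L2b_def)
  from L2b_CS[OF this L2b_const[of 1]] show ?thesis by (simp add: u01.prob_space[simplified])
qed

text \<open>Riesz-Fischer with a rate. A subsequence with summable L1 differences converges almost
  everywhere, and Fatou's lemma carries the estimate \<open>e n\<close> over to the limit.\<close>

lemma L2b_complete:
  assumes L: "\<And>n. L2b (g n)" and e: "e \<longlonglongrightarrow> 0"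
    and C: "\<And>n m. n \<le> m \<Longrightarrow> (\<integral>x. (g n x - g m x)\<^sup>2 \<partial>u01) \<le> e n"
  shows "\<exists>h. L2b h \<and> (\<forall>n. (\<integral>x. (g n x - h x)\<^sup>2 \<partial>u01) \<le> e n)"
proof -
  have [measurable]: "g n \<in> borel_measurable borel" for n using L by (simp add: L2b_def)
  \<comment> \<open>The bound \<open>(1/4)^j\<close> concerns squared norms, so the norms themselves
    are at most \<open>(1/2)^j\<close> and hence summable.\<close>
  have "\<exists>N. \<forall>n\<ge>N. e n \<le> (1/4)^j" for j :: nat
  proof -
    have "eventually (\<lambda>n. e n < (1/4)^j) sequentially" by (rule order_tendstoD(2)[OF e]) simp
    then show ?thesis unfolding eventually_sequentially by (meson less_imp_le)
  qed
  then obtain N where N: "\<And>j n. n \<ge> N j \<Longrightarrow> e n \<le> (1/4)^j" by metis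
  \<comment> \<open>The sum makes the indices increasing and puts them beyond \<open>N j\<close>;
    the summand \<open>j\<close> makes them exceed every given index, as the final estimate
    needs.\<close>
  define s where "s j = (\<Sum>i\<le>j. N i) + j" for j
  have s: "s j \<le> s (Suc j)" "N j \<le> s j" "j \<le> s j" for j by (auto simp: s_def atMost_Suc intro: trans_le_add1 member_le_sum)
  have D: "(\<integral>x. \<bar>g (s j) x - g (s (Suc j)) x\<bar> \<partial>u01) \<le> (1/2)^j" for j
  proof -
    have "(\<integral>x. \<bar>g (s j) x - g (s (Suc j)) x\<bar> \<partial>u01)\<^sup>2 \<le> (\<integral>x. (g (s j) x - g (s (Suc j)) x)\<^sup>2 \<partial>u01)"
      by (rule L2b_L1_le[OF L2b_diff[OF L L]])
    also have "\<dots> \<le> e (s j)" by (rule C[OF s(1)])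
    also have "\<dots> \<le> (1/4)^j" by (rule N[OF s(2)])
    also have "\<dots> = ((1/2)^j)\<^sup>2" by (simp add: power2_eq_square flip: power_mult_distrib)
    finally show ?thesis by (rule power2_le_imp_le) simp
  qed
  have "(\<integral>\<^sup>+x. (\<Sum>j. ennreal \<bar>g (s j) x - g (s (Suc j)) x\<bar>) \<partial>u01) = (\<Sum>j. \<integral>\<^sup>+x. ennreal \<bar>g (s j) x - g (s (Suc j)) x\<bar> \<partial>u01)"
    by (rule nn_integral_suminf) measurable
  also have "\<dots> \<le> (\<Sum>j. ennreal ((1/2)^j))"
  proof (rule suminf_le)
    fix j
    have "integrable u01 (\<lambda>x. \<bar>g (s j) x - g (s (Suc j)) x\<bar>)"
      using L2b_integrable[OF L2b_diff[OF L L]] by (rule integrable_abs)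
    then have "(\<integral>\<^sup>+x. ennreal \<bar>g (s j) x - g (s (Suc j)) x\<bar> \<partial>u01) = ennreal (\<integral>x. \<bar>g (s j) x - g (s (Suc j)) x\<bar> \<partial>u01)"
      by (rule nn_integral_eq_integral) simp
    also have "\<dots> \<le> ennreal ((1/2)^j)" by (rule ennreal_leI[OF D])
    finally show "(\<integral>\<^sup>+x. ennreal \<bar>g (s j) x - g (s (Suc j)) x\<bar> \<partial>u01) \<le> ennreal ((1/2)^j)" .
  qed auto
  also have "\<dots> = ennreal (\<Sum>j. (1/2)^j)" by (rule suminf_ennreal2) (auto intro: summable_geometric)
  also have "\<dots> < \<infinity>" by simp
  finally have "AE x in u01. (\<Sum>j. ennreal \<bar>g (s j) x - g (s (Suc j)) x\<bar>) \<noteq> \<infinity>"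
    by (intro nn_integral_noteq_infinite) auto
  then have conv: "AE x in u01. convergent (\<lambda>j. g (s j) x)"
  proof eventually_elim
    case (elim x)
    then have "summable (\<lambda>j. \<bar>g (s j) x - g (s (Suc j)) x\<bar>)"
      by (intro summable_suminf_not_top) auto
    then have "summable (\<lambda>j. g (s (Suc j)) x - g (s j) x)"
      by (intro summable_norm_cancel[of "\<lambda>j. g (s (Suc j)) x - g (s j) x"]) (simp add: abs_minus_commute)
    then have "convergent (\<lambda>n. \<Sum>j<n. g (s (Suc j)) x - g (s j) x)" by (simp add: summable_iff_convergent)
    then have "convergent (\<lambda>n. g (s n) x - g (s 0) x)" by (simp only: sum_lessThan_telescope[of "\<lambda>j. g (s j) x"])
    then have "convergent (\<lambda>n. g (s n) x - g (s 0) x + g (s 0) x)" by (intro convergent_add convergent_const)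
    then show ?case by simp
  qed
  \<comment> \<open>\<open>lim\<close> is Borel on the whole line, whatever its value on the null
    set where the subsequence diverges.\<close>
  define h where "h x = lim (\<lambda>j. g (s j) x)" for x
  have [measurable]: "h \<in> borel_measurable borel" unfolding h_def by measurable
  have bound: "(\<integral>\<^sup>+x. ennreal ((g n x - h x)\<^sup>2) \<partial>u01) \<le> ennreal (e n)" for n
  proof -
    have "(\<integral>\<^sup>+x. ennreal ((g n x - h x)\<^sup>2) \<partial>u01) = (\<integral>\<^sup>+x. liminf (\<lambda>j. ennreal ((g n x - g (s j) x)\<^sup>2)) \<partial>u01)"
    proof (rule nn_integral_cong_AE)
      show "AE x in u01. ennreal ((g n x - h x)\<^sup>2) = liminf (\<lambda>j. ennreal ((g n x - g (s j) x)\<^sup>2))"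
        using conv
      proof eventually_elim
        case (elim x)
        then have "(\<lambda>j. g (s j) x) \<longlonglongrightarrow> h x" by (simp add: h_def convergent_LIMSEQ_iff)
        then have "(\<lambda>j. ennreal ((g n x - g (s j) x)\<^sup>2)) \<longlonglongrightarrow> ennreal ((g n x - h x)\<^sup>2)"
          by (intro tendsto_intros)
        then show ?case by (rule lim_imp_Liminf[symmetric, rotated]) simp
      qed
    qed
    also have "\<dots> \<le> liminf (\<lambda>j. \<integral>\<^sup>+x. ennreal ((g n x - g (s j) x)\<^sup>2) \<partial>u01)"
      by (rule nn_integral_liminf) measurable
    also have "\<dots> \<le> ennreal (e n)"
    proof (rule Liminf_le)
      have "(\<integral>\<^sup>+x. ennreal ((g n x - g (s j) x)\<^sup>2) \<partial>u01) \<le> ennreal (e n)" if "j \<ge> n" for j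
      proof -
        have "(\<integral>\<^sup>+x. ennreal ((g n x - g (s j) x)\<^sup>2) \<partial>u01) = ennreal (\<integral>x. (g n x - g (s j) x)\<^sup>2 \<partial>u01)"
          by (rule nn_integral_eq_integral[OF L2b_square[OF L2b_diff[OF L L]]]) simp
        also have "\<dots> \<le> ennreal (e n)"
          using that s(3)[of j] by (intro ennreal_leI C) simp
        finally show ?thesis .
      qed
      then show "\<forall>\<^sub>F j in sequentially. (\<integral>\<^sup>+x. ennreal ((g n x - g (s j) x)\<^sup>2) \<partial>u01) \<le> ennreal (e n)"
        by (rule eventually_sequentiallyI)
    qed simp
    finally show ?thesis .
  qed
  have e0: "e n \<ge> 0" for n using C[OF order_refl[of n]] by simp
  have int: "integrable u01 (\<lambda>x. (g n x - h x)\<^sup>2)" for n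
    using bound[of n] by (intro integrableI_bounded) (auto simp: top_unique less_top[symmetric] intro: le_less_trans)
  have "(\<integral>x. (g n x - h x)\<^sup>2 \<partial>u01) \<le> e n" for n
    using bound[of n] nn_integral_eq_integral[OF int[of n]] e0 by simp
  moreover have "L2b h"
  proof -
    have "L2b (\<lambda>x. g 0 x - h x)" using int[of 0] by (simp add: L2b_def)
    from L2b_diff[OF L[of 0] this] show ?thesis by simp
  qed
  ultimately show ?thesis by blast
qed


text \<open>Almost-minimisers of the norm over the nested superlevel sets form a Cauchy sequence by the
  parallelogram law, which replaces weak compactness of balls in \<open>L\<^sup>2\<close>.\<close>
lemma L2b_affine_family_maximizer:
  fixes a :: "'p \<Rightarrow> real" and k :: "'p \<Rightarrow> real \<Rightarrow> real"
  assumes k: "\<And>p. p \<in> P \<Longrightarrow> L2b (k p)"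
    and near: "\<And>c. c < c0 \<Longrightarrow> \<exists>g. L2b g \<and> (\<integral>x. (g x)\<^sup>2 \<partial>u01) \<le> R \<and> (\<forall>p\<in>P. c \<le> a p + (\<integral>x. g x * k p x \<partial>u01))"
  shows "\<exists>g. L2b g \<and> (\<forall>p\<in>P. c0 \<le> a p + (\<integral>x. g x * k p x \<partial>u01))"
proof -
  define nrm where "nrm g = (\<integral>x. (g x)\<^sup>2 \<partial>u01)" for g :: "real \<Rightarrow> real"
  define t where "t n = 1 / (real n + 1)" for n :: nat
  have t0: "t n > 0" and tdec: "n \<le> m \<Longrightarrow> t m \<le> t n" for n m by (auto simp: t_def field_simps)
  have tlim: "t \<longlonglongrightarrow> 0" unfolding t_def using LIMSEQ_inverse_real_of_nat by (simp add: inverse_eq_divide add.commute)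
  \<comment> \<open>Relaxing every constraint by \<open>t n\<close> makes each set non-empty by
    \<open>near\<close>, which speaks only of levels strictly below \<open>c0\<close>. The sets are
    convex and shrink as \<open>n\<close> grows.\<close>
  define K where "K n = {g. L2b g \<and> (\<forall>p\<in>P. c0 - t n \<le> a p + (\<integral>x. g x * k p x \<partial>u01))}" for n
  have Kmono: "K m \<subseteq> K n" if "n \<le> m" for n m
    using tdec[OF that] unfolding K_def by (auto intro: order_trans[rotated])
  have nrm0: "nrm g \<ge> 0" for g by (simp add: nrm_def)
  have Kne: "\<exists>g\<in>K n. nrm g \<le> R" for n
    using near[of "c0 - t n"] t0[of n] by (auto simp: K_def nrm_def)
  have bdd: "bdd_below (nrm ` K n)" for n by (rule bdd_belowI[of _ 0]) (auto simp: nrm0)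
  define d where "d n = Inf (nrm ` K n)" for n
  have dle: "d n \<le> nrm g" if "g \<in> K n" for n g
    unfolding d_def using that bdd by (intro cInf_lower) auto
  have dR: "d n \<le> R" for n using Kne[of n] dle by (meson order_trans)
  have dmono: "d n \<le> d m" if "n \<le> m" for n m
    unfolding d_def[of m] using Kne[of m] Kmono[OF that] dle by (intro cInf_greatest) auto
  define D where "D = (SUP n. d n)"
  have dD: "d n \<le> D" for n unfolding D_def by (rule cSUP_upper) (auto intro: bdd_aboveI[of _ R] simp: dR)
  have dlim: "d \<longlonglongrightarrow> D"
    unfolding D_def by (rule LIMSEQ_incseq_SUP) (auto intro: bdd_aboveI[of _ R] simp: dR incseq_def dmono)
  have "\<exists>g\<in>K n. nrm g < d n + t n" for n
  proof -
    have "Inf (nrm ` K n) < d n + t n" using t0 by (simp add: d_def)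
    then show ?thesis using Kne[of n] cInf_lessD[of "nrm ` K n"] by blast
  qed
  then obtain g where gK: "\<And>n. g n \<in> K n" and gn: "\<And>n. nrm (g n) < d n + t n" by metis
  have gL: "L2b (g n)" for n using gK by (auto simp: K_def)
  \<comment> \<open>Twice the upper bounds \<open>d n + t n\<close> and \<open>D + t n\<close> for
    the two squared norms, less four times the lower bound \<open>d n\<close> for that of the
    midpoint.\<close>
  define e where "e n = 2 * (D - d n) + 4 * t n" for n
  have elim: "e \<longlonglongrightarrow> 2 * (D - D) + 4 * 0"
    unfolding e_def by (intro tendsto_intros dlim tlim)
  have C: "(\<integral>x. (g n x - g m x)\<^sup>2 \<partial>u01) \<le> e n" if nm: "n \<le> m" for n m
  proof -
    define h where "h x = (1/2) * g n x + (1/2) * g m x" for x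
    have gm: "g m \<in> K n" using gK[of m] Kmono[OF nm] by blast
    have hL: "L2b h" unfolding h_def by (rule L2b_lincomb[OF gL gL])
    have "h \<in> K n"
      unfolding K_def
    proof (intro CollectI conjI ballI hL)
      fix p assume p: "p \<in> P"
      have "(\<integral>x. h x * k p x \<partial>u01) = (\<integral>x. (1/2) * (g n x * k p x) + (1/2) * (g m x * k p x) \<partial>u01)"
        by (rule Bochner_Integration.integral_cong) (auto simp: h_def algebra_simps)
      also have "\<dots> = (1/2) * (\<integral>x. g n x * k p x \<partial>u01) + (1/2) * (\<integral>x. g m x * k p x \<partial>u01)"
        using L2b_mult_integrable[OF gL k[OF p]] by (subst Bochner_Integration.integral_add) auto
      moreover have "c0 - t n \<le> a p + (\<integral>x. g n x * k p x \<partial>u01)" "c0 - t n \<le> a p + (\<integral>x. g m x * k p x \<partial>u01)"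
        using gK[of n] gm p by (auto simp: K_def)
      ultimately show "c0 - t n \<le> a p + (\<integral>x. h x * k p x \<partial>u01)" by linarith
    qed
    then have "d n \<le> nrm h" by (rule dle)
    moreover have "(\<integral>x. (g n x - g m x)\<^sup>2 \<partial>u01) = (\<integral>x. 2 * (g n x)\<^sup>2 + 2 * (g m x)\<^sup>2 - 4 * (h x)\<^sup>2 \<partial>u01)"
      by (rule Bochner_Integration.integral_cong) (auto simp: h_def power2_eq_square algebra_simps)
    then have "(\<integral>x. (g n x - g m x)\<^sup>2 \<partial>u01) = 2 * nrm (g n) + 2 * nrm (g m) - 4 * nrm h"
      using L2b_square[OF gL] L2b_square[OF hL] unfolding nrm_def
      by (simp del: power_divide)
    ultimately have "(\<integral>x. (g n x - g m x)\<^sup>2 \<partial>u01) \<le> 2 * (d n + t n) + 2 * (D + t n) - 4 * d n"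
      using gn[of n] gn[of m] tdec[OF nm] dD[of m] by (smt (verit))
    then show ?thesis by (simp add: e_def)
  qed
  have "e \<longlonglongrightarrow> 0" using elim by simp
  from L2b_complete[OF gL this C] obtain h where h: "L2b h" "\<And>n. (\<integral>x. (g n x - h x)\<^sup>2 \<partial>u01) \<le> e n" by blast
  have "c0 \<le> a p + (\<integral>x. h x * k p x \<partial>u01)" if p: "p \<in> P" for p
  proof -
    let ?k2 = "\<integral>x. (k p x)\<^sup>2 \<partial>u01"
    \<comment> \<open>The limit inherits each constraint up to the Cauchy-Schwarz error
      \<open>sqrt (e n * ?k2)\<close>, which tends to zero for each fixed \<open>p\<close>; no
      uniformity in \<open>p\<close> is involved.\<close>
    have le: "c0 - t n - sqrt (e n * ?k2) \<le> a p + (\<integral>x. h x * k p x \<partial>u01)" for n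
    proof -
      have "(\<integral>x. (g n x - h x) * k p x \<partial>u01)\<^sup>2 \<le> (\<integral>x. (g n x - h x)\<^sup>2 \<partial>u01) * ?k2"
        by (rule L2b_CS[OF L2b_diff[OF gL h(1)] k[OF p]])
      also have "\<dots> \<le> e n * ?k2" by (intro mult_right_mono h(2)) simp
      finally have "(\<integral>x. (g n x - h x) * k p x \<partial>u01) \<le> sqrt (e n * ?k2)" by (rule real_le_rsqrt)
      moreover have "(\<integral>x. (g n x - h x) * k p x \<partial>u01) = (\<integral>x. g n x * k p x \<partial>u01) - (\<integral>x. h x * k p x \<partial>u01)"
        using L2b_mult_integrable[OF gL k[OF p]] L2b_mult_integrable[OF h(1) k[OF p]]
        by (simp add: left_diff_distrib)
      moreover have "c0 - t n \<le> a p + (\<integral>x. g n x * k p x \<partial>u01)" using gK[of n] p by (auto simp: K_def)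
      ultimately show ?thesis by linarith
    qed
    have "(\<lambda>n. c0 - t n - sqrt (e n * ?k2)) \<longlonglongrightarrow> c0 - 0 - sqrt (0 * ?k2)"
      by (intro tendsto_intros tlim \<open>e \<longlonglongrightarrow> 0\<close>)
    then show ?thesis by (intro LIMSEQ_le_const2[of _ c0]) (auto intro: le)
  qed
  then show ?thesis using h(1) by blast
qed

section \<open>Borel versions and almost-everywhere identities for functions in L2 and H1\<close>

lemma L2r_borel_version:
  assumes "L2r f" obtains f' where "L2b f'" "AE x in u01. f x = f' x"
proof -
  obtain f' where f': "f' \<in> borel_measurable borel" "AE x in u01. f x = f' x"
    using assms measurable_on_borel_version[of f "{0..1}"] by (auto simp: L2r_def)
  have "(\<lambda>x. (f x)\<^sup>2) absolutely_integrable_on {0..1}"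
    using assms by (simp add: L2r_def absolutely_integrable_on_iff_nonneg)
  then have "(\<lambda>x. (f' x)\<^sup>2) absolutely_integrable_on {0..1}"
  proof (rule absolutely_integrable_spike)
    show "negligible {x \<in> {0..1}. f x \<noteq> f' x}"
      using f'(2) negligible_iff_AE_uni[of "{0..1}" "\<lambda>x. f x = f' x"] by simp
  qed auto
  moreover have "(\<lambda>x. (f' x)\<^sup>2) \<in> borel_measurable borel" using f'(1) by measurable
  ultimately have "integrable u01 (\<lambda>x. (f' x)\<^sup>2)" by (subst integrable_uni_iff) auto
  then have "L2b f'" using f'(1) by (simp add: L2b_def)
  then show ?thesis using f'(2) by (rule that)
qed

lemma L2b_L2r:
  assumes "L2b f" shows "L2r f"
proof -
  have "(\<lambda>x. (f x)\<^sup>2) absolutely_integrable_on {0..1}"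
    using assms by (intro integrable_uniD) (auto simp: L2b_def)
  moreover have "f measurable_on {0..1}"
    using assms unfolding L2b_def
    by (simp add: measurable_on_iff_borel_measurable measurable_completion measurable_restrict_space1)
  ultimately show ?thesis by (simp add: L2r_def absolutely_integrable_on_def)
qed

lemma L2r_cong_AE:
  assumes "L2r f" "AE x in u01. f x = g x" shows "L2r g"
proof -
  have n: "negligible {x \<in> {0..1}. f x \<noteq> g x}"
    using assms(2) negligible_iff_AE_uni[of "{0..1}" "\<lambda>x. f x = g x"] by simp
  have "g measurable_on {0..1}"
  proof (rule measurable_on_spike[OF _ n])
    show "f measurable_on {0..1}" using assms(1) by (simp add: L2r_def)
  qed auto
  moreover have "(\<lambda>x. (g x)\<^sup>2) integrable_on {0..1}"
  proof (rule integrable_spike[OF _ n])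
    show "(\<lambda>x. (f x)\<^sup>2) integrable_on {0..1}" using assms(1) by (simp add: L2r_def)
  qed auto
  ultimately show ?thesis by (simp add: L2r_def)
qed

lemma absolutely_integrable_cong_AE_uni:
  fixes f :: "'a::euclidean_space \<Rightarrow> 'b::euclidean_space"
  assumes "f absolutely_integrable_on A" "AE x in uni A. f x = g x" "A \<in> sets borel"
  shows "g absolutely_integrable_on A"
proof (rule absolutely_integrable_spike[OF assms(1)])
  show "negligible {x \<in> A. f x \<noteq> g x}"
    using assms(2,3) negligible_iff_AE_uni[of A "\<lambda>x. f x = g x"] by simp
qed auto

lemma L2r_absolutely_integrable:
  assumes "L2r f" shows "f absolutely_integrable_on {0..1}"
proof -
  obtain f' where f': "L2b f'" "AE x in u01. f x = f' x" using L2r_borel_version[OF assms] .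
  have "f' absolutely_integrable_on {0..1}" using L2b_integrable[OF f'(1)] by (rule integrable_uniD) simp
  moreover have "AE x in u01. f' x = f x" using f'(2) by eventually_elim simp
  ultimately show ?thesis by (rule absolutely_integrable_cong_AE_uni) simp
qed

lemma integral_mult_L2_eq:
  assumes "AE x in u01. f x = f' x" "AE x in u01. g x = g' x" "L2b f'" "L2b g'"
  shows "integral {0..1} (\<lambda>x. f x * g x) = (\<integral>x. f' x * g' x \<partial>u01)"
proof -
  have "AE x in u01. f x * g x = f' x * g' x" using assms(1,2) by eventually_elim simp
  then have "integral {0..1} (\<lambda>x. f x * g x) = integral {0..1} (\<lambda>x. f' x * g' x)" by (rule integral_cong_AE_uni) simp
  also have "\<dots> = (\<integral>x. f' x * g' x \<partial>u01)"
    by (rule integral_uni_eq[symmetric]) (simp_all add: L2b_mult_integrable assms)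
  finally show ?thesis .
qed

lemma weak_deriv1_unique:
  assumes g: "g absolutely_integrable_on {0..1}" "h absolutely_integrable_on {0..1}"
    and w: "weak_deriv1 u g" "weak_deriv1 u h"
  shows "AE x in u01. g x = h x"
proof -
  have gh: "(\<lambda>x. g x - h x) absolutely_integrable_on {0..1}" by (rule set_integral_diff(1)[OF g])
  have "AE x in u01. g x - h x = 0"
  proof (rule AE_zero_if_test1_HK_integrals_zero[OF gh])
    fix b d assume b: "test1 b d"
    have "integral {0..1} (\<lambda>x. u x * d x) = - integral {0..1} (\<lambda>x. g x * b x)"
      "integral {0..1} (\<lambda>x. u x * d x) = - integral {0..1} (\<lambda>x. h x * b x)"
      using w b unfolding weak_deriv1_def by blast+
    moreover have "integral {0..1} (\<lambda>x. (g x - h x) * b x) = integral {0..1} (\<lambda>x. g x * b x) - integral {0..1} (\<lambda>x. h x * b x)"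
      using test1_integrable_mult[OF b] g unfolding left_diff_distrib
      by (intro Henstock_Kurzweil_Integration.integral_diff) (auto simp: absolutely_integrable_on_def)
    ultimately show "integral {0..1} (\<lambda>x. (g x - h x) * b x) = 0" by simp
  qed
  then show ?thesis by eventually_elim simp
qed

lemma weak_deriv1_cong_AE:
  assumes "weak_deriv1 u g" "AE x in u01. u x = v x" "AE x in u01. g x = h x"
  shows "weak_deriv1 v h"
  unfolding weak_deriv1_def
proof (intro allI impI)
  fix \<phi> d assume t: "test1 \<phi> d"
  have "integral {0..1} (\<lambda>x. v x * d x) = integral {0..1} (\<lambda>x. u x * d x)"
    by (rule integral_cong_AE_uni) (use assms(2) in \<open>auto elim!: eventually_mono\<close>)
  also have "\<dots> = - integral {0..1} (\<lambda>x. g x * \<phi> x)" using assms(1) t unfolding weak_deriv1_def by blast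
  also have "integral {0..1} (\<lambda>x. g x * \<phi> x) = integral {0..1} (\<lambda>x. h x * \<phi> x)"
    by (rule integral_cong_AE_uni) (use assms(3) in \<open>auto elim!: eventually_mono\<close>)
  finally show "integral {0..1} (\<lambda>x. v x * d x) = - integral {0..1} (\<lambda>x. h x * \<phi> x)" .
qed

lemma dr_spec:
  assumes "H1r u" shows "L2r (dr u)" "weak_deriv1 u (dr u)"
  using someI_ex[of "\<lambda>g. L2r g \<and> weak_deriv1 u g"] assms by (auto simp: H1r_def dr_def)

text \<open>\<open>dr\<close> is an arbitrary choice of weak derivative, so a concrete derivative
  can be compared with it only through uniqueness almost everywhere.\<close>

lemma dr_eqI:
  assumes "L2r g" "weak_deriv1 u g"
  shows "AE x in u01. dr u x = g x"
proof -
  have "L2r (dr u) \<and> weak_deriv1 u (dr u)"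
    unfolding dr_def by (rule someI[of _ g]) (use assms in auto)
  then show ?thesis using assms by (intro weak_deriv1_unique[of _ _ u] L2r_absolutely_integrable) auto
qed

lemma H1r_ac_pair:
  assumes "H1r u"
  obtains r g where "L2b g" "ac_pair r g" "r 0 = r 1" "AE x in u01. u x = r x" "AE x in u01. dr u x = g x"
proof -
  have L: "L2r u" "L2r (dr u)" "weak_deriv1 u (dr u)" using assms dr_spec by (auto simp: H1r_def)
  obtain g where g: "L2b g" "AE x in u01. dr u x = g x" using L2r_borel_version[OF L(2)] .
  have ga: "g absolutely_integrable_on {0..1}" by (rule integrable_uniD[OF L2b_integrable[OF g(1)]]) simp
  have "weak_deriv1 u g" by (rule weak_deriv1_cong_AE[OF L(3) _ g(2)]) simp
  from weak_deriv1_ac_pair[OF L2r_absolutely_integrable[OF L(1)] ga this]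
  obtain r where "ac_pair r g" "r 0 = r 1" "AE x in u01. u x = r x" .
  then show ?thesis using g by (intro that)
qed

lemma ac_pair_L2r:
  fixes r g :: "real \<Rightarrow> real"
  assumes "ac_pair r g" shows "L2r r"
proof -
  have c: "continuous_on {0..1} r" by (rule ac_pair_continuous[OF assms])
  have "r absolutely_integrable_on {0..1}" by (rule absolutely_integrable_continuous_real[OF c])
  then have "r measurable_on {0..1}"
    by (simp add: measurable_on_iff_borel_measurable absolutely_integrable_measurable)
  then show ?thesis
    using c by (auto simp: L2r_def intro!: integrable_continuous_interval continuous_intros)
qed


section \<open>Attainment of the supremum and the subdifferential\<close>

lemma ac_pair_lincomb:
  fixes r s :: "real \<Rightarrow> real"
  assumes "ac_pair r g" "ac_pair s h"
  shows "ac_pair (\<lambda>t. a * r t + b * s t) (\<lambda>t. a * g t + b * h t)"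
proof -
  have c: "ac_pair (\<lambda>t. c) (\<lambda>t. 0)" for c :: real by (simp add: ac_pair_def)
  have 1: "ac_pair (\<lambda>t. a * r t) (\<lambda>t. a * g t)" using ac_pair_mult[OF c assms(1)] by simp
  have 2: "ac_pair (\<lambda>t. b * s t) (\<lambda>t. b * h t)" using ac_pair_mult[OF c assms(2)] by simp
  show ?thesis
    unfolding ac_pair_def
  proof (intro conjI ballI)
    show "(\<lambda>t. a * g t + b * h t) absolutely_integrable_on {0..1}"
      by (rule set_integral_add(1)[OF ac_pair_absint[OF 1] ac_pair_absint[OF 2]])
    fix t :: real assume t: "t \<in> {0..1}"
    have "a * r t = a * r 0 + integral {0..t} (\<lambda>t. a * g t)" "b * s t = b * s 0 + integral {0..t} (\<lambda>t. b * h t)"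
      using ac_pair_eq[OF 1, of t] ac_pair_eq[OF 2, of t] t by auto
    moreover have "integral {0..t} (\<lambda>t. a * g t + b * h t) = integral {0..t} (\<lambda>t. a * g t) + integral {0..t} (\<lambda>t. b * h t)"
      using t by (intro integral_add ac_pair_integrable[OF 1] ac_pair_integrable[OF 2]) auto
    ultimately show "a * r t + b * s t = a * r 0 + b * s 0 + integral {0..t} (\<lambda>t. a * g t + b * h t)" by linarith
  qed
qed

lemma L2b_integral_hk: "L2b f \<Longrightarrow> L2b g \<Longrightarrow> (\<integral>x. f x * g x \<partial>u01) = integral {0..1} (\<lambda>x. f x * g x)"
  by (rule integral_uni_eq[OF L2b_mult_integrable]) auto

lemma H1r_representative:
  assumes "\<rho> \<in> Xset N"
  obtains r k where "L2b k" "ac_pair r k" "r 0 = r 1" "AE x in u01. \<rho> x = r x" "AE x in u01. dr \<rho> x = k x"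
    "integral {0..1} k = 0" "integral {0..1} r = real N"
proof -
  have "H1r \<rho>" using assms by (simp add: Xset_def)
  then obtain k r where *: "L2b k" "ac_pair r k" "r 0 = r 1" "AE x in u01. \<rho> x = r x" "AE x in u01. dr \<rho> x = k x"
    using H1r_ac_pair by metis
  have "integral {0..1} \<rho> = integral {0..1} r" by (rule integral_cong_AE_uni[OF *(4)]) simp
  then show ?thesis using * assms ac_pair_integral[OF *(2)] by (intro that[of k r]) (auto simp: Xset_def)
qed

text \<open>For \<open>v = (f, g)\<close> the primitive of \<open>f - \<integral>f\<close> is periodic, so it can be added to \<open>g\<close> in place of \<open>f\<close>.\<close>
lemma pairing_normal_form:
  assumes "v \<in> Xstar"
  obtains w m where "L2b w" "(\<integral>x. w x \<partial>u01) = 0"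
    "\<And>N \<rho>. \<rho> \<in> Xset N \<Longrightarrow> pairing v \<rho> = m * real N - integral {0..1} (\<lambda>x. w x * dr \<rho> x)"
proof -
  obtain f g where v: "v = (f, g)" "L2r f" "L2r g" using assms by (auto simp: Xstar_def)
  obtain f' where f': "L2b f'" "AE x in u01. f x = f' x" using L2r_borel_version[OF v(2)] .
  obtain g' where g': "L2b g'" "AE x in u01. g x = g' x" using L2r_borel_version[OF v(3)] .
  define m where "m = (\<integral>x. f' x \<partial>u01)"
  have f'a: "f' absolutely_integrable_on {0..1}" by (rule integrable_uniD[OF L2b_integrable[OF f'(1)]]) simp
  have m: "m = integral {0..1} f'" unfolding m_def by (rule integral_uni_eq[OF L2b_integrable[OF f'(1)]]) simp
  have f'm: "(\<lambda>x. f' x - m) absolutely_integrable_on {0..1}" by (rule set_integral_diff(1)[OF f'a]) simp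
  define P where "P t = integral {0..t} (\<lambda>x. f' x - m)" for t
  have P: "ac_pair P (\<lambda>x. f' x - m)" using f'm by (simp add: ac_pair_def P_def)
  have "integral {0..1} (\<lambda>x. f' x - m) = integral {0..1} f' - integral {0..1} (\<lambda>x::real. m)"
    by (rule Henstock_Kurzweil_Integration.integral_diff) (use f'a in \<open>auto simp: absolutely_integrable_on_def\<close>)
  then have P01: "P 0 = 0" "P 1 = 0" by (simp_all add: P_def m)
  obtain P' where P': "L2b P'" "AE x in u01. P x = P' x" using L2r_borel_version[OF ac_pair_L2r[OF P]] .
  define w0 where "w0 x = 1 * P' x + 1 * g' x" for x
  have w0: "L2b w0" unfolding w0_def by (rule L2b_lincomb[OF P'(1) g'(1)])
  \<comment> \<open>The derivative of a periodic function has mean zero, so removing the mean of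
    \<open>w0\<close> leaves the pairing unchanged.\<close>
  define c where "c = (\<integral>x. w0 x \<partial>u01)"
  have w: "L2b (\<lambda>x. w0 x - c)" by (rule L2b_diff[OF w0 L2b_const])
  have "(\<integral>x. w0 x - c \<partial>u01) = 0"
    using L2b_integrable[OF w0] by (simp add: c_def u01.prob_space[simplified])
  moreover have "pairing v \<rho> = m * real N - integral {0..1} (\<lambda>x. (w0 x - c) * dr \<rho> x)" if \<rho>: "\<rho> \<in> Xset N" for N \<rho>
  proof -
    obtain r k where k: "L2b k" and rk: "ac_pair r k" "r 0 = r 1" and ae: "AE x in u01. \<rho> x = r x" "AE x in u01. dr \<rho> x = k x"
      and k0: "integral {0..1} k = 0" and rN: "integral {0..1} r = real N" using H1r_representative[OF \<rho>] .
    have ki: "k integrable_on {0..1}" and ri: "r integrable_on {0..1}" 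
      using ac_pair_integrable[OF rk(1), of 0 1] integrable_continuous_interval[OF ac_pair_continuous[OF rk(1)]] by auto
    have f'r: "(\<lambda>x. f' x * r x) integrable_on {0..1}"
      using absolutely_integrable_continuous_mult[OF ac_pair_continuous[OF rk(1)] f'a]
      by (simp add: absolutely_integrable_on_def mult.commute)
    have "integral {0..1} (\<lambda>x. f x * \<rho> x) = integral {0..1} (\<lambda>x. f' x * r x)"
    proof (rule integral_cong_AE_uni)
      show "AE x in u01. f x * \<rho> x = f' x * r x" using f'(2) ae(1) by eventually_elim simp
    qed simp
    also have "\<dots> = m * real N + integral {0..1} (\<lambda>x. r x * (f' x - m))"
    proof -
      have "integral {0..1} (\<lambda>x. r x * (f' x - m)) = integral {0..1} (\<lambda>x. f' x * r x - m * r x)"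
        by (rule arg_cong[of _ _ "integral {0..1}"]) (auto simp: algebra_simps)
      also have "\<dots> = integral {0..1} (\<lambda>x. f' x * r x) - m * real N"
        using f'r ri by (subst integral_diff) (auto intro: integrable_on_mult_right simp: rN)
      finally show ?thesis by simp
    qed
    also have "integral {0..1} (\<lambda>x. r x * (f' x - m)) = - integral {0..1} (\<lambda>x. k x * P x)"
      by (rule ac_pair_by_parts[OF rk(1) P]) (simp add: P01)
    also have "integral {0..1} (\<lambda>x. k x * P x) = integral {0..1} (\<lambda>x. k x * P' x)"
      by (rule integral_cong_AE_uni) (use P'(2) in \<open>auto elim!: eventually_mono\<close>)
    finally have 1: "integral {0..1} (\<lambda>x. f x * \<rho> x) = m * real N - integral {0..1} (\<lambda>x. k x * P' x)" by simp
    have 2: "integral {0..1} (\<lambda>x. g x * dr \<rho> x) = integral {0..1} (\<lambda>x. g' x * k x)"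
      unfolding L2b_integral_hk[OF g'(1) k, symmetric] by (rule integral_mult_L2_eq[OF g'(2) ae(2) g'(1) k])
    have "integral {0..1} (\<lambda>x. (w0 x - c) * dr \<rho> x) = (\<integral>x. (w0 x - c) * k x \<partial>u01)"
      by (rule integral_mult_L2_eq[OF _ ae(2) w k]) simp
    also have "\<dots> = (\<integral>x. k x * P' x + g' x * k x - c * k x \<partial>u01)"
      by (rule Bochner_Integration.integral_cong) (auto simp: w0_def algebra_simps)
    also have "\<dots> = (\<integral>x. k x * P' x \<partial>u01) + (\<integral>x. g' x * k x \<partial>u01) - c * (\<integral>x. k x \<partial>u01)"
      using L2b_mult_integrable[OF k P'(1)] L2b_mult_integrable[OF g'(1) k] L2b_integrable[OF k] by simp
    also have "(\<integral>x. k x \<partial>u01) = 0"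
      using integral_uni_eq[OF L2b_integrable[OF k]] k0 by simp
    finally have 3: "integral {0..1} (\<lambda>x. (w0 x - c) * dr \<rho> x)
        = integral {0..1} (\<lambda>x. k x * P' x) + integral {0..1} (\<lambda>x. g' x * k x)"
      by (simp add: L2b_integral_hk k P' g')
    show ?thesis unfolding pairing_def v(1) by (simp add: 1 2 3)
  qed
  ultimately show ?thesis using w by (intro that)
qed

lemma H1r_diff:
  assumes "H1r \<rho>" "H1r \<rho>'"
  shows "H1r (\<lambda>x. \<rho> x - \<rho>' x)" "AE x in u01. dr (\<lambda>x. \<rho> x - \<rho>' x) x = dr \<rho> x - dr \<rho>' x"
proof -
  obtain g r where 1: "L2b g" "ac_pair r g" "r 0 = r 1" "AE x in u01. \<rho> x = r x" "AE x in u01. dr \<rho> x = g x"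
    using H1r_ac_pair[OF assms(1)] by metis
  obtain g' r' where 2: "L2b g'" "ac_pair r' g'" "r' 0 = r' 1" "AE x in u01. \<rho>' x = r' x" "AE x in u01. dr \<rho>' x = g' x"
    using H1r_ac_pair[OF assms(2)] by metis
  have ac: "ac_pair (\<lambda>t. r t - r' t) (\<lambda>t. g t - g' t)" using ac_pair_lincomb[OF 1(2) 2(2), of 1 "-1"] by simp
  have L: "L2r (\<lambda>t. g t - g' t)" by (rule L2b_L2r[OF L2b_diff[OF 1(1) 2(1)]])
  have "weak_deriv1 (\<lambda>t. r t - r' t) (\<lambda>t. g t - g' t)" by (rule ac_pair_weak_deriv1[OF ac]) (simp add: 1 2)
  then have w: "weak_deriv1 (\<lambda>x. \<rho> x - \<rho>' x) (\<lambda>t. g t - g' t)"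
  proof (rule weak_deriv1_cong_AE)
    show "AE x in u01. r x - r' x = \<rho> x - \<rho>' x" using 1(4) 2(4) by eventually_elim simp
  qed simp
  have "L2r (\<lambda>x. \<rho> x - \<rho>' x)"
  proof (rule L2r_cong_AE[OF ac_pair_L2r[OF ac]])
    show "AE x in u01. r x - r' x = \<rho> x - \<rho>' x" using 1(4) 2(4) by eventually_elim simp
  qed
  then show "H1r (\<lambda>x. \<rho> x - \<rho>' x)" using L w by (auto simp: H1r_def)
  show "AE x in u01. dr (\<lambda>x. \<rho> x - \<rho>' x) x = dr \<rho> x - dr \<rho>' x"
    using dr_eqI[OF L w] 1(5) 2(5) by eventually_elim simp
qed

text \<open>\<open>bound\<close> is the local upper bound: every mean-zero change of the derivative
  of \<open>\<rho>\<close> by at most \<open>\<delta>\<close> in L2 is realised with energy at most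
  \<open>C\<close>. Taking \<open>h = 0\<close> bounds \<open>Ffun W \<rho>\<close> above,
  \<open>nonneg\<close> with the zero potential bounds it below, and a normalised potential as
  \<open>h\<close> limits the size of near-maximal potentials.\<close>

lemma subdiff_nonempty_if_locally_bounded:
  fixes W :: "'n::finite wf \<Rightarrow> 'n wf \<Rightarrow> complex"
  assumes \<rho>: "\<rho> \<in> Xset CARD('n)"
    and dens: "\<And>\<Psi> :: 'n wf. \<Psi> \<in> Wset \<Longrightarrow> dens \<Psi> \<in> Xset CARD('n)"
    and nonneg: "\<And>\<Psi>. \<Psi> \<in> Wset \<Longrightarrow> 0 \<le> kin \<Psi> + Re (W \<Psi> \<Psi>)"
    and \<delta>: "\<delta> > 0"
    and bound: "\<And>h. L2b h \<Longrightarrow> (\<integral>x. h x \<partial>u01) = 0 \<Longrightarrow> (\<integral>x. (h x)\<^sup>2 \<partial>u01) \<le> 1 \<Longrightarrow>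
      \<exists>\<Psi>\<in>Wset. kin \<Psi> + Re (W \<Psi> \<Psi>) \<le> C \<and> (AE x in u01. dr (dens \<Psi>) x = dr \<rho> x + \<delta> * h x)"
  shows "subdiff W \<rho> \<noteq> {}"
proof -
  define a where "a \<Psi> = kin \<Psi> + Re (W \<Psi> \<Psi>)" for \<Psi> :: "'n wf"
  have E: "Efun W v = (INF \<Psi>\<in>Wset. ereal (a \<Psi> + pairing v (dens \<Psi>)))" for v
    by (simp add: Efun_def a_def)
  have "\<exists>k. L2b k \<and> (AE x in u01. dr \<rho>' x = k x)" if "\<rho>' \<in> Xset N" for \<rho>' N
    using H1r_representative[OF that] by metis
  then obtain K where K: "\<And>\<rho>' N. \<rho>' \<in> Xset N \<Longrightarrow> L2b (K \<rho>')" "\<And>\<rho>' N. \<rho>' \<in> Xset N \<Longrightarrow> AE x in u01. dr \<rho>' x = K \<rho>' x"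
    by metis
  \<comment> \<open>Differences of pairings are linear in the potential with kernel
    \<open>q \<Psi>\<close>: the constant term of the normal form cancels because both densities
    have the same integral.\<close>
  define q where "q \<Psi> x = K \<rho> x - K (dens \<Psi>) x" for \<Psi> :: "'n wf" and x
  have qL: "L2b (q \<Psi>)" if "\<Psi> \<in> Wset" for \<Psi>
    unfolding q_def by (rule L2b_diff[OF K(1)[OF \<rho>] K(1)[OF dens[OF that]]])
  have pK: "integral {0..1} (\<lambda>x. w x * dr \<rho>' x) = (\<integral>x. w x * K \<rho>' x \<partial>u01)" if "L2b w" "\<rho>' \<in> Xset N" for w \<rho>' N
    by (rule integral_mult_L2_eq[OF _ K(2)[OF that(2)] that(1) K(1)[OF that(2)]]) simp
  have pq: "- (\<integral>x. w x * K (dens \<Psi>) x \<partial>u01) + (\<integral>x. w x * K \<rho> x \<partial>u01) = (\<integral>x. w x * q \<Psi> x \<partial>u01)"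
    if "L2b w" "\<Psi> \<in> Wset" for w \<Psi>
    using L2b_mult_integrable[OF that(1) K(1)[OF \<rho>]] L2b_mult_integrable[OF that(1) K(1)[OF dens[OF that(2)]]]
    by (simp add: q_def right_diff_distrib)
  have Ele: "ereal c \<le> Efun W v - ereal (pairing v \<rho>) \<longleftrightarrow> (\<forall>\<Psi>\<in>Wset. c \<le> a \<Psi> + (pairing v (dens \<Psi>) - pairing v \<rho>))" for v c
  proof -
    have "ereal c \<le> Efun W v - ereal (pairing v \<rho>) \<longleftrightarrow> ereal (c + pairing v \<rho>) \<le> Efun W v"
      by (simp add: ereal_le_minus)
    also have "\<dots> \<longleftrightarrow> (\<forall>\<Psi>\<in>Wset. c + pairing v \<rho> \<le> a \<Psi> + pairing v (dens \<Psi>))"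
      unfolding E le_INF_iff by simp
    also have "\<dots> \<longleftrightarrow> (\<forall>\<Psi>\<in>Wset. c \<le> a \<Psi> + (pairing v (dens \<Psi>) - pairing v \<rho>))"
      by (simp add: algebra_simps)
    finally show ?thesis .
  qed
  have normal: "\<exists>w. L2b w \<and> (\<integral>x. w x \<partial>u01) = 0 \<and>
      (\<forall>\<Psi>\<in>Wset. pairing v (dens \<Psi>) - pairing v \<rho> = (\<integral>x. w x * q \<Psi> x \<partial>u01))" if v: "v \<in> Xstar" for v
  proof -
    obtain w m where w: "L2b w" "(\<integral>x. w x \<partial>u01) = 0"
      "\<And>N \<rho>. \<rho> \<in> Xset N \<Longrightarrow> pairing v \<rho> = m * real N - integral {0..1} (\<lambda>x. w x * dr \<rho> x)"
      using pairing_normal_form[OF v] by metis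
    have "pairing v (dens \<Psi>) - pairing v \<rho> = (\<integral>x. w x * q \<Psi> x \<partial>u01)" if \<Psi>: "\<Psi> \<in> Wset" for \<Psi>
      using w(3)[OF dens[OF \<Psi>]] w(3)[OF \<rho>] pK[OF w(1) dens[OF \<Psi>]] pK[OF w(1) \<rho>] pq[OF w(1) \<Psi>] by simp
    then show ?thesis using w by blast
  qed
  have test: "\<exists>\<Psi>\<in>Wset. a \<Psi> \<le> C \<and> (AE x in u01. q \<Psi> x = - (\<delta> * h x))"
    if h: "L2b h" "(\<integral>x. h x \<partial>u01) = 0" "(\<integral>x. (h x)\<^sup>2 \<partial>u01) \<le> 1" for h
  proof -
    obtain \<Psi> where \<Psi>: "\<Psi> \<in> Wset" "a \<Psi> \<le> C" "AE x in u01. dr (dens \<Psi>) x = dr \<rho> x + \<delta> * h x"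
      using bound[OF h] by (auto simp: a_def)
    have "AE x in u01. q \<Psi> x = - (\<delta> * h x)"
      using \<Psi>(3) K(2)[OF \<rho>] K(2)[OF dens[OF \<Psi>(1)]] by eventually_elim (simp add: q_def)
    then show ?thesis using \<Psi> by blast
  qed
  have "Ffun W \<rho> \<le> ereal C"
    unfolding Ffun_def
  proof (rule SUP_least)
    fix v assume v: "v \<in> Xstar"
    obtain w where w: "L2b w" "\<And>\<Psi>. \<Psi> \<in> Wset \<Longrightarrow> pairing v (dens \<Psi>) - pairing v \<rho> = (\<integral>x. w x * q \<Psi> x \<partial>u01)"
      using normal[OF v] by blast
    obtain \<Psi> where \<Psi>: "\<Psi> \<in> Wset" "a \<Psi> \<le> C" "AE x in u01. q \<Psi> x = - (\<delta> * 0)" using test[OF L2b_const[of 0]] by auto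
    have "(\<integral>x. w x * q \<Psi> x \<partial>u01) = 0" by (rule integral_eq_zero_AE) (use \<Psi>(3) in \<open>auto elim!: eventually_mono\<close>)
    then have p: "pairing v (dens \<Psi>) = pairing v \<rho>" using w(2)[OF \<Psi>(1)] by simp
    have "Efun W v \<le> ereal (a \<Psi> + pairing v \<rho>)" unfolding E p[symmetric] by (rule INF_lower[OF \<Psi>(1)])
    then have "Efun W v - ereal (pairing v \<rho>) \<le> ereal (a \<Psi>)" by (simp add: ereal_minus_le)
    also have "\<dots> \<le> ereal C" using \<Psi>(2) by simp
    finally show "Efun W v - ereal (pairing v \<rho>) \<le> ereal C" .
  qed
  moreover have "ereal 0 \<le> Ffun W \<rho>"
  proof -
    have L0: "L2r (\<lambda>x. 0)" by (rule L2b_L2r[OF L2b_const])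
    then have "(\<lambda>x. 0, \<lambda>x. 0) \<in> Xstar" by (simp add: Xstar_def)
    moreover have "ereal 0 \<le> Efun W (\<lambda>x. 0, \<lambda>x. 0) - ereal (pairing (\<lambda>x. 0, \<lambda>x. 0) \<rho>)"
      unfolding Ele using nonneg by (simp add: pairing_def a_def)
    ultimately show ?thesis unfolding Ffun_def by (rule SUP_upper2)
  qed
  ultimately obtain c0 where c0: "Ffun W \<rho> = ereal c0" by (cases "Ffun W \<rho>") auto
  \<comment> \<open>A near-maximal \<open>w\<close> of norm \<open>sqrt s\<close> satisfies
    \<open>c0 - 1 \<le> C - \<delta> * sqrt s\<close>; solving for \<open>s\<close> gives this
    radius.\<close>
  define R where "R = ((C - c0 + 1) / \<delta>)\<^sup>2"
  have "\<exists>w. L2b w \<and> (\<forall>\<Psi>\<in>Wset. c0 \<le> a \<Psi> + (\<integral>x. w x * q \<Psi> x \<partial>u01))"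
  proof (rule L2b_affine_family_maximizer[where R = R])
    show "L2b (q \<Psi>)" if "\<Psi> \<in> Wset" for \<Psi> by (rule qL[OF that])
    fix c assume c: "c < c0"
    \<comment> \<open>The floor \<open>c0 - 1\<close> keeps the radius independent of how far
      \<open>c\<close> lies below \<open>c0\<close>.\<close>
    define c' where "c' = max c (c0 - 1)"
    have "ereal c' < Ffun W \<rho>" using c by (simp add: c0 c'_def)
    then obtain v where v: "v \<in> Xstar" "ereal c' < Efun W v - ereal (pairing v \<rho>)"
      unfolding Ffun_def less_SUP_iff by blast
    obtain w where w: "L2b w" "(\<integral>x. w x \<partial>u01) = 0" "\<And>\<Psi>. \<Psi> \<in> Wset \<Longrightarrow> pairing v (dens \<Psi>) - pairing v \<rho> = (\<integral>x. w x * q \<Psi> x \<partial>u01)"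
      using normal[OF v(1)] by blast
    have le: "c' \<le> a \<Psi> + (\<integral>x. w x * q \<Psi> x \<partial>u01)" if "\<Psi> \<in> Wset" for \<Psi>
      unfolding w(3)[OF that, symmetric] using less_imp_le[OF v(2)] that unfolding Ele by blast
    define s where "s = (\<integral>x. (w x)\<^sup>2 \<partial>u01)"
    have s0: "s \<ge> 0" by (simp add: s_def)
    have "s \<le> R"
    proof (cases "s = 0")
      case True then show ?thesis by (simp add: R_def)
    next
      case False
      then have sp: "sqrt s > 0" using s0 by simp
      \<comment> \<open>The density is displaced in the direction of \<open>w\<close> itself, which
        turns the linear term into \<open>- \<delta> * sqrt s\<close>.\<close>
      define h where "h x = (1 / sqrt s) * w x" for x
      have h: "L2b h" unfolding h_def using L2b_lincomb[OF w(1) w(1), of "1 / sqrt s" 0] by simp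
      have h0: "(\<integral>x. h x \<partial>u01) = 0" by (simp add: h_def w(2))
      have "(\<integral>x. (h x)\<^sup>2 \<partial>u01) = (1 / sqrt s)\<^sup>2 * s" 
        unfolding h_def power_mult_distrib by (simp only: integral_mult_right_zero s_def)
      also have "\<dots> = 1" using s0 False by (simp add: power_divide)
      finally have h1: "(\<integral>x. (h x)\<^sup>2 \<partial>u01) \<le> 1" by simp
      obtain \<Psi> where \<Psi>: "\<Psi> \<in> Wset" "a \<Psi> \<le> C" "AE x in u01. q \<Psi> x = - (\<delta> * h x)" using test[OF h h0 h1] by blast
      have "(\<integral>x. w x * q \<Psi> x \<partial>u01) = (\<integral>x. - (\<delta> / sqrt s) * (w x)\<^sup>2 \<partial>u01)"
      proof (rule integral_cong_AE)
        show "AE x in u01. w x * q \<Psi> x = - (\<delta> / sqrt s) * (w x)\<^sup>2"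
          using \<Psi>(3) by eventually_elim (simp add: h_def power2_eq_square)
      qed (use L2b_measurable[OF w(1)] L2b_measurable[OF qL[OF \<Psi>(1)]] in measurable)
      also have "\<dots> = - (\<delta> * (s / sqrt s))" by (simp add: s_def)
      also have "s / sqrt s = sqrt s" using s0 by (simp add: real_div_sqrt)
      finally have "c' \<le> C - \<delta> * sqrt s" using le[OF \<Psi>(1)] \<Psi>(2) by simp
      moreover have "c0 - 1 \<le> c'" by (simp add: c'_def)
      ultimately have "sqrt s * \<delta> \<le> C - c0 + 1" by (simp add: mult.commute)
      then have "sqrt s \<le> (C - c0 + 1) / \<delta>" using \<delta> by (simp add: pos_le_divide_eq)
      then have "(sqrt s)\<^sup>2 \<le> R" unfolding R_def using sp by (intro power_mono) auto
      then show ?thesis using s0 by simp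
    qed
    moreover have "c \<le> c'" by (simp add: c'_def)
    ultimately show "\<exists>g. L2b g \<and> (\<integral>x. (g x)\<^sup>2 \<partial>u01) \<le> R \<and> (\<forall>\<Psi>\<in>Wset. c \<le> a \<Psi> + (\<integral>x. g x * q \<Psi> x \<partial>u01))"
      using w(1) le unfolding s_def by (meson order_trans)
  qed
  then obtain w where w: "L2b w" "\<And>\<Psi>. \<Psi> \<in> Wset \<Longrightarrow> c0 \<le> a \<Psi> + (\<integral>x. w x * q \<Psi> x \<partial>u01)" by blast
  let ?v = "(\<lambda>x. 0 :: real, w)" and ?u = "(\<lambda>x. 0 :: real, \<lambda>x. - w x)"
  have L: "L2r (\<lambda>x. 0)" "L2r w" "L2r (\<lambda>x. - w x)"
    using L2b_L2r[OF L2b_const] L2b_L2r[OF w(1)] L2b_L2r[OF L2b_lincomb[OF w(1) w(1), of "-1" 0]] by auto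
  have v: "?v \<in> Xstar" and u: "?u \<in> Xstar" using L by (auto simp: Xstar_def)
  have pv: "pairing ?v \<rho>' = - (\<integral>x. w x * K \<rho>' x \<partial>u01)" if "\<rho>' \<in> Xset N" for \<rho>' N
    unfolding pairing_def using pK[OF w(1) that] by simp
  have "ereal c0 \<le> Efun W ?v - ereal (pairing ?v \<rho>)"
    unfolding Ele
  proof
    fix \<Psi> :: "'n wf" assume \<Psi>: "\<Psi> \<in> Wset"
    show "c0 \<le> a \<Psi> + (pairing ?v (dens \<Psi>) - pairing ?v \<rho>)"
      using w(2)[OF \<Psi>] pq[OF w(1) \<Psi>] pv[OF \<rho>] pv[OF dens[OF \<Psi>]] by simp
  qed
  then have Ev: "ereal (c0 + pairing ?v \<rho>) \<le> Efun W ?v" by (simp add: ereal_le_minus)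
  have "?u \<in> subdiff W \<rho>"
    unfolding subdiff_def
  proof (intro CollectI conjI ballI u)
    fix \<rho>' assume \<rho>': "\<rho>' \<in> Xset CARD('n)"
    have "ereal (c0 + pairing ?v \<rho> - pairing ?v \<rho>') \<le> Efun W ?v - ereal (pairing ?v \<rho>')"
      using Ev by (simp add: ereal_le_minus)
    also have "\<dots> \<le> Ffun W \<rho>'" unfolding Ffun_def by (rule SUP_upper[OF v])
    \<comment> \<open>\<open>Ffun W \<rho>'\<close> may be infinite, so the inequality is passed
      through the difference by monotonicity of extended subtraction.\<close>
    finally have "ereal c0 - Ffun W \<rho>' \<le> ereal c0 - ereal (c0 + pairing ?v \<rho> - pairing ?v \<rho>')"
      by (intro ereal_minus_mono) auto
    also have "\<dots> = ereal (pairing ?v \<rho>' - pairing ?v \<rho>)" by simp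
    \<comment> \<open>Linearity of the pairing is not immediate, since \<open>dr\<close> of the
      difference is a choice of its own; it agrees with the difference of the derivatives almost
      everywhere.\<close>
    also have "pairing ?v \<rho>' - pairing ?v \<rho> = pairing ?u (\<lambda>x. \<rho> x - \<rho>' x)"
    proof -
      have H: "H1r \<rho>" "H1r \<rho>'" using \<rho> \<rho>' by (auto simp: Xset_def)
      have "AE x in u01. dr (\<lambda>x. \<rho> x - \<rho>' x) x = K \<rho> x - K \<rho>' x"
        using H1r_diff(2)[OF H] K(2)[OF \<rho>] K(2)[OF \<rho>'] by eventually_elim simp
      then have "integral {0..1} (\<lambda>x. - w x * dr (\<lambda>x. \<rho> x - \<rho>' x) x) = (\<integral>x. - w x * (K \<rho> x - K \<rho>' x) \<partial>u01)"
        using L2b_lincomb[OF w(1) w(1), of "-1" 0]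
        by (intro integral_mult_L2_eq L2b_diff K(1)[OF \<rho>] K(1)[OF \<rho>']) auto
      also have "\<dots> = (\<integral>x. w x * K \<rho>' x - w x * K \<rho> x \<partial>u01)"
        by (rule Bochner_Integration.integral_cong) (auto simp: algebra_simps)
      also have "\<dots> = (\<integral>x. w x * K \<rho>' x \<partial>u01) - (\<integral>x. w x * K \<rho> x \<partial>u01)"
        by (rule Bochner_Integration.integral_diff) (rule L2b_mult_integrable[OF w(1)] K(1)[OF \<rho>] K(1)[OF \<rho>'])+
      finally show ?thesis using pv[OF \<rho>] pv[OF \<rho>'] by (simp add: pairing_def)
    qed
    finally show "Ffun W \<rho> - Ffun W \<rho>' \<le> ereal (pairing ?u (\<lambda>x. \<rho> x - \<rho>' x))" by (simp add: c0)
  qed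
  then show ?thesis by blast
qed


section \<open>Densities of finite-energy wave functions\<close>

text \<open>Products allow the factor in one coordinate to be exchanged while the others stay fixed,
  and they suffice to detect functions that vanish almost everywhere.\<close>

lemma testN_prod:
  fixes b d :: "'n::finite \<Rightarrow> real \<Rightarrow> real"
  assumes b: "\<And>i. test1 (b i) (d i)"
  shows "testN (\<lambda>x. \<Prod>k\<in>UNIV. b k (x $ k)) (\<lambda>i x. d i (x $ i) * (\<Prod>k\<in>UNIV - {i}. b k (x $ k)))"
  unfolding testN_def
proof (intro conjI allI)
  fix x :: "real^'n" and i
  have per: "b k (t + 1) = b k t" for k t using b[of k] by (simp add: test1_def)
  have "b k ((x + axis i 1) $ k) = b k (x $ k)" for k
    by (simp add: axis_def per)
  then show "(\<Prod>k\<in>UNIV. b k ((x + axis i 1) $ k)) = (\<Prod>k\<in>UNIV. b k (x $ k))" by simp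
next
  fix i
  have cd: "continuous_on UNIV (d k)" and cb: "continuous_on UNIV (b k)" for k
    using b[of k] test1_continuous[OF b] by (auto simp: test1_def)
  have c1: "continuous_on UNIV (\<lambda>x::real^'n. d k (x $ k))" "continuous_on UNIV (\<lambda>x::real^'n. b k (x $ k))" for k
    by (intro continuous_on_compose2[OF cd] continuous_on_compose2[OF cb] continuous_intros; simp)+
  show "continuous_on UNIV (\<lambda>x::real^'n. d i (x $ i) * (\<Prod>k\<in>UNIV - {i}. b k (x $ k)))"
    by (intro continuous_intros c1)
  fix x :: "real^'n"
  have eq: "(\<Prod>k\<in>UNIV. b k ((x + t *\<^sub>R axis i 1) $ k)) = b i (x $ i + t) * (\<Prod>k\<in>UNIV - {i}. b k (x $ k))" for t
  proof -
    have "(\<Prod>k\<in>insert i (UNIV - {i}). b k ((x + t *\<^sub>R axis i 1) $ k)) = b i (x $ i + t) * (\<Prod>k\<in>UNIV - {i}. b k ((x + t *\<^sub>R axis i 1) $ k))"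
      by (subst prod.insert) (auto simp: axis_def)
    also have "(\<Prod>k\<in>UNIV - {i}. b k ((x + t *\<^sub>R axis i 1) $ k)) = (\<Prod>k\<in>UNIV - {i}. b k (x $ k))"
      by (rule prod.cong) (auto simp: axis_def)
    finally show ?thesis by (simp add: insert_absorb)
  qed
  have "(b i has_real_derivative d i (x $ i)) (at (x $ i + 0))" using b[of i] by (simp add: test1_def)
  then have "((\<lambda>t. b i (x $ i + t)) has_real_derivative d i (x $ i)) (at 0)"
  proof (rule DERIV_chain2[where x = 0 and Db = 1 and g = "\<lambda>t. x $ i + t", THEN DERIV_cong])
    show "((+) (x $ i) has_real_derivative 1) (at 0)" by (auto intro!: derivative_eq_intros)
  qed simp
  then show "((\<lambda>t. \<Prod>k\<in>UNIV. b k ((x + t *\<^sub>R axis i 1) $ k)) has_real_derivative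
      d i (x $ i) * (\<Prod>k\<in>UNIV - {i}. b k (x $ k))) (at 0)"
    unfolding eq by (rule DERIV_cmult_right)
qed

lemma integrable_bounded_mult:
  fixes f :: "'a \<Rightarrow> 'b::{banach, second_countable_topology, real_normed_field}" and g :: "'a \<Rightarrow> real"
  assumes "integrable M f" "g \<in> borel_measurable M" "\<And>x. \<bar>g x\<bar> \<le> B"
  shows "integrable M (\<lambda>x. g x *\<^sub>R f x)"
proof (rule Bochner_Integration.integrable_bound[where f = "\<lambda>x. B *\<^sub>R f x"])
  show "AE x in M. norm (g x *\<^sub>R f x) \<le> norm (B *\<^sub>R f x)"
    using assms(3) by (auto intro!: AE_I2 mult_right_mono order_trans[OF _ abs_ge_self])
qed (use assms in auto)

lemma borel_measurable_integral_u01: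
  fixes h :: "'a::topological_space \<Rightarrow> real \<Rightarrow> 'b::{banach, second_countable_topology}"
  assumes "(\<lambda>(x, s). h x s) \<in> borel_measurable (borel \<Otimes>\<^sub>M borel)"
  shows "(\<lambda>x. \<integral>s. h x s \<partial>u01) \<in> borel_measurable borel"
proof (rule u01.borel_measurable_lebesgue_integral)
  have "sets (borel \<Otimes>\<^sub>M u01) = sets ((borel :: 'a measure) \<Otimes>\<^sub>M (borel :: real measure))"
    by (rule sets_pair_measure_cong) simp_all
  then show "(\<lambda>(x, s). h x s) \<in> borel_measurable (borel \<Otimes>\<^sub>M u01)"
    using assms by (simp cong: measurable_cong_sets)
qed

text \<open>Factor bounds of at least 1 make the product over any subset at most the full product,
  so one \<open>B\<close> serves for all subsets.\<close>

lemma prod_test_bounded: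
  fixes b d :: "'n::finite \<Rightarrow> real \<Rightarrow> real"
  assumes b: "\<And>i. test1 (b i) (d i)"
  obtains B where "\<And>S x. \<bar>\<Prod>k\<in>S. b k (x $ k)\<bar> \<le> (B::real)"
proof -
  have "\<forall>i. \<exists>B\<ge>1. \<forall>x. \<bar>b i x\<bar> \<le> B"
  proof
    fix i
    obtain B where "\<And>x. \<bar>b i x\<bar> \<le> B" using test1_bounded[OF b] by blast
    then show "\<exists>B\<ge>1. \<forall>x. \<bar>b i x\<bar> \<le> B" by (intro exI[of _ "max 1 B"]) (auto intro: le_max_iff_disj[THEN iffD2])
  qed
  then obtain B where B: "\<And>i. B i \<ge> 1" "\<And>i x. \<bar>b i x\<bar> \<le> B i" by metis
  have "\<bar>\<Prod>k\<in>S. b k (x $ k)\<bar> \<le> (\<Prod>k\<in>UNIV. B k)" for S x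
  proof -
    have "\<bar>\<Prod>k\<in>S. b k (x $ k)\<bar> \<le> (\<Prod>k\<in>S. B k)"
      unfolding abs_prod using B by (intro prod_mono) auto
    also have "\<dots> \<le> (\<Prod>k\<in>UNIV. B k)"
      using B(1) by (intro prod_mono2) (auto intro: order_trans[OF zero_le_one])
    finally show ?thesis .
  qed
  then show ?thesis by (rule that)
qed

lemma weak_pderiv_ucube:
  fixes u g :: "real^'n::finite \<Rightarrow> complex"
  assumes "weak_pderiv i u g" "testN \<phi> d"
    and "integrable ucube (\<lambda>x. d i x *\<^sub>R u x)" "integrable ucube (\<lambda>x. \<phi> x *\<^sub>R g x)"
  shows "(\<integral>x. d i x *\<^sub>R u x \<partial>ucube) = - (\<integral>x. \<phi> x *\<^sub>R g x \<partial>ucube)"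
proof -
  have "integral cube (\<lambda>x. of_real (d i x) * u x) = - integral cube (\<lambda>x. of_real (\<phi> x) * g x)"
    using assms(1,2) unfolding weak_pderiv_def by blast
  then show ?thesis
    unfolding integral_uni_eq[OF assms(3) cube_borel] integral_uni_eq[OF assms(4) cube_borel]
    by (simp add: scaleR_conv_of_real)
qed

text \<open>As in one dimension, \<open>u - \<integral>\<^sub>0\<^sup>t g\<close> minus its mean along
  the line is orthogonal to all products of test functions.\<close>
lemma weak_pderiv_ac_on_lines:
  fixes u g :: "real^'n::finite \<Rightarrow> complex"
  assumes u: "integrable ucube u" and g: "integrable ucube g" and w: "weak_pderiv i u g"
  shows "AE y in ucube. \<exists>w. ac_pair w (\<lambda>s. g (vupd i y s)) \<and> w 0 = w 1 \<and> (AE t in u01. u (vupd i y t) = w t)"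
proof -
  have um[measurable]: "u \<in> borel_measurable borel" and gm[measurable]: "g \<in> borel_measurable borel"
    using u g by (auto simp: borel_measurable_integrable cong: measurable_cong_sets)
  \<comment> \<open>The primitive along the line, written as an integral over the whole interval: in
    this form it is total and Borel measurable in \<open>x\<close>, also on the exceptional lines
    where \<open>g\<close> is not integrable.\<close>
  define G where "G x = (\<integral>s. (if s \<le> x $ i then g (vupd i x s) else 0) \<partial>u01)" for x
  \<comment> \<open>The increment of the primitive over a full period; it has to vanish for the
    function on the line to be periodic.\<close>
  define F where "F x = (\<integral>s. g (vupd i x s) \<partial>u01)" for x
  define c where "c x = (\<integral>s. u (vupd i x s) - G (vupd i x s) \<partial>u01)" for x
  have Gm[measurable]: "G \<in> borel_measurable borel"
    unfolding G_def by (rule borel_measurable_integral_u01) measurable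
  have Fm[measurable]: "F \<in> borel_measurable borel" unfolding F_def by (rule borel_measurable_integral_u01) measurable
  have cm[measurable]: "c \<in> borel_measurable borel" unfolding c_def by (rule borel_measurable_integral_u01) measurable
  have F: "integrable ucube F" unfolding F_def by (rule integral_vupd(7)[OF g])
  have G: "integrable ucube G"
  proof (rule Bochner_Integration.integrable_bound)
    show "integrable ucube (\<lambda>x. \<integral>s. norm (g (vupd i x s)) \<partial>u01)"
      by (rule integral_vupd(7)[OF integrable_norm[OF g]])
    have "AE x in ucube. integrable u01 (\<lambda>s. g (vupd i x s))" by (rule integral_vupd(5)[OF g])
    then show "AE x in ucube. norm (G x) \<le> norm (\<integral>s. norm (g (vupd i x s)) \<partial>u01)"
    proof eventually_elim
      case (elim x)
      have "norm (G x) \<le> (\<integral>s. norm (if s \<le> x $ i then g (vupd i x s) else 0) \<partial>u01)"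
        unfolding G_def by (rule integral_norm_bound)
      also have "\<dots> \<le> (\<integral>s. norm (g (vupd i x s)) \<partial>u01)"
      proof (rule integral_mono)
        have "integrable u01 (\<lambda>s. indicator {..x $ i} s *\<^sub>R g (vupd i x s))"
          using elim by (intro integrable_mult_indicator) auto
        moreover have "(\<lambda>s. indicator {..x $ i} s *\<^sub>R g (vupd i x s)) = (\<lambda>s. if s \<le> x $ i then g (vupd i x s) else 0)"
          by (auto simp: indicator_def)
        ultimately show "integrable u01 (\<lambda>s. norm (if s \<le> x $ i then g (vupd i x s) else 0))" by simp
      qed (use elim in auto)
      finally show ?case by simp
    qed
  qed measurable
  have c: "integrable ucube c"
    unfolding c_def by (rule integral_vupd(7)[OF Bochner_Integration.integrable_diff[OF u G]])
  have line: "AE y in ucube. integrable u01 (\<lambda>t. u (vupd i y t)) \<and> integrable u01 (\<lambda>s. g (vupd i y s))"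
    using integral_vupd(5)[OF u, of i] integral_vupd(5)[OF g, of i] by eventually_elim simp
  have Gline: "ac_pair (\<lambda>t. G (vupd i y t)) (\<lambda>s. g (vupd i y s))" "G (vupd i y 0) = 0"
    "integrable u01 (\<lambda>t. G (vupd i y t))"
    if y: "integrable u01 (\<lambda>s. g (vupd i y s))" for y
  proof -
    have hk: "G (vupd i y t) = integral {0..t} (\<lambda>s. g (vupd i y s))" if t: "t \<in> {0..1}" for t
    proof -
      have "integrable u01 (\<lambda>s. indicator {..t} s *\<^sub>R g (vupd i y s))"
        using y by (intro integrable_mult_indicator) auto
      moreover have "(\<lambda>s. indicator {..t} s *\<^sub>R g (vupd i y s)) = (\<lambda>s. if s \<le> t then g (vupd i y s) else 0)"
        by (auto simp: indicator_def)
      ultimately have int: "integrable u01 (\<lambda>s. if s \<le> t then g (vupd i y s) else 0)" by simp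
      have "G (vupd i y t) = integral {0..1} (\<lambda>s. if s \<le> t then g (vupd i y s) else 0)"
        using integral_uni_eq[OF int] unfolding G_def vupd_vupd by simp
      also have "\<dots> = integral {0..1} (\<lambda>s. if s \<in> {0..t} then g (vupd i y s) else 0)"
        by (rule Henstock_Kurzweil_Integration.integral_cong) auto
      also have "\<dots> = integral {0..t} (\<lambda>s. g (vupd i y s))"
      proof -
        have "{0..t} \<inter> {0..1} = {0..t}" using t by auto
        then show ?thesis unfolding integral_restrict_Int by (rule arg_cong)
      qed
      finally show ?thesis .
    qed
    show ac: "ac_pair (\<lambda>t. G (vupd i y t)) (\<lambda>s. g (vupd i y s))"
      unfolding ac_pair_def using hk[of 0] hk integrable_uniD[OF y] by simp
    show "G (vupd i y 0) = 0" using hk[of 0] by simp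
    have "(\<lambda>t. G (vupd i y t)) absolutely_integrable_on {0..1}"
      by (rule absolutely_integrable_continuous_real[OF ac_pair_continuous[OF ac]])
    then show "integrable u01 (\<lambda>t. G (vupd i y t))" by (subst integrable_uni_iff) auto
  qed
  have test: "(\<integral>x. (\<Prod>k\<in>UNIV. b k (x $ k)) *\<^sub>R (u x - G x - c x) \<partial>ucube) = 0 \<and>
      (\<integral>x. (\<Prod>k\<in>UNIV. b k (x $ k)) *\<^sub>R F x \<partial>ucube) = 0"
    if "\<And>k. \<exists>d. test1 (b k) d" for b
  proof -
    obtain d where b: "\<And>k. test1 (b k) (d k)" using \<open>\<And>k. \<exists>d. test1 (b k) d\<close> by metis
    let ?m = "integral {0..1} (b i)"
    obtain \<phi> where \<phi>: "\<phi> 0 = 0" "test1 \<phi> (\<lambda>x. b i x - ?m)" using test1_antiderivative[OF b] by blast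
    have "\<phi> (0 + 1) = \<phi> 0" using \<phi>(2) unfolding test1_def by blast
    then have \<phi>1: "\<phi> 1 = 0" using \<phi>(1) by simp
    \<comment> \<open>The factors in the other coordinates are constant on lines in direction
      \<open>i\<close> and come out of the inner integral.\<close>
    define P where "P x = (\<Prod>k\<in>UNIV - {i}. b k (x $ k))" for x
    have Pv: "P (vupd i y t) = P y" for y t unfolding P_def by (rule prod.cong) auto
    have split: "(\<Prod>k\<in>UNIV. b k (x $ k)) = b i (x $ i) * P x" for x
      unfolding P_def by (rule prod.remove) auto
    have [measurable]: "b k \<in> borel_measurable borel" "\<phi> \<in> borel_measurable borel" for k
      using test1_measurable(1)[OF b] test1_measurable(1)[OF \<phi>(2)] by auto
    have Pm[measurable]: "P \<in> borel_measurable borel" unfolding P_def by measurable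
    obtain B where B: "\<And>S x. \<bar>\<Prod>k\<in>S. b k (x $ k)\<bar> \<le> B" using prod_test_bounded[of b d, OF b] by metis
    have PB: "\<bar>P x\<bar> \<le> B" for x unfolding P_def by (rule B)
    obtain B1 where B1: "\<And>x. \<bar>b i x\<bar> \<le> B1" using test1_bounded[OF b[of i]] by metis
    obtain B2 where B2: "\<And>x. \<bar>\<phi> x\<bar> \<le> B2" using test1_bounded[OF \<phi>(2)] by metis
    have B3: "\<bar>b i x - ?m\<bar> \<le> B1 + \<bar>?m\<bar>" for x using B1[of x] by (auto intro: order_trans[OF abs_triangle_ineq4])
    have B0: "0 \<le> B" "0 \<le> B1" "0 \<le> B2" using PB[of 0] B1[of 0] B2[of 0] by linarith+
    have I: "integrable ucube (\<lambda>x. (h (x $ i) * P x) *\<^sub>R f x)"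
      if "integrable ucube f" "h \<in> borel_measurable borel" "\<And>x. \<bar>h x\<bar> \<le> C" for f :: "real^'n \<Rightarrow> complex" and h C
    proof (rule integrable_bounded_mult[OF that(1), where B = "\<bar>C\<bar> * B"])
      show "(\<lambda>x. h (x $ i) * P x) \<in> borel_measurable ucube" using that(2) by measurable
      show "\<bar>h (x $ i) * P x\<bar> \<le> \<bar>C\<bar> * B" for x
        unfolding abs_mult using that(3)[of "x $ i"] PB[of x] by (intro mult_mono) auto
    qed
    have Il: "integrable u01 (\<lambda>t. h t *\<^sub>R f t)"
      if "integrable u01 f" "h \<in> borel_measurable borel" "\<And>x. \<bar>h x\<bar> \<le> C" for f :: "real \<Rightarrow> complex" and h C
      by (rule integrable_bounded_mult[OF that(1) _ that(3)]) (use that(2) in auto)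
    have Fub: "(\<integral>x. (h (x $ i) * P x) *\<^sub>R f x \<partial>ucube) = (\<integral>y. P y *\<^sub>R (\<integral>t. h t *\<^sub>R f (vupd i y t) \<partial>u01) \<partial>ucube)"
      "integrable ucube (\<lambda>y. P y *\<^sub>R (\<integral>t. h t *\<^sub>R f (vupd i y t) \<partial>u01))"
      if "integrable ucube f" "h \<in> borel_measurable borel" "\<And>x. \<bar>h x\<bar> \<le> C" for f :: "real^'n \<Rightarrow> complex" and h C
    proof -
      have eq: "(\<integral>t. (h (vupd i y t $ i) * P (vupd i y t)) *\<^sub>R f (vupd i y t) \<partial>u01) = P y *\<^sub>R (\<integral>t. h t *\<^sub>R f (vupd i y t) \<partial>u01)" for y
        unfolding integral_scaleR_right[symmetric] by (simp add: Pv mult.commute)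
      show "(\<integral>x. (h (x $ i) * P x) *\<^sub>R f x \<partial>ucube) = (\<integral>y. P y *\<^sub>R (\<integral>t. h t *\<^sub>R f (vupd i y t) \<partial>u01) \<partial>ucube)"
        using integral_vupd(3)[OF I[OF that], of i] unfolding eq .
      show "integrable ucube (\<lambda>y. P y *\<^sub>R (\<integral>t. h t *\<^sub>R f (vupd i y t) \<partial>u01))"
        using integral_vupd(7)[OF I[OF that], of i] unfolding eq .
    qed
    have bim: "b i \<in> borel_measurable borel" "(\<lambda>x. b i x - ?m) \<in> borel_measurable borel" "\<phi> \<in> borel_measurable borel"
      by measurable
    have uGc: "integrable ucube (\<lambda>x. u x - G x - c x)" using u G c by simp
    have "(\<integral>x. (\<Prod>k\<in>UNIV. b k (x $ k)) *\<^sub>R (u x - G x - c x) \<partial>ucube)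
        = (\<integral>y. P y *\<^sub>R (\<integral>t. b i t *\<^sub>R (u (vupd i y t) - G (vupd i y t) - c (vupd i y t)) \<partial>u01) \<partial>ucube)"
      unfolding split by (rule Fub(1)[OF uGc bim(1) B1])
    also have "\<dots> = (\<integral>y. P y *\<^sub>R (\<integral>t. (b i t - ?m) *\<^sub>R u (vupd i y t) \<partial>u01) + P y *\<^sub>R (\<integral>t. \<phi> t *\<^sub>R g (vupd i y t) \<partial>u01) \<partial>ucube)"
    proof (rule integral_cong_AE)
      show "AE y in ucube. P y *\<^sub>R (\<integral>t. b i t *\<^sub>R (u (vupd i y t) - G (vupd i y t) - c (vupd i y t)) \<partial>u01)
          = P y *\<^sub>R (\<integral>t. (b i t - ?m) *\<^sub>R u (vupd i y t) \<partial>u01) + P y *\<^sub>R (\<integral>t. \<phi> t *\<^sub>R g (vupd i y t) \<partial>u01)"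
        using line
      proof eventually_elim
        case (elim y)
        then have uy: "integrable u01 (\<lambda>t. u (vupd i y t))" and gy: "integrable u01 (\<lambda>t. g (vupd i y t))" by auto
        note Gy = Gline[OF gy]
        have cy: "c (vupd i y t) = (\<integral>s. u (vupd i y s) \<partial>u01) - (\<integral>s. G (vupd i y s) \<partial>u01)" for t
          unfolding c_def using uy Gy(3) by simp
        have ibm: "(\<integral>t. b i t \<partial>u01) = ?m"
          by (rule integral_uni_eq) (auto intro!: u01.integrable_const_bound[where B = B1] simp: B1)
        have ib: "integrable u01 (b i)" by (auto intro!: u01.integrable_const_bound[where B = B1] simp: B1)
        let ?C = "(\<integral>s. u (vupd i y s) \<partial>u01) - (\<integral>s. G (vupd i y s) \<partial>u01)"
        have "(\<integral>t. b i t *\<^sub>R (u (vupd i y t) - G (vupd i y t) - c (vupd i y t)) \<partial>u01)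
            = (\<integral>t. b i t *\<^sub>R u (vupd i y t) - b i t *\<^sub>R G (vupd i y t) - b i t *\<^sub>R ?C \<partial>u01)"
          unfolding cy by (simp add: scaleR_right_diff_distrib)
        also have "\<dots> = (\<integral>t. b i t *\<^sub>R u (vupd i y t) \<partial>u01) - (\<integral>t. b i t *\<^sub>R G (vupd i y t) \<partial>u01) - ?m *\<^sub>R ?C"
          using Il[OF uy bim(1) B1] Il[OF Gy(3) bim(1) B1] ib by (simp add: ibm)
        also have "\<dots> = ((\<integral>t. b i t *\<^sub>R u (vupd i y t) \<partial>u01) - ?m *\<^sub>R (\<integral>s. u (vupd i y s) \<partial>u01))
            - ((\<integral>t. b i t *\<^sub>R G (vupd i y t) \<partial>u01) - ?m *\<^sub>R (\<integral>s. G (vupd i y s) \<partial>u01))"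
          by (simp add: scaleR_right_diff_distrib)
        also have "\<dots> = (\<integral>t. (b i t - ?m) *\<^sub>R u (vupd i y t) \<partial>u01) - (\<integral>t. (b i t - ?m) *\<^sub>R G (vupd i y t) \<partial>u01)"
          using Il[OF uy bim(1) B1] Il[OF Gy(3) bim(1) B1] uy Gy(3) by (simp add: scaleR_left_diff_distrib)
        \<comment> \<open>\<open>G\<close> is not yet known to be periodic along the line, but
          \<open>\<phi>\<close> vanishes at both ends.\<close>
        also have "(\<integral>t. (b i t - ?m) *\<^sub>R G (vupd i y t) \<partial>u01) = - (\<integral>t. \<phi> t *\<^sub>R g (vupd i y t) \<partial>u01)"
        proof -
          have ac\<phi>: "ac_pair (\<lambda>t. complex_of_real (\<phi> t)) (\<lambda>t. complex_of_real (b i t - ?m))"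
            by (rule ac_pair_bounded_linear[OF test1_ac_pair[OF \<phi>(2)] bounded_linear_of_real])
          have "integral {0..1} (\<lambda>t. G (vupd i y t) * complex_of_real (b i t - ?m)) = - integral {0..1} (\<lambda>t. g (vupd i y t) * complex_of_real (\<phi> t))"
            by (rule ac_pair_by_parts[OF Gy(1) ac\<phi>]) (simp add: Gy(2) \<phi>1)
          then show ?thesis
            using integral_uni_eq[OF Il[OF Gy(3) bim(2) B3]] integral_uni_eq[OF Il[OF gy bim(3) B2]]
            by (simp add: scaleR_conv_of_real mult.commute)
        qed
        finally show ?case by (simp add: scaleR_right_distrib)
      qed
    qed measurable
    also have "\<dots> = (\<integral>x. ((b i (x $ i) - ?m) * P x) *\<^sub>R u x \<partial>ucube) + (\<integral>x. (\<phi> (x $ i) * P x) *\<^sub>R g x \<partial>ucube)"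
      using Fub[OF u bim(2) B3] Fub[OF g bim(3) B2] by simp
    \<comment> \<open>Here the weak derivative enters, tested with the product in which
      \<open>b i\<close> is replaced by \<open>\<phi>\<close>, whose derivative is
      \<open>b i\<close> minus its mean.\<close>
    also have "\<dots> = 0"
    proof -
      have t: "testN (\<lambda>x. \<Prod>k\<in>UNIV. (b(i := \<phi>)) k (x $ k)) (\<lambda>j x. (d(i := \<lambda>x. b i x - ?m)) j (x $ j) * (\<Prod>k\<in>UNIV - {j}. (b(i := \<phi>)) k (x $ k)))"
        by (rule testN_prod) (use b \<phi>(2) in auto)
      have e1: "(\<Prod>k\<in>UNIV. (b(i := \<phi>)) k (x $ k)) = \<phi> (x $ i) * P x" for x
      proof -
        have "(\<Prod>k\<in>UNIV. (b(i := \<phi>)) k (x $ k)) = (b(i := \<phi>)) i (x $ i) * (\<Prod>k\<in>UNIV - {i}. (b(i := \<phi>)) k (x $ k))"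
          by (rule prod.remove) auto
        also have "(\<Prod>k\<in>UNIV - {i}. (b(i := \<phi>)) k (x $ k)) = P x" unfolding P_def by (rule prod.cong) auto
        finally show ?thesis by simp
      qed
      have e2: "(d(i := \<lambda>x. b i x - ?m)) i (x $ i) * (\<Prod>k\<in>UNIV - {i}. (b(i := \<phi>)) k (x $ k)) = (b i (x $ i) - ?m) * P x" for x
      proof -
        have "(\<Prod>k\<in>UNIV - {i}. (b(i := \<phi>)) k (x $ k)) = P x" unfolding P_def by (rule prod.cong) auto
        then show ?thesis by simp
      qed
      show ?thesis
        using weak_pderiv_ucube[OF w t] I[OF u bim(2) B3] I[OF g bim(3) B2] unfolding e1 e2 by simp
    qed
    finally have z1: "(\<integral>x. (\<Prod>k\<in>UNIV. b k (x $ k)) *\<^sub>R (u x - G x - c x) \<partial>ucube) = 0" .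
    have "(\<integral>x. (\<Prod>k\<in>UNIV. b k (x $ k)) *\<^sub>R F x \<partial>ucube) = (\<integral>y. P y *\<^sub>R (\<integral>t. b i t *\<^sub>R F (vupd i y t) \<partial>u01) \<partial>ucube)"
      unfolding split by (rule Fub(1)[OF F bim(1) B1])
    also have "\<dots> = (\<integral>y. ?m *\<^sub>R (P y *\<^sub>R (\<integral>t. 1 *\<^sub>R g (vupd i y t) \<partial>u01)) \<partial>ucube)"
    proof (rule Bochner_Integration.integral_cong)
      fix y
      have ibm: "(\<integral>t. b i t \<partial>u01) = ?m"
        by (rule integral_uni_eq) (auto intro!: u01.integrable_const_bound[where B = B1] simp: B1)
      have ib: "integrable u01 (b i)" by (auto intro!: u01.integrable_const_bound[where B = B1] simp: B1)
      have "(\<integral>t. b i t *\<^sub>R F (vupd i y t) \<partial>u01) = (\<integral>t. b i t *\<^sub>R F y \<partial>u01)" by (simp add: F_def)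
      also have "\<dots> = ?m *\<^sub>R F y" using ib by (simp add: ibm)
      finally show "P y *\<^sub>R (\<integral>t. b i t *\<^sub>R F (vupd i y t) \<partial>u01) = ?m *\<^sub>R (P y *\<^sub>R (\<integral>t. 1 *\<^sub>R g (vupd i y t) \<partial>u01))"
        by (simp add: F_def mult.commute)
    qed simp
    also have "\<dots> = ?m *\<^sub>R (\<integral>x. (1 * P x) *\<^sub>R g x \<partial>ucube)"
      unfolding integral_scaleR_right using Fub(1)[OF g, of "\<lambda>x. 1" 1] by simp
    \<comment> \<open>With the constant 1 in coordinate \<open>i\<close> the test product has
      derivative zero in that direction, so the weak equation says that \<open>g\<close> integrates
      to zero against \<open>P\<close>.\<close>
    also have "(\<integral>x. (1 * P x) *\<^sub>R g x \<partial>ucube) = 0"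
    proof -
      have t: "testN (\<lambda>x. \<Prod>k\<in>UNIV. (b(i := \<lambda>x. 1)) k (x $ k)) (\<lambda>j x. (d(i := \<lambda>x. 0)) j (x $ j) * (\<Prod>k\<in>UNIV - {j}. (b(i := \<lambda>x. 1)) k (x $ k)))"
        by (rule testN_prod) (use b test1_const in auto)
      have e1: "(\<Prod>k\<in>UNIV. (b(i := \<lambda>x. 1)) k (x $ k)) = 1 * P x" for x
      proof -
        have "(\<Prod>k\<in>UNIV. (b(i := \<lambda>x. 1)) k (x $ k)) = (b(i := \<lambda>x. 1)) i (x $ i) * (\<Prod>k\<in>UNIV - {i}. (b(i := \<lambda>x. 1)) k (x $ k))"
          by (rule prod.remove) auto
        also have "(\<Prod>k\<in>UNIV - {i}. (b(i := \<lambda>x. 1)) k (x $ k)) = P x" unfolding P_def by (rule prod.cong) auto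
        finally show ?thesis by simp
      qed
      show ?thesis
        using weak_pderiv_ucube[OF w t] I[OF g, of "\<lambda>x. 1" 1] unfolding e1 by simp
    qed
    finally have z2: "(\<integral>x. (\<Prod>k\<in>UNIV. b k (x $ k)) *\<^sub>R F x \<partial>ucube) = 0" by simp
    show ?thesis using z1 z2 by blast
  qed
  have "AE x in ucube. u x - G x - c x = 0"
    by (rule AE_zero_if_product_test_integrals_zero) (use u G c test in auto)
  then have A1: "AE y in ucube. AE t in u01. u (vupd i y t) - G (vupd i y t) - c (vupd i y t) = 0" by (rule AE_vupd(2))
  have A2: "AE x in ucube. F x = 0"
    by (rule AE_zero_if_product_test_integrals_zero) (use F test in auto)
  show ?thesis
    using line A1 A2
  proof eventually_elim
    case (elim y)
    then have gy: "integrable u01 (\<lambda>t. g (vupd i y t))" by auto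
    note Gy = Gline[OF gy]
    have cy: "c (vupd i y t) = c y" for t by (simp add: c_def)
    let ?w = "\<lambda>t. G (vupd i y t) + c y"
    have "ac_pair ?w (\<lambda>s. g (vupd i y s))"
      using Gy(1) unfolding ac_pair_def by (metis add.commute add.left_commute)
    moreover have "G (vupd i y 1) - G (vupd i y 0) = F y"
      using ac_pair_integral[OF Gy(1)] integral_uni_eq[OF gy] by (simp add: F_def)
    then have "?w 0 = ?w 1" using elim(3) by simp
    moreover have "AE t in u01. u (vupd i y t) = ?w t"
      using elim(2) by eventually_elim (simp add: cy algebra_simps)
    ultimately show ?case by blast
  qed
qed


section \<open>From coordinate lines to the one-body density\<close>

lemma L2c_borel_version:
  fixes u :: "real^'n::finite \<Rightarrow> complex"
  assumes "L2c u"
  obtains u' where "u' \<in> borel_measurable borel" "AE x in ucube. u x = u' x" "integrable ucube (\<lambda>x. (cmod (u' x))\<^sup>2)"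
proof -
  obtain u' where u': "u' \<in> borel_measurable borel" "AE x in ucube. u x = u' x"
    using assms measurable_on_borel_version[of u cube] by (auto simp: L2c_def)
  have "(\<lambda>x. (cmod (u x))\<^sup>2) absolutely_integrable_on cube"
    using assms by (simp add: L2c_def absolutely_integrable_on_iff_nonneg)
  moreover have "AE x in ucube. (cmod (u x))\<^sup>2 = (cmod (u' x))\<^sup>2" using u'(2) by eventually_elim simp
  ultimately have "(\<lambda>x. (cmod (u' x))\<^sup>2) absolutely_integrable_on cube"
    by (rule absolutely_integrable_cong_AE_uni) simp
  moreover have "(\<lambda>x. (cmod (u' x))\<^sup>2) \<in> borel_measurable borel" using u'(1) by measurable
  ultimately have "integrable ucube (\<lambda>x. (cmod (u' x))\<^sup>2)" by (subst integrable_uni_iff) auto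
  then show ?thesis using u' by (intro that)
qed

lemma integrable_if_square_integrable:
  fixes u :: "real^'n::finite \<Rightarrow> complex"
  assumes [measurable]: "u \<in> borel_measurable borel" and "integrable ucube (\<lambda>x. (cmod (u x))\<^sup>2)"
  shows "integrable ucube u"
proof (rule Bochner_Integration.integrable_bound[where f = "\<lambda>x. 1 + (cmod (u x))\<^sup>2"])
  have "s \<le> 1 + s\<^sup>2" for s :: real
    using sum_squares_bound[of s 1] zero_le_power2[of s] by (smt (verit) mult_1_right one_power2)
  then show "AE x in ucube. norm (u x) \<le> norm (1 + (cmod (u x))\<^sup>2)" by simp
qed (use assms in auto)

lemma weak_pderiv_cong_AE:
  fixes u g :: "real^'n::finite \<Rightarrow> complex"
  assumes "weak_pderiv i u g" "AE x in ucube. u x = v x" "AE x in ucube. g x = h x"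
  shows "weak_pderiv i v h"
  unfolding weak_pderiv_def
proof (intro allI impI)
  fix \<phi> :: "real^'n \<Rightarrow> real" and d assume t: "testN \<phi> d"
  have "integral cube (\<lambda>x. of_real (d i x) * v x) = integral cube (\<lambda>x. of_real (d i x) * u x)"
    by (rule integral_cong_AE_uni) (use assms(2) in \<open>auto elim!: eventually_mono\<close>)
  also have "\<dots> = - integral cube (\<lambda>x. of_real (\<phi> x) * g x)" using assms(1) t unfolding weak_pderiv_def by blast
  also have "integral cube (\<lambda>x. of_real (\<phi> x) * g x) = integral cube (\<lambda>x. of_real (\<phi> x) * h x)"
    by (rule integral_cong_AE_uni) (use assms(3) in \<open>auto elim!: eventually_mono\<close>)
  finally show "integral cube (\<lambda>x. of_real (d i x) * v x) = - integral cube (\<lambda>x. of_real (\<phi> x) * h x)" .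
qed

lemma ac_pair_norm_square:
  fixes w g :: "real \<Rightarrow> complex"
  assumes "ac_pair w g"
  shows "ac_pair (\<lambda>t. (cmod (w t))\<^sup>2) (\<lambda>t. 2 * Re (cnj (w t) * g t))"
proof -
  have "ac_pair (\<lambda>t. Re (w t * cnj (w t))) (\<lambda>t. Re (g t * cnj (w t) + w t * cnj (g t)))"
    by (rule ac_pair_bounded_linear[OF ac_pair_mult[OF assms ac_pair_bounded_linear[OF assms bounded_linear_cnj]] bounded_linear_Re])
  moreover have "Re (w t * cnj (w t)) = (cmod (w t))\<^sup>2" for t by (simp add: complex_norm_square[symmetric])
  moreover have "Re (g t * cnj (w t) + w t * cnj (g t)) = 2 * Re (cnj (w t) * g t)" for t by simp
  ultimately show ?thesis by (simp only:)
qed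

text \<open>A bootstrap. The candidate derivative \<open>q\<close>, the integral of
  \<open>2 * Re (cnj u * g)\<close>, is at first only integrable; this already gives the line
  density \<open>p\<close> a continuous, hence bounded, version. Cauchy-Schwarz then bounds
  \<open>(q t)\<^sup>2\<close> by four times \<open>p t\<close> times the line integral of the
  squared norm of \<open>g\<close>, which is integrable.\<close>

lemma line_density_ac_pair:
  fixes u g :: "real^'n::finite \<Rightarrow> complex"
  assumes m[measurable]: "u \<in> borel_measurable borel" "g \<in> borel_measurable borel"
    and u2: "integrable ucube (\<lambda>x. (cmod (u x))\<^sup>2)" and g2: "integrable ucube (\<lambda>x. (cmod (g x))\<^sup>2)"
    and w: "weak_pderiv i u g"
  obtains r q where "L2b q" "ac_pair r q" "r 0 = r 1"
    "AE t in u01. (\<integral>y. (cmod (u (vupd i y t)))\<^sup>2 \<partial>ucube) = r t"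
proof -
  define p where "p t = (\<integral>y. (cmod (u (vupd i y t)))\<^sup>2 \<partial>ucube)" for t
  define k where "k t = (\<integral>y. (cmod (g (vupd i y t)))\<^sup>2 \<partial>ucube)" for t
  let ?ug = "\<lambda>x. 2 * Re (cnj (u x) * g x)"
  define q where "q t = (\<integral>y. ?ug (vupd i y t) \<partial>ucube)" for t
  have ugb: "\<bar>?ug x\<bar> \<le> 2 * (cmod (u x) * cmod (g x))" for x
    using abs_Re_le_cmod[of "cnj (u x) * g x"] by (simp add: norm_mult del: times_complex.simps)
  have ug: "integrable ucube ?ug"
  proof (rule Bochner_Integration.integrable_bound[where f = "\<lambda>x. (cmod (u x))\<^sup>2 + (cmod (g x))\<^sup>2"])
    have "\<bar>?ug x\<bar> \<le> (cmod (u x))\<^sup>2 + (cmod (g x))\<^sup>2" for x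
      using ugb[of x] sum_squares_bound[of "cmod (u x)" "cmod (g x)"] by linarith
    then show "AE x in ucube. norm (?ug x) \<le> norm ((cmod (u x))\<^sup>2 + (cmod (g x))\<^sup>2)"
      by (simp del: times_complex.simps)
  qed (use u2 g2 in \<open>simp_all\<close>)
  have pi: "integrable u01 p" unfolding p_def by (rule integral_vupd(6)[OF u2])
  have qi: "integrable u01 q" unfolding q_def by (rule integral_vupd(6)[OF ug])
  have ki: "integrable u01 k" unfolding k_def by (rule integral_vupd(6)[OF g2])
  have ac: "AE y in ucube. \<exists>w. ac_pair w (\<lambda>s. g (vupd i y s)) \<and> w 0 = w 1 \<and> (AE t in u01. u (vupd i y t) = w t)"
    by (rule weak_pderiv_ac_on_lines[OF integrable_if_square_integrable[OF m(1) u2] integrable_if_square_integrable[OF m(2) g2] w])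
  have "weak_deriv1 p q"
    unfolding weak_deriv1_def
  proof (intro allI impI)
    fix \<phi> d assume t: "test1 \<phi> d"
    obtain B where B: "\<And>x. \<bar>\<phi> x\<bar> \<le> B" using test1_bounded[OF t] by blast
    \<comment> \<open>Periodicity of \<open>d\<close> follows from that of \<open>\<phi>\<close> by
      uniqueness of derivatives, and it makes \<open>d\<close> bounded.\<close>
    have dper: "d (x + 1) = d x" for x
    proof -
      have "(\<phi> has_real_derivative d (x + 1)) (at (x + 1))" using t by (simp add: test1_def)
      then have "((\<lambda>x. \<phi> (x + 1)) has_real_derivative d (x + 1)) (at x)" by (simp add: DERIV_shift)
      then have "(\<phi> has_real_derivative d (x + 1)) (at x)" using t by (simp add: test1_def)
      moreover have "(\<phi> has_real_derivative d x) (at x)" using t by (simp add: test1_def)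
      ultimately show ?thesis by (rule DERIV_unique)
    qed
    have "continuous_on UNIV d" using t by (simp add: test1_def)
    then obtain D where D: "\<And>x. \<bar>d x\<bar> \<le> D" using periodic_continuous_bounded[of d] dper by metis
    have dm[measurable]: "d \<in> borel_measurable borel" and \<phi>m[measurable]: "\<phi> \<in> borel_measurable borel"
      using test1_measurable[OF t] by auto
    have swap: "(\<integral>t. h t * (\<integral>y. f (vupd i y t) \<partial>ucube) \<partial>u01) = (\<integral>y. \<integral>t. h t * f (vupd i y t) \<partial>u01 \<partial>ucube)"
      "AE y in ucube. integrable u01 (\<lambda>t. h t * f (vupd i y t))"
      "integrable u01 (\<lambda>t. h t * (\<integral>y. f (vupd i y t) \<partial>ucube))"
      if f: "integrable ucube f" and h: "h \<in> borel_measurable borel" "\<And>x. \<bar>h x\<bar> \<le> C" for f :: "real^'n \<Rightarrow> real" and h C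
    proof -
      have "integrable ucube (\<lambda>x. h (x $ i) *\<^sub>R f x)"
        by (rule integrable_bounded_mult[OF f _ h(2)]) (use h(1) in measurable)
      then have I: "integrable ucube (\<lambda>x. h (x $ i) * f x)" by simp
      show "(\<integral>t. h t * (\<integral>y. f (vupd i y t) \<partial>ucube) \<partial>u01) = (\<integral>y. \<integral>t. h t * f (vupd i y t) \<partial>u01 \<partial>ucube)"
        using integral_vupd(2)[OF I, of i] integral_vupd(3)[OF I, of i] by simp
      show "AE y in ucube. integrable u01 (\<lambda>t. h t * f (vupd i y t))"
        using integral_vupd(5)[OF I, of i] by simp
      show "integrable u01 (\<lambda>t. h t * (\<integral>y. f (vupd i y t) \<partial>ucube))"
        using integral_vupd(6)[OF I, of i] by simp
    qed
    note s1 = swap[OF u2 dm D] and s2 = swap[OF ug \<phi>m B]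
    have "integral {0..1} (\<lambda>x. p x * d x) = (\<integral>t. d t * p t \<partial>u01)"
      using integral_uni_eq[OF s1(3)] unfolding p_def by (simp add: mult.commute)
    also have "\<dots> = (\<integral>y. \<integral>t. d t * (cmod (u (vupd i y t)))\<^sup>2 \<partial>u01 \<partial>ucube)"
      unfolding p_def by (rule s1(1))
    \<comment> \<open>Integration by parts on almost every line, where \<open>u\<close> coincides
      with an absolutely continuous periodic function.\<close>
    also have "\<dots> = (\<integral>y. - (\<integral>t. \<phi> t * ?ug (vupd i y t) \<partial>u01) \<partial>ucube)"
    proof (rule integral_cong_AE)
      show "AE y in ucube. (\<integral>t. d t * (cmod (u (vupd i y t)))\<^sup>2 \<partial>u01) = - (\<integral>t. \<phi> t * ?ug (vupd i y t) \<partial>u01)"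
        using ac s1(2) s2(2)
      proof eventually_elim
        case (elim y)
        then obtain w where w: "ac_pair w (\<lambda>s. g (vupd i y s))" "w 0 = w 1" "AE t in u01. u (vupd i y t) = w t" by blast
        have "\<phi> (0 + 1) = \<phi> 0" using t unfolding test1_def by blast
        then have parts: "integral {0..1} (\<lambda>t. (cmod (w t))\<^sup>2 * d t) = - integral {0..1} (\<lambda>t. (2 * Re (cnj (w t) * g (vupd i y t))) * \<phi> t)"
          using w(2) by (intro ac_pair_by_parts[OF ac_pair_norm_square[OF w(1)] test1_ac_pair[OF t]]) simp
        have "(\<integral>t. d t * (cmod (u (vupd i y t)))\<^sup>2 \<partial>u01) = integral {0..1} (\<lambda>t. d t * (cmod (u (vupd i y t)))\<^sup>2)"
          by (rule integral_uni_eq[OF elim(2)]) simp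
        also have "\<dots> = integral {0..1} (\<lambda>t. (cmod (w t))\<^sup>2 * d t)"
          by (rule integral_cong_AE_uni) (use w(3) in \<open>auto elim!: eventually_mono\<close>)
        also note parts
        also have "integral {0..1} (\<lambda>t. (2 * Re (cnj (w t) * g (vupd i y t))) * \<phi> t) = integral {0..1} (\<lambda>t. \<phi> t * ?ug (vupd i y t))"
          by (rule integral_cong_AE_uni) (use w(3) in \<open>auto elim!: eventually_mono\<close>)
        also have "\<dots> = (\<integral>t. \<phi> t * ?ug (vupd i y t) \<partial>u01)"
          by (rule integral_uni_eq[OF elim(3), symmetric]) simp
        finally show ?case .
      qed
      have "(\<lambda>y. \<integral>t. d t * (cmod (u (vupd i y t)))\<^sup>2 \<partial>u01) \<in> borel_measurable borel"
        by (rule borel_measurable_integral_u01) measurable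
      then show "(\<lambda>y. \<integral>t. d t * (cmod (u (vupd i y t)))\<^sup>2 \<partial>u01) \<in> borel_measurable ucube"
        by (simp cong: measurable_cong_sets)
      have [measurable]: "cnj \<in> borel_measurable borel" by (intro borel_measurable_continuous_onI continuous_intros)
      have "(\<lambda>y. \<integral>t. \<phi> t * ?ug (vupd i y t) \<partial>u01) \<in> borel_measurable borel"
        by (rule borel_measurable_integral_u01) measurable
      then show "(\<lambda>y. - (\<integral>t. \<phi> t * ?ug (vupd i y t) \<partial>u01)) \<in> borel_measurable ucube"
        by (intro borel_measurable_uminus) (simp del: times_complex.simps cong: measurable_cong_sets)
    qed
    also have "\<dots> = - (\<integral>t. \<phi> t * q t \<partial>u01)"
      unfolding q_def s2(1) by simp
    also have "(\<integral>t. \<phi> t * q t \<partial>u01) = integral {0..1} (\<lambda>x. q x * \<phi> x)"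
      using integral_uni_eq[OF s2(3)] unfolding q_def by (simp add: mult.commute)
    finally show "integral {0..1} (\<lambda>x. p x * d x) = - integral {0..1} (\<lambda>x. q x * \<phi> x)" .
  qed
  from weak_deriv1_ac_pair[OF integrable_uniD[OF pi] integrable_uniD[OF qi] this]
  obtain r where r: "ac_pair r q" "r 0 = r 1" "AE x in u01. p x = r x" by auto
  have "bounded (r ` {0..1})"
    by (intro compact_imp_bounded compact_continuous_image ac_pair_continuous[OF r(1)]) auto
  then obtain M where "\<forall>y\<in>r ` {0..1}. norm y \<le> M" unfolding bounded_iff by blast
  then have M: "\<bar>r t\<bar> \<le> M" if "t \<in> {0..1}" for t using that by simp
  have qm[measurable]: "q \<in> borel_measurable borel"
    using qi by (simp add: borel_measurable_integrable cong: measurable_cong_sets)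
  have "integrable u01 (\<lambda>t. (q t)\<^sup>2)"
  proof (rule Bochner_Integration.integrable_bound[where f = "\<lambda>t. (4 * M) * k t"])
    have "AE t in u01. integrable ucube (\<lambda>y. (cmod (u (vupd i y t)))\<^sup>2)" by (rule integral_vupd(4)[OF u2])
    moreover have "AE t in u01. integrable ucube (\<lambda>y. (cmod (g (vupd i y t)))\<^sup>2)" by (rule integral_vupd(4)[OF g2])
    moreover have "AE t in u01. integrable ucube (\<lambda>y. ?ug (vupd i y t))" by (rule integral_vupd(4)[OF ug])
    ultimately show "AE t in u01. norm ((q t)\<^sup>2) \<le> norm ((4 * M) * k t)"
      using r(3) AE_u01
    proof eventually_elim
      case (elim t)
      let ?U = "\<lambda>y. cmod (u (vupd i y t))" and ?V = "\<lambda>y. cmod (g (vupd i y t))"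
      have UV: "?U \<in> borel_measurable (ucube :: (real^'n) measure)" "?V \<in> borel_measurable (ucube :: (real^'n) measure)" by measurable
      have "\<bar>q t\<bar> \<le> (\<integral>y. \<bar>?ug (vupd i y t)\<bar> \<partial>ucube)"
        unfolding q_def by (rule integral_abs_bound)
      also have "\<dots> \<le> (\<integral>y. 2 * (?U y * ?V y) \<partial>ucube)"
        using elim(3) ugb integrable_mult_L2[OF UV elim(1,2)] by (intro integral_mono) auto
      also have "\<dots> = 2 * (\<integral>y. ?U y * ?V y \<partial>ucube)" by simp
      finally have "\<bar>q t\<bar>\<^sup>2 \<le> (2 * (\<integral>y. ?U y * ?V y \<partial>ucube))\<^sup>2" by (rule power_mono) simp
      also have "\<dots> = 4 * (\<integral>y. ?U y * ?V y \<partial>ucube)\<^sup>2" by (simp add: power2_eq_square)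
      also have "\<dots> \<le> 4 * (p t * k t)"
        using Cauchy_Schwarz_integral[OF UV elim(1,2)] unfolding p_def k_def by simp
      also have "\<dots> \<le> 4 * (M * k t)"
        using M[of t] elim(4,5) by (intro mult_left_mono mult_right_mono) (auto simp: k_def)
      finally show ?case by simp
    qed
  qed (use ki in auto)
  then have "L2b q" by (simp add: L2b_def)
  then show ?thesis using r by (intro that[of q r]) (auto simp: p_def)
qed

lemma ac_pair_sum:
  fixes r :: "'i \<Rightarrow> real \<Rightarrow> real"
  assumes "finite I" "\<And>i. i \<in> I \<Longrightarrow> ac_pair (r i) (q i)" "\<And>i. i \<in> I \<Longrightarrow> L2b (q i)"
  shows "ac_pair (\<lambda>t. \<Sum>i\<in>I. r i t) (\<lambda>t. \<Sum>i\<in>I. q i t) \<and> L2b (\<lambda>t. \<Sum>i\<in>I. q i t)"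
  using assms
proof (induction I rule: finite_induct)
  case empty
  then show ?case using L2b_const[of 0] by (simp add: ac_pair_def)
next
  case (insert i I)
  then have "ac_pair (\<lambda>t. 1 * r i t + 1 * (\<Sum>i\<in>I. r i t)) (\<lambda>t. 1 * q i t + 1 * (\<Sum>i\<in>I. q i t))"
    "L2b (\<lambda>t. 1 * q i t + 1 * (\<Sum>i\<in>I. q i t))"
    by (intro ac_pair_lincomb L2b_lincomb; auto)+
  then show ?case using insert.hyps by simp
qed

text \<open>One summand of \<open>dens\<close>, in terms of the given functions rather than Borel
  versions. The last conjunct is Fubini and will give the density its total mass.\<close>

lemma dens_component:
  fixes u :: "real^'n::finite \<Rightarrow> complex"
  assumes u: "L2c u" and g: "L2c g" and w: "weak_pderiv i u g"
  shows "\<exists>r q. L2b q \<and> ac_pair r q \<and> r 0 = r 1 \<and>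
    (AE t in u01. integral cube (\<lambda>y. (cmod (u (\<chi> k. if k = i then t else y $ k)))\<^sup>2) = r t) \<and>
    integral {0..1} r = integral cube (\<lambda>x. (cmod (u x))\<^sup>2)"
proof -
  obtain u' where u': "u' \<in> borel_measurable borel" "AE x in ucube. u x = u' x" "integrable ucube (\<lambda>x. (cmod (u' x))\<^sup>2)"
    using L2c_borel_version[OF u] .
  obtain g' where g': "g' \<in> borel_measurable borel" "AE x in ucube. g x = g' x" "integrable ucube (\<lambda>x. (cmod (g' x))\<^sup>2)"
    using L2c_borel_version[OF g] .
  have "weak_pderiv i u' g'" by (rule weak_pderiv_cong_AE[OF w u'(2) g'(2)])
  from line_density_ac_pair[OF u'(1) g'(1) u'(3) g'(3) this]
  obtain q r where qr: "L2b q" "ac_pair r q" "r 0 = r 1" "AE t in u01. (\<integral>y. (cmod (u' (vupd i y t)))\<^sup>2 \<partial>ucube) = r t" .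
  have "AE t in u01. integral cube (\<lambda>y. (cmod (u (\<chi> k. if k = i then t else y $ k)))\<^sup>2) = r t"
    using AE_vupd(1)[OF u'(2), of i] integral_vupd(4)[OF u'(3), of i] qr(4)
  proof eventually_elim
    case (elim t)
    have "integral cube (\<lambda>y. (cmod (u (vupd i y t)))\<^sup>2) = integral cube (\<lambda>y. (cmod (u' (vupd i y t)))\<^sup>2)"
      by (rule integral_cong_AE_uni) (use elim(1) in \<open>auto elim!: eventually_mono\<close>)
    also have "\<dots> = (\<integral>y. (cmod (u' (vupd i y t)))\<^sup>2 \<partial>ucube)"
      by (rule integral_uni_eq[OF elim(2), symmetric]) simp
    finally show ?case using elim(3) by (simp add: vupd_def)
  qed
  moreover have "integral {0..1} r = integral cube (\<lambda>x. (cmod (u x))\<^sup>2)"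
  proof -
    have pi: "integrable u01 (\<lambda>t. \<integral>y. (cmod (u' (vupd i y t)))\<^sup>2 \<partial>ucube)" by (rule integral_vupd(6)[OF u'(3)])
    have "integral {0..1} r = integral {0..1} (\<lambda>t. \<integral>y. (cmod (u' (vupd i y t)))\<^sup>2 \<partial>ucube)"
      by (rule integral_cong_AE_uni) (use qr(4) in \<open>auto elim!: eventually_mono\<close>)
    also have "\<dots> = (\<integral>x. (cmod (u' x))\<^sup>2 \<partial>ucube)"
      using integral_uni_eq[OF pi] integral_vupd(2)[OF u'(3), of i] by simp
    also have "\<dots> = integral cube (\<lambda>x. (cmod (u' x))\<^sup>2)" by (rule integral_uni_eq[OF u'(3)]) simp
    also have "\<dots> = integral cube (\<lambda>x. (cmod (u x))\<^sup>2)"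
      by (rule integral_cong_AE_uni) (use u'(2) in \<open>auto elim!: eventually_mono\<close>)
    finally show ?thesis .
  qed
  ultimately show ?thesis using qr by blast
qed

lemma dens_in_Xset:
  fixes \<Psi> :: "'n::finite wf"
  assumes "\<Psi> \<in> Wset"
  shows "dens \<Psi> \<in> Xset CARD('n)"
proof -
  have H: "H1wf \<Psi>" and nrm: "norm2_wf \<Psi> = 1" using assms by (auto simp: Wset_def)
  define Q where "Q p r q \<longleftrightarrow> L2b q \<and> ac_pair r q \<and> r 0 = r 1 \<and>
    (AE t in u01. integral cube (\<lambda>y. (cmod (\<Psi> (\<chi> k. if k = fst p then t else y $ k) (snd p)))\<^sup>2) = r t) \<and>
    integral {0..1} r = integral cube (\<lambda>x. (cmod (\<Psi> x (snd p)))\<^sup>2)" for p :: "'n \<times> ('n \<Rightarrow> bool)" and r q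
  have "\<exists>r q. Q p r q" for p
  proof -
    obtain g where "L2c g" "weak_pderiv (fst p) (\<lambda>x. \<Psi> x (snd p)) g" "L2c (\<lambda>x. \<Psi> x (snd p))"
      using H unfolding H1wf_def by blast
    then show ?thesis unfolding Q_def by (intro dens_component[where u = "\<lambda>x. \<Psi> x (snd p)"])
  qed
  then obtain r q where "\<And>p. Q p (r p) (q p)" by metis
  then have rq: "\<And>p. L2b (q p)" "\<And>p. ac_pair (r p) (q p)" "\<And>p. r p 0 = r p 1"
    "\<And>p. AE t in u01. integral cube (\<lambda>y. (cmod (\<Psi> (\<chi> k. if k = fst p then t else y $ k) (snd p)))\<^sup>2) = r p t"
    "\<And>p. integral {0..1} (r p) = integral cube (\<lambda>x. (cmod (\<Psi> x (snd p)))\<^sup>2)"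
    unfolding Q_def by blast+
  let ?I = "UNIV :: ('n \<times> ('n \<Rightarrow> bool)) set"
  have ac: "ac_pair (\<lambda>t. \<Sum>p\<in>?I. r p t) (\<lambda>t. \<Sum>p\<in>?I. q p t)" and L: "L2b (\<lambda>t. \<Sum>p\<in>?I. q p t)"
    using ac_pair_sum[of ?I r q] rq(1,2) by auto
  have dens: "dens \<Psi> t = (\<Sum>p\<in>?I. integral cube (\<lambda>y. (cmod (\<Psi> (\<chi> k. if k = fst p then t else y $ k) (snd p)))\<^sup>2))" for t
    unfolding dens_def sum.cartesian_product by (simp add: case_prod_beta')
  have "AE t in u01. \<forall>p\<in>?I. integral cube (\<lambda>y. (cmod (\<Psi> (\<chi> k. if k = fst p then t else y $ k) (snd p)))\<^sup>2) = r p t"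
    by (intro AE_finite_allI) (auto simp: rq(4))
  then have ae: "AE t in u01. (\<Sum>p\<in>?I. r p t) = dens \<Psi> t"
    by eventually_elim (simp add: dens)
  have "weak_deriv1 (dens \<Psi>) (\<lambda>t. \<Sum>p\<in>?I. q p t)"
    by (rule weak_deriv1_cong_AE[OF ac_pair_weak_deriv1[OF ac] ae]) (simp_all add: rq(3))
  moreover have "L2r (dens \<Psi>)" by (rule L2r_cong_AE[OF ac_pair_L2r[OF ac] ae])
  ultimately have "H1r (dens \<Psi>)" using L2b_L2r[OF L] by (auto simp: H1r_def)
  moreover have "integral {0..1} (dens \<Psi>) = real CARD('n)"
  proof -
    have "integral {0..1} (dens \<Psi>) = integral {0..1} (\<lambda>t. \<Sum>p\<in>?I. r p t)"
      by (rule integral_cong_AE_uni) (use ae in \<open>auto elim!: eventually_mono\<close>)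
    also have "\<dots> = (\<Sum>p\<in>?I. integral {0..1} (r p))"
      by (intro integral_sum integrable_continuous_interval ac_pair_continuous[OF rq(2)]) simp
    \<comment> \<open>Each particle contributes the squared norm of the whole state, which is
      1.\<close>
    also have "\<dots> = (\<Sum>i\<in>(UNIV :: 'n set). \<Sum>\<sigma>\<in>UNIV. integral cube (\<lambda>x. (cmod (\<Psi> x \<sigma>))\<^sup>2))"
      unfolding sum.cartesian_product by (simp add: rq(5) case_prod_beta')
    also have "\<dots> = real CARD('n)" using nrm by (simp add: norm2_wf_def)
    finally show ?thesis .
  qed
  ultimately show ?thesis by (simp add: Xset_def)
qed


section \<open>Slater determinants with prescribed density\<close>

lemma continuous_integrable_u01:
  fixes h :: "real \<Rightarrow> 'b::euclidean_space"
  assumes "continuous_on UNIV h" shows "integrable u01 h"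
proof (subst integrable_uni_iff)
  show "h absolutely_integrable_on {0..1}"
    by (rule absolutely_integrable_continuous_real[OF continuous_on_subset[OF assms]]) simp
  show "h \<in> borel_measurable borel" by (rule borel_measurable_continuous_onI[OF assms])
qed simp

lemma testN_axis_deriv:
  fixes \<phi> :: "real^'n::finite \<Rightarrow> real"
  assumes "testN \<phi> d"
  shows "((\<lambda>t. \<phi> (vupd k y t)) has_real_derivative d k (vupd k y t)) (at t)"
proof -
  have eq: "vupd k y t + s *\<^sub>R axis k 1 = vupd k y (t + s)" for s by (auto simp: vec_eq_iff axis_def)
  have "((\<lambda>s. \<phi> (vupd k y t + s *\<^sub>R axis k 1)) has_real_derivative d k (vupd k y t)) (at 0)"
    using assms by (simp add: testN_def)
  then have "((\<lambda>s. \<phi> (vupd k y (s + t))) has_real_derivative d k (vupd k y t)) (at 0)"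
    by (simp add: eq add.commute)
  then show ?thesis using DERIV_shift[of "\<lambda>t. \<phi> (vupd k y t)" _ 0 t] by simp
qed

text \<open>\<open>testN\<close> gives continuous partial derivatives, and continuity of
  \<open>\<phi>\<close> itself has to be deduced: coordinates are changed one at a time inside a
  box, and the mean value inequality bounds each change.\<close>

lemma testN_continuous:
  fixes \<phi> :: "real^'n::finite \<Rightarrow> real"
  assumes t: "testN \<phi> d"
  shows "continuous_on UNIV \<phi>"
proof -
  have "isCont \<phi> x0" for x0
  proof -
    \<comment> \<open>The extra 1 puts the unit ball around \<open>x0\<close> into \<open>Q\<close>.
      A box is used because overwriting a coordinate of one of its points by that of another stays
      inside.\<close>
    define K where "K = norm x0 + 1"
    define Q where "Q = {x :: real^'n. \<forall>k. \<bar>x $ k\<bar> \<le> K}"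
    have Qc: "Q = cbox (\<chi> k. - K) (\<chi> k. K)" 
      by (simp add: Q_def mem_box_cart set_eq_iff abs_le_iff minus_le_iff) blast
    have "\<exists>L. \<forall>x\<in>Q. \<bar>d k x\<bar> \<le> L" for k
    proof -
      have "continuous_on UNIV (d k)" using t by (simp add: testN_def)
      then have "bounded (d k ` Q)"
        unfolding Qc by (intro compact_imp_bounded compact_continuous_image) (auto intro: continuous_on_subset)
      then show ?thesis by (auto simp: bounded_iff)
    qed
    then obtain L where L: "\<And>k x. x \<in> Q \<Longrightarrow> \<bar>d k x\<bar> \<le> L k" by metis
    have lip: "\<forall>x\<in>Q. \<forall>y\<in>Q. (\<forall>k. k \<notin> S \<longrightarrow> x $ k = y $ k) \<longrightarrow> \<bar>\<phi> x - \<phi> y\<bar> \<le> (\<Sum>k\<in>S. L k * \<bar>x $ k - y $ k\<bar>)"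
      if "finite S" for S
      using that
    proof (induction S)
      case empty
      then show ?case by (auto simp: vec_eq_iff[symmetric])
    next
      case (insert k S)
      show ?case
      proof (intro ballI impI)
        fix x y assume xQ: "x \<in> Q" and yQ: "y \<in> Q" and off: "\<forall>j. j \<notin> insert k S \<longrightarrow> x $ j = y $ j"
        let ?z = "vupd k x (y $ k)"
        have zQ: "?z \<in> Q" using xQ yQ by (auto simp: Q_def)
        have "\<bar>\<phi> ?z - \<phi> y\<bar> \<le> (\<Sum>j\<in>S. L j * \<bar>?z $ j - y $ j\<bar>)"
          using insert.IH zQ yQ off by auto
        also have "\<dots> = (\<Sum>j\<in>S. L j * \<bar>x $ j - y $ j\<bar>)"
          using insert.hyps by (intro sum.cong) auto
        finally have 1: "\<bar>\<phi> ?z - \<phi> y\<bar> \<le> (\<Sum>j\<in>S. L j * \<bar>x $ j - y $ j\<bar>)" .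
        have "norm (\<phi> (vupd k x (x $ k)) - \<phi> (vupd k x (y $ k))) \<le> L k * norm (x $ k - y $ k)"
        proof (rule field_differentiable_bound[where S = "{-K..K}" and f' = "\<lambda>t. d k (vupd k x t)"])
          fix s assume s: "s \<in> {-K..K}"
          show "((\<lambda>s. \<phi> (vupd k x s)) has_field_derivative d k (vupd k x s)) (at s within {-K..K})"
            by (rule has_field_derivative_at_within[OF testN_axis_deriv[OF t]])
          have "vupd k x s \<in> Q" using s xQ by (auto simp: Q_def abs_le_iff)
          then show "norm (d k (vupd k x s)) \<le> L k" using L by simp
        qed (use xQ yQ in \<open>auto simp: Q_def abs_le_iff minus_le_iff\<close>)
        then have 2: "\<bar>\<phi> x - \<phi> ?z\<bar> \<le> L k * \<bar>x $ k - y $ k\<bar>" by simp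
        show "\<bar>\<phi> x - \<phi> y\<bar> \<le> (\<Sum>j\<in>insert k S. L j * \<bar>x $ j - y $ j\<bar>)"
          using 1 2 insert.hyps by simp
      qed
    qed
    have x0Q: "x0 \<in> Q" unfolding Q_def K_def using component_le_norm_cart[of x0] by (auto intro: add_increasing2)
    have ev: "\<forall>\<^sub>F y in at x0. norm (\<phi> y - \<phi> x0) \<le> (\<Sum>k\<in>UNIV. L k * \<bar>y $ k - x0 $ k\<bar>)"
    proof -
      have "\<forall>\<^sub>F y in at x0. dist y x0 < 1" 
        by (rule eventually_mono[OF eventually_at_ball[of 1 x0 UNIV]]) (auto simp: dist_commute)
      then show ?thesis
      proof eventually_elim
        case (elim y)
        have "norm y \<le> K" using elim norm_triangle_ineq2[of y x0] by (simp add: K_def dist_norm)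
        then have "y \<in> Q" unfolding Q_def using order_trans[OF component_le_norm_cart[of y]] by blast
        then show ?case using lip[of UNIV] x0Q by auto
      qed
    qed
    have lim: "((\<lambda>y. \<Sum>k\<in>UNIV. L k * \<bar>y $ k - x0 $ k\<bar>) \<longlongrightarrow> (\<Sum>k\<in>UNIV. L k * \<bar>x0 $ k - x0 $ k\<bar>)) (at x0)"
      by (intro tendsto_intros)
    have "((\<lambda>y. \<phi> y - \<phi> x0) \<longlongrightarrow> 0) (at x0)"
      by (rule Lim_null_comparison[OF ev]) (use lim in simp)
    then show ?thesis by (simp add: isCont_def LIM_zero_iff)
  qed
  then show ?thesis by (simp add: continuous_on_eq_continuous_at)
qed

lemma continuous_bounded_AE_ucube:
  fixes h :: "real^'n::finite \<Rightarrow> 'b::real_normed_vector"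
  assumes "continuous_on UNIV h"
  obtains B where "AE x in ucube. norm (h x) \<le> B"
proof -
  have "bounded (h ` cube)"
    unfolding cube_def using assms
    by (intro compact_imp_bounded compact_continuous_image) (auto intro: continuous_on_subset)
  then obtain B where B: "\<forall>y\<in>h ` cube. norm y \<le> B" unfolding bounded_iff by blast
  have "AE x in (ucube :: (real^'n) measure). x \<in> cube" by (simp add: AE_uni_iff)
  then have "AE x in ucube. norm (h x) \<le> B" by eventually_elim (use B in auto)
  then show ?thesis by (rule that)
qed

lemma integrable_continuous_mult_ucube:
  fixes h :: "real^'n::finite \<Rightarrow> real" and f :: "real^'n \<Rightarrow> complex"
  assumes h: "continuous_on UNIV h" and f: "integrable ucube f"
  shows "integrable ucube (\<lambda>x. h x *\<^sub>R f x)"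
proof -
  obtain B where B: "AE x in ucube. norm (h x) \<le> B" using continuous_bounded_AE_ucube[OF h] .
  have "h \<in> borel_measurable borel" by (rule borel_measurable_continuous_onI[OF h])
  then have [measurable]: "h \<in> borel_measurable ucube" by (simp cong: measurable_cong_sets)
  show ?thesis
  proof (rule Bochner_Integration.integrable_bound[where f = "\<lambda>x. B *\<^sub>R f x"])
    show "AE x in ucube. norm (h x *\<^sub>R f x) \<le> norm (B *\<^sub>R f x)"
      using B by eventually_elim (auto intro!: mult_right_mono order_trans[OF _ abs_ge_self])
  qed (use f in auto)
qed

text \<open>Parts are integrated on lines in direction \<open>i\<close>, where all factors but one
  are constant. The test function need not be a product: restricted to such a line it is C1 and
  periodic, which is all that the one-dimensional rule asks for.\<close>

lemma prod_weak_pderiv: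
  fixes f f' :: "'n::finite \<Rightarrow> real \<Rightarrow> complex"
  assumes c: "\<And>k. continuous_on UNIV (f k)" and ac: "\<And>k. ac_pair (f k) (f' k)" and per: "\<And>k. f k 0 = f k 1"
    and f'i: "\<And>k. integrable u01 (f' k)" and t: "testN \<phi> d"
  shows "integrable ucube (\<lambda>x. d i x *\<^sub>R (\<Prod>k\<in>UNIV. f k (x $ k)))" (is ?A)
    and "integrable ucube (\<lambda>x. \<phi> x *\<^sub>R (f' i (x $ i) * (\<Prod>k\<in>UNIV - {i}. f k (x $ k))))" (is ?B)
    and "(\<integral>x. d i x *\<^sub>R (\<Prod>k\<in>UNIV. f k (x $ k)) \<partial>ucube)
      = - (\<integral>x. \<phi> x *\<^sub>R (f' i (x $ i) * (\<Prod>k\<in>UNIV - {i}. f k (x $ k))) \<partial>ucube)"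
proof -
  define P where "P x = (\<Prod>k\<in>UNIV - {i}. f k (x $ k))" for x
  have Pv: "P (vupd i y s) = P y" for y s unfolding P_def by (rule prod.cong) auto
  have split: "(\<Prod>k\<in>UNIV. h k (x $ k)) = h i (x $ i) * (\<Prod>k\<in>UNIV - {i}. h k (x $ k))" for h :: "'n \<Rightarrow> real \<Rightarrow> complex" and x
    by (rule prod.remove) auto
  have "integrable ucube (\<lambda>x. \<Prod>k\<in>UNIV. (f(i := f' i)) k (x $ k))"
    by (rule integral_prod_ucube(1)) (use f'i continuous_integrable_u01[OF c] in auto)
  moreover have "(\<Prod>k\<in>UNIV. (f(i := f' i)) k (x $ k)) = f' i (x $ i) * P x" for x
  proof -
    have "(\<Prod>k\<in>UNIV - {i}. (f(i := f' i)) k (x $ k)) = P x" unfolding P_def by (rule prod.cong) auto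
    then show ?thesis unfolding split by simp
  qed
  ultimately have I2: "integrable ucube (\<lambda>x. f' i (x $ i) * P x)" by simp
  have I1: "integrable ucube (\<lambda>x. f i (x $ i) * P x)"
    using integral_prod_ucube(1)[of UNIV f] continuous_integrable_u01[OF c] unfolding split P_def by simp
  have dc: "continuous_on UNIV (d i)" using t by (simp add: testN_def)
  have A: "integrable ucube (\<lambda>x. d i x *\<^sub>R (f i (x $ i) * P x))" by (rule integrable_continuous_mult_ucube[OF dc I1])
  then show ?A unfolding split P_def .
  have B: "integrable ucube (\<lambda>x. \<phi> x *\<^sub>R (f' i (x $ i) * P x))"
    by (rule integrable_continuous_mult_ucube[OF testN_continuous[OF t] I2])
  then show ?B unfolding P_def .
  have vc: "continuous_on UNIV (\<lambda>s. vupd i y s)" for y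
    unfolding vupd_def
  proof (rule continuous_on_vec_lambda)
    fix k show "continuous_on UNIV (\<lambda>s. if k = i then s else y $ k)"
      by (cases "k = i") (simp_all add: continuous_on_id)
  qed
  have inner: "(\<integral>s. d i (vupd i y s) *\<^sub>R f i s \<partial>u01) = - (\<integral>s. \<phi> (vupd i y s) *\<^sub>R f' i s \<partial>u01)" for y
  proof -
    have dvc: "continuous_on UNIV (\<lambda>s. d i (vupd i y s))" by (rule continuous_on_compose2[OF dc vc]) simp
    have pvc: "continuous_on UNIV (\<lambda>s. \<phi> (vupd i y s))" by (rule continuous_on_compose2[OF testN_continuous[OF t] vc]) simp
    have "ac_pair (\<lambda>s. \<phi> (vupd i y s)) (\<lambda>s. d i (vupd i y s))"
    proof (rule ac_pair_C1)
      show "continuous_on {0..1} (\<lambda>s. d i (vupd i y s))" by (rule continuous_on_subset[OF dvc]) simp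
      show "((\<lambda>s. \<phi> (vupd i y s)) has_vector_derivative d i (vupd i y s)) (at s within {0..1})" for s
        by (rule has_vector_derivative_at_within)
           (rule has_real_derivative_iff_has_vector_derivative[THEN iffD1, OF testN_axis_deriv[OF t]])
    qed
    then have acp: "ac_pair (\<lambda>s. complex_of_real (\<phi> (vupd i y s))) (\<lambda>s. complex_of_real (d i (vupd i y s)))"
      by (rule ac_pair_bounded_linear[OF _ bounded_linear_of_real])
    have "vupd i y 1 = vupd i y 0 + axis i 1" by (auto simp: vec_eq_iff axis_def)
    then have "\<phi> (vupd i y 1) = \<phi> (vupd i y 0)" using t by (simp add: testN_def)
    then have e: "integral {0..1} (\<lambda>s. f i s * complex_of_real (d i (vupd i y s))) = - integral {0..1} (\<lambda>s. f' i s * complex_of_real (\<phi> (vupd i y s)))"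
      using per[of i] by (intro ac_pair_by_parts[OF ac acp]) simp
    have i1: "integrable u01 (\<lambda>s. f i s * complex_of_real (d i (vupd i y s)))"
      by (intro continuous_integrable_u01 continuous_intros c dvc)
    have i2: "integrable u01 (\<lambda>s. f' i s * complex_of_real (\<phi> (vupd i y s)))"
    proof (subst integrable_uni_iff)
      have "(\<lambda>s. complex_of_real (\<phi> (vupd i y s)) * f' i s) absolutely_integrable_on {0..1}"
        by (intro absolutely_integrable_continuous_mult continuous_on_subset[OF continuous_on_of_real[OF pvc]] integrable_uniD[OF f'i]) auto
      then show "(\<lambda>s. f' i s * complex_of_real (\<phi> (vupd i y s))) absolutely_integrable_on {0..1}" by (simp add: mult.commute)
      have "f' i \<in> borel_measurable borel" using f'i[of i] by (simp add: borel_measurable_integrable cong: measurable_cong_sets)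
      moreover have "(\<lambda>s. \<phi> (vupd i y s)) \<in> borel_measurable borel" by (rule borel_measurable_continuous_onI[OF pvc])
      ultimately show "(\<lambda>s. f' i s * complex_of_real (\<phi> (vupd i y s))) \<in> borel_measurable borel" by measurable
    qed simp
    show ?thesis
      using e integral_uni_eq[OF i1] integral_uni_eq[OF i2] by (simp add: scaleR_conv_of_real mult.commute)
  qed
  have "(\<integral>x. d i x *\<^sub>R (f i (x $ i) * P x) \<partial>ucube) = (\<integral>y. P y * (\<integral>s. d i (vupd i y s) *\<^sub>R f i s \<partial>u01) \<partial>ucube)"
  proof -
    have "(\<integral>s. d i (vupd i y s) *\<^sub>R (f i (vupd i y s $ i) * P (vupd i y s)) \<partial>u01) = P y * (\<integral>s. d i (vupd i y s) *\<^sub>R f i s \<partial>u01)" for y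
      unfolding Pv integral_mult_right_zero[symmetric] by (rule Bochner_Integration.integral_cong) (auto simp: mult.commute)
    then show ?thesis using integral_vupd(3)[OF A, of i] by simp
  qed
  also have "\<dots> = - (\<integral>y. P y * (\<integral>s. \<phi> (vupd i y s) *\<^sub>R f' i s \<partial>u01) \<partial>ucube)" by (simp add: inner)
  also have "(\<integral>y. P y * (\<integral>s. \<phi> (vupd i y s) *\<^sub>R f' i s \<partial>u01) \<partial>ucube) = (\<integral>x. \<phi> x *\<^sub>R (f' i (x $ i) * P x) \<partial>ucube)"
  proof -
    have "(\<integral>s. \<phi> (vupd i y s) *\<^sub>R (f' i (vupd i y s $ i) * P (vupd i y s)) \<partial>u01) = P y * (\<integral>s. \<phi> (vupd i y s) *\<^sub>R f' i s \<partial>u01)" for y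
      unfolding Pv integral_mult_right_zero[symmetric] by (rule Bochner_Integration.integral_cong) (auto simp: mult.commute)
    then show ?thesis using integral_vupd(3)[OF B, of i] by simp
  qed
  finally show "(\<integral>x. d i x *\<^sub>R (\<Prod>k\<in>UNIV. f k (x $ k)) \<partial>ucube)
      = - (\<integral>x. \<phi> x *\<^sub>R (f' i (x $ i) * (\<Prod>k\<in>UNIV - {i}. f k (x $ k))) \<partial>ucube)"
    unfolding split P_def .
qed

text \<open>\<open>grad\<close> is an arbitrary choice of weak derivatives; uniqueness allows the
  kinetic energy to be computed from an explicit one.\<close>

lemma weak_pderiv_unique:
  fixes g h :: "real^'n::finite \<Rightarrow> complex"
  assumes g: "L2c g" and h: "L2c h" and w: "weak_pderiv i u g" "weak_pderiv i u h"
  shows "AE x in ucube. g x = h x"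
proof -
  obtain g' where g': "g' \<in> borel_measurable borel" "AE x in ucube. g x = g' x" "integrable ucube (\<lambda>x. (cmod (g' x))\<^sup>2)"
    using L2c_borel_version[OF g] .
  obtain h' where h': "h' \<in> borel_measurable borel" "AE x in ucube. h x = h' x" "integrable ucube (\<lambda>x. (cmod (h' x))\<^sup>2)"
    using L2c_borel_version[OF h] .
  have gi: "integrable ucube g'" "integrable ucube h'"
    using integrable_if_square_integrable g' h' by blast+
  have w': "weak_pderiv i u g'" "weak_pderiv i u h'"
    using weak_pderiv_cong_AE[OF w(1) _ g'(2)] weak_pderiv_cong_AE[OF w(2) _ h'(2)] by auto
  have "AE x in ucube. g' x - h' x = 0"
  proof (rule AE_zero_if_product_test_integrals_zero)
    show "integrable ucube (\<lambda>x. g' x - h' x)" using gi by simp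
    fix b :: "'n \<Rightarrow> real \<Rightarrow> real" assume "\<And>k. \<exists>d. test1 (b k) d"
    then obtain d where b: "\<And>k. test1 (b k) (d k)" by metis
    let ?p = "\<lambda>x :: real^'n. \<Prod>k\<in>UNIV. b k (x $ k)"
    note tN = testN_prod[of b d, OF b]
    have I: "integrable ucube (\<lambda>x. ?p x *\<^sub>R g' x)" "integrable ucube (\<lambda>x. ?p x *\<^sub>R h' x)"
      by (intro integrable_continuous_mult_ucube testN_continuous[OF tN] gi)+
    have "integral cube (\<lambda>x. of_real (?p x) * g' x) = integral cube (\<lambda>x. of_real (?p x) * h' x)"
      by (rule neg_equal_iff_equal[THEN iffD1, OF trans[OF
            w'(1)[unfolded weak_pderiv_def, rule_format, OF tN, symmetric]
            w'(2)[unfolded weak_pderiv_def, rule_format, OF tN]]])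
    then have "(\<integral>x. ?p x *\<^sub>R g' x \<partial>ucube) = (\<integral>x. ?p x *\<^sub>R h' x \<partial>ucube)"
      unfolding integral_uni_eq[OF I(1) cube_borel] integral_uni_eq[OF I(2) cube_borel] by (simp add: scaleR_conv_of_real)
    then show "(\<integral>x. ?p x *\<^sub>R (g' x - h' x) \<partial>ucube) = 0"
      using I by (simp add: scaleR_right_diff_distrib)
  qed
  then show ?thesis using g'(2) h'(2) by eventually_elim simp
qed


lemma L2cI:
  fixes u :: "real^'n::finite \<Rightarrow> complex"
  assumes m: "u \<in> borel_measurable borel" and i: "integrable ucube (\<lambda>x. (cmod (u x))\<^sup>2)"
  shows "L2c u"
proof -
  have "(\<lambda>x. (cmod (u x))\<^sup>2) absolutely_integrable_on cube" by (rule integrable_uniD[OF i]) simp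
  moreover have "u measurable_on cube"
    using m by (simp add: measurable_on_iff_borel_measurable measurable_completion measurable_restrict_space1)
  ultimately show ?thesis by (simp add: L2c_def absolutely_integrable_on_def)
qed

text \<open>The unnormalised determinant; the factor \<open>1 / sqrt (fact CARD('n))\<close> enters
  only with the state built from it.\<close>

definition slater :: "('n \<Rightarrow> real \<Rightarrow> complex) \<Rightarrow> real^'n::finite \<Rightarrow> complex" where
  "slater f x = (\<Sum>p | p permutes UNIV. of_int (sign p) * (\<Prod>k\<in>UNIV. f (p k) (x $ k)))"

definition slater_grad :: "('n \<Rightarrow> real \<Rightarrow> complex) \<Rightarrow> ('n \<Rightarrow> real \<Rightarrow> complex) \<Rightarrow> 'n \<Rightarrow> real^'n::finite \<Rightarrow> complex" where
  "slater_grad f f' i x =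
    (\<Sum>p | p permutes UNIV. of_int (sign p) * (f' (p i) (x $ i) * (\<Prod>k\<in>UNIV - {i}. f (p k) (x $ k))))"

text \<open>The exchange of two variables is absorbed by composing the summation index with the
  transposition, which flips the sign of every term.\<close>

lemma slater_antisym:
  fixes x :: "real^'n::finite"
  assumes "i \<noteq> j"
  shows "slater f (\<chi> k. x $ transp i j k) = - slater f x"
proof -
  let ?\<tau> = "transp i j"
  have \<tau>: "?\<tau> = Transposition.transpose i j" by (auto simp: transp_def Transposition.transpose_def)
  have per: "?\<tau> permutes UNIV" unfolding \<tau> by (rule permutes_swap_id) auto
  have inv: "?\<tau> (?\<tau> k) = k" for k by (auto simp: transp_def)
  have bij: "bij ?\<tau>" by (rule permutes_bij[OF per])
  have prod: "(\<Prod>k\<in>UNIV. f ((p \<circ> ?\<tau>) k) (x $ ?\<tau> k)) = (\<Prod>k\<in>UNIV. f (p k) (x $ k))" for p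
    using prod.reindex_bij_betw[OF bij, of "\<lambda>k. f (p k) (x $ k)"] by (simp add: comp_def)
  have sgn: "sign (p \<circ> ?\<tau>) = - sign p" if "p permutes (UNIV :: 'n set)" for p
  proof -
    have "permutation p" "permutation ?\<tau>" using that per by (auto intro: permutes_imp_permutation[of UNIV])
    then have "sign (p \<circ> ?\<tau>) = sign p * sign ?\<tau>" by (rule sign_compose)
    then show ?thesis unfolding \<tau> by (simp add: sign_swap_id assms)
  qed
  have "slater f (\<chi> k. x $ ?\<tau> k) = (\<Sum>p | p permutes UNIV. of_int (sign (p \<circ> ?\<tau>)) * (\<Prod>k\<in>UNIV. f ((p \<circ> ?\<tau>) k) (x $ ?\<tau> k)))"
    unfolding slater_def by (subst sum_permutations_compose_right[OF per]) simp
  also have "\<dots> = (\<Sum>p | p permutes UNIV. - (of_int (sign p) * (\<Prod>k\<in>UNIV. f (p k) (x $ k))))"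
    by (rule sum.cong) (simp_all add: sgn prod[unfolded comp_def])
  finally show ?thesis by (simp add: slater_def sum_negf)
qed

text \<open>Distinct permutations disagree in at least two places. Thus, even with one variable
  frozen, a factor remains in which two different orbitals are integrated against each
  other.\<close>

lemma permutes_eq_if_agree_off_one:
  assumes p: "p permutes UNIV" and q: "q permutes UNIV" and agree: "\<And>k. k \<noteq> i \<Longrightarrow> p k = q k"
  shows "p = q"
proof -
  obtain k where k: "q k = p i" using permutes_surj[OF q] by (metis surjD)
  have "k = i"
  proof (rule ccontr)
    assume "k \<noteq> i"
    then have "p k = p i" using agree k by simp
    then show False using permutes_inj[OF p] \<open>k \<noteq> i\<close> by (simp add: inj_eq)
  qed
  then show ?thesis using k agree by (intro ext) metis
qed

text \<open>The square expands into pairs of permutations. Integrating over all variables but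
  \<open>i\<close> annihilates pairs of distinct permutations by orthogonality and leaves the
  diagonal; the dummy coordinate \<open>y $ i\<close> contributes a factor 1.\<close>

lemma slater_line_density:
  fixes f :: "'n::finite \<Rightarrow> real \<Rightarrow> complex"
  assumes c: "\<And>a. continuous_on UNIV (f a)"
    and orth: "\<And>a b. (\<integral>t. f a t * cnj (f b t) \<partial>u01) = (if a = b then 1 else 0)"
  shows "integrable ucube (\<lambda>y. (cmod (slater f (vupd i y t)))\<^sup>2)"
    and "(\<integral>y. (cmod (slater f (vupd i y t)))\<^sup>2 \<partial>ucube) = (\<Sum>p | p permutes UNIV. (cmod (f (p i) t))\<^sup>2)"
proof -
  let ?P = "{p. p permutes (UNIV :: 'n set)}"
  define h where "h p q k s = f (p k) s * cnj (f (q k) s)" for p q :: "'n \<Rightarrow> 'n" and k s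
  define T where "T p q y = of_int (sign p) * of_int (sign q) * (h p q i t * (\<Prod>k\<in>UNIV - {i}. h p q k (y $ k)))" for p q and y :: "real^'n"
  have hi: "integrable u01 (h p q k)" for p q k
    unfolding h_def by (intro continuous_integrable_u01 continuous_intros c)
  have Ti: "integrable ucube (T p q)" for p q
    unfolding T_def by (intro integrable_mult_right integral_prod_ucube(1) hi)
  have Te: "(\<integral>y. T p q y \<partial>ucube) = (if p = q then complex_of_real ((cmod (f (p i) t))\<^sup>2) else 0)" if pq: "p \<in> ?P" "q \<in> ?P" for p q
  proof -
    have "(\<integral>y. T p q y \<partial>ucube) = of_int (sign p) * of_int (sign q) * (h p q i t * (\<Prod>k\<in>UNIV - {i}. \<integral>s. h p q k s \<partial>u01))"
      unfolding T_def integral_mult_right_zero by (subst integral_prod_ucube(2)[OF hi]) simp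
    also have "\<dots> = of_int (sign p) * of_int (sign q) * (h p q i t * (\<Prod>k\<in>UNIV - {i}. if p k = q k then 1 else 0))"
      by (simp add: h_def orth)
    also have "\<dots> = (if p = q then complex_of_real ((cmod (f (p i) t))\<^sup>2) else 0)"
    proof (cases "p = q")
      case True
      have "of_int (sign p) * of_int (sign p) = (1 :: complex)" by (simp add: sign_def)
      moreover have "h q q i t = complex_of_real ((cmod (f (q i) t))\<^sup>2)"
        unfolding h_def by (rule complex_norm_square[symmetric])
      ultimately show ?thesis using True by (simp del: of_real_power)
    next
      case False
      then obtain k where "k \<noteq> i" "p k \<noteq> q k" using permutes_eq_if_agree_off_one[of p q i] pq by blast
      then have "(\<Prod>k\<in>UNIV - {i}. if p k = q k then 1 else 0 :: complex) = 0" by (intro prod_zero) auto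
      then show ?thesis using False by simp
    qed
    finally show ?thesis .
  qed
  have eq: "complex_of_real ((cmod (slater f (vupd i y t)))\<^sup>2) = (\<Sum>p\<in>?P. \<Sum>q\<in>?P. T p q y)" for y
  proof -
    let ?z = "vupd i y t"
    have pr: "(\<Prod>k\<in>UNIV. f (p k) (?z $ k)) * cnj (\<Prod>k\<in>UNIV. f (q k) (?z $ k)) = h p q i t * (\<Prod>k\<in>UNIV - {i}. h p q k (y $ k))" for p q
    proof -
      have "(\<Prod>k\<in>UNIV. f (p k) (?z $ k)) * cnj (\<Prod>k\<in>UNIV. f (q k) (?z $ k)) = (\<Prod>k\<in>UNIV. h p q k (?z $ k))"
        unfolding h_def prod.distrib cnj_prod ..
      also have "\<dots> = h p q i (?z $ i) * (\<Prod>k\<in>UNIV - {i}. h p q k (?z $ k))" by (rule prod.remove) auto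
      also have "(\<Prod>k\<in>UNIV - {i}. h p q k (?z $ k)) = (\<Prod>k\<in>UNIV - {i}. h p q k (y $ k))" by (rule prod.cong) auto
      finally show ?thesis by simp
    qed
    have "complex_of_real ((cmod (slater f ?z))\<^sup>2) = slater f ?z * cnj (slater f ?z)" by (rule complex_norm_square)
    also have "\<dots> = (\<Sum>p\<in>?P. \<Sum>q\<in>?P. (of_int (sign p) * (\<Prod>k\<in>UNIV. f (p k) (?z $ k))) * cnj (of_int (sign q) * (\<Prod>k\<in>UNIV. f (q k) (?z $ k))))"
      unfolding slater_def cnj_sum sum_product ..
    also have "\<dots> = (\<Sum>p\<in>?P. \<Sum>q\<in>?P. T p q y)"
    proof (intro sum.cong refl)
      fix p q
      have "(of_int (sign p) * (\<Prod>k\<in>UNIV. f (p k) (?z $ k))) * cnj (of_int (sign q) * (\<Prod>k\<in>UNIV. f (q k) (?z $ k)))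
          = of_int (sign p) * of_int (sign q) * ((\<Prod>k\<in>UNIV. f (p k) (?z $ k)) * cnj (\<Prod>k\<in>UNIV. f (q k) (?z $ k)))"
        by (simp only: complex_cnj_mult complex_cnj_of_int mult_ac)
      then show "(of_int (sign p) * (\<Prod>k\<in>UNIV. f (p k) (?z $ k))) * cnj (of_int (sign q) * (\<Prod>k\<in>UNIV. f (q k) (?z $ k))) = T p q y"
        unfolding pr T_def .
    qed
    finally show ?thesis .
  qed
  have I: "integrable ucube (\<lambda>y. complex_of_real ((cmod (slater f (vupd i y t)))\<^sup>2))"
    unfolding eq by (intro Bochner_Integration.integrable_sum Ti)
  from integrable_Re[OF I] show Ir: "integrable ucube (\<lambda>y. (cmod (slater f (vupd i y t)))\<^sup>2)" by simp
  have "complex_of_real (\<integral>y. (cmod (slater f (vupd i y t)))\<^sup>2 \<partial>ucube) = (\<integral>y. (\<Sum>p\<in>?P. \<Sum>q\<in>?P. T p q y) \<partial>ucube)"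
    unfolding eq[symmetric] by (rule integral_complex_of_real[symmetric])
  also have "\<dots> = (\<Sum>p\<in>?P. \<Sum>q\<in>?P. \<integral>y. T p q y \<partial>ucube)"
    by (subst Bochner_Integration.integral_sum; (intro sum.cong refl Bochner_Integration.integral_sum Bochner_Integration.integrable_sum Ti)?)
  also have "\<dots> = (\<Sum>p\<in>?P. \<Sum>q\<in>?P. if p = q then complex_of_real ((cmod (f (p i) t))\<^sup>2) else 0)"
    by (intro sum.cong refl Te) auto
  also have "\<dots> = (\<Sum>p\<in>?P. complex_of_real ((cmod (f (p i) t))\<^sup>2))"
    by (intro sum.cong refl) (simp add: sum.delta)
  also have "\<dots> = complex_of_real (\<Sum>p\<in>?P. (cmod (f (p i) t))\<^sup>2)" by simp
  finally show "(\<integral>y. (cmod (slater f (vupd i y t)))\<^sup>2 \<partial>ucube) = (\<Sum>p\<in>?P. (cmod (f (p i) t))\<^sup>2)"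
    using of_real_eq_iff by blast
qed

lemma slater_continuous:
  fixes f :: "'n::finite \<Rightarrow> real \<Rightarrow> complex"
  assumes c: "\<And>a. continuous_on UNIV (f a)"
  shows "continuous_on UNIV (slater f)"
  unfolding slater_def
  by (intro continuous_intros continuous_on_compose2[OF c]) auto

lemma slater_weak_pderiv:
  fixes f f' :: "'n::finite \<Rightarrow> real \<Rightarrow> complex"
  assumes c: "\<And>k. continuous_on UNIV (f k)" and ac: "\<And>k. ac_pair (f k) (f' k)" and per: "\<And>k. f k 0 = f k 1"
    and f'i: "\<And>k. integrable u01 (f' k)"
  shows "weak_pderiv i (slater f) (slater_grad f f' i)"
  unfolding weak_pderiv_def
proof (intro allI impI)
  fix \<phi> :: "real^'n \<Rightarrow> real" and d assume t: "testN \<phi> d"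
  let ?P = "{p. p permutes (UNIV :: 'n set)}"
  let ?u = "\<lambda>p x. \<Prod>k\<in>UNIV. f (p k) (x $ k)" and ?g = "\<lambda>p x. f' (p i) (x $ i) * (\<Prod>k\<in>UNIV - {i}. f (p k) (x $ k))"
  note pw = prod_weak_pderiv[of "\<lambda>k. f (p k)" "\<lambda>k. f' (p k)" \<phi> d i for p, OF c ac per f'i t]
  have s1: "d i x *\<^sub>R slater f x = (\<Sum>p\<in>?P. of_int (sign p) * (d i x *\<^sub>R ?u p x))" for x
    by (simp add: slater_def scaleR_sum_right)
  have s2: "\<phi> x *\<^sub>R slater_grad f f' i x = (\<Sum>p\<in>?P. of_int (sign p) * (\<phi> x *\<^sub>R ?g p x))" for x
    by (simp add: slater_grad_def scaleR_sum_right)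
  have I1: "integrable ucube (\<lambda>x. d i x *\<^sub>R slater f x)" unfolding s1
    by (intro Bochner_Integration.integrable_sum integrable_mult_right pw(1))
  have I2: "integrable ucube (\<lambda>x. \<phi> x *\<^sub>R slater_grad f f' i x)" unfolding s2
    by (intro Bochner_Integration.integrable_sum integrable_mult_right pw(2))
  have "(\<integral>x. d i x *\<^sub>R slater f x \<partial>ucube) = (\<Sum>p\<in>?P. of_int (sign p) * (\<integral>x. d i x *\<^sub>R ?u p x \<partial>ucube))"
    unfolding s1 by (subst Bochner_Integration.integral_sum) (simp_all only: integrable_mult_right[OF pw(1)] integral_mult_right_zero)
  also have "\<dots> = (\<Sum>p\<in>?P. - (of_int (sign p) * (\<integral>x. \<phi> x *\<^sub>R ?g p x \<partial>ucube)))"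
    unfolding pw(3) by (simp only: mult_minus_right)
  also have "\<dots> = - (\<integral>x. \<phi> x *\<^sub>R slater_grad f f' i x \<partial>ucube)"
    unfolding s2 sum_negf by (subst Bochner_Integration.integral_sum) (simp_all only: integrable_mult_right[OF pw(2)] integral_mult_right_zero)
  finally show "integral cube (\<lambda>x. of_real (d i x) * slater f x) = - integral cube (\<lambda>x. of_real (\<phi> x) * slater_grad f f' i x)"
    unfolding integral_uni_eq[OF I1 cube_borel] integral_uni_eq[OF I2 cube_borel] by (simp only: scaleR_conv_of_real)
qed

text \<open>Cauchy-Schwarz for a sum over permutations: each squared term is a product of one
  squared orbital derivative and squares of normalised orbitals, with integral at most
  \<open>S\<close>. The number of permutations enters twice, once from the inequality and once from
  the sum.\<close>

lemma slater_grad_bound: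
  fixes f f' :: "'n::finite \<Rightarrow> real \<Rightarrow> complex"
  assumes c: "\<And>k. continuous_on UNIV (f k)" and f'm: "\<And>k. f' k \<in> borel_measurable borel"
    and f'2: "\<And>k. integrable u01 (\<lambda>t. (cmod (f' k t))\<^sup>2)" and S: "\<And>k. (\<integral>t. (cmod (f' k t))\<^sup>2 \<partial>u01) \<le> S"
    and n1: "\<And>k. (\<integral>t. (cmod (f k t))\<^sup>2 \<partial>u01) = 1"
  shows "slater_grad f f' i \<in> borel_measurable borel"
    and "integrable ucube (\<lambda>x. (cmod (slater_grad f f' i x))\<^sup>2)"
    and "(\<integral>x. (cmod (slater_grad f f' i x))\<^sup>2 \<partial>ucube) \<le> (fact CARD('n))\<^sup>2 * S"
proof -
  let ?P = "{p. p permutes (UNIV :: 'n set)}"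
  have cardP: "card ?P = fact CARD('n)" by (rule card_permutations) auto
  note [measurable] = f'm
  have [measurable]: "f k \<in> borel_measurable borel" for k by (rule borel_measurable_continuous_onI[OF c])
  show m: "slater_grad f f' i \<in> borel_measurable borel" unfolding slater_grad_def by measurable
  define h where "h p k = (if k = i then (\<lambda>t. (cmod (f' (p i) t))\<^sup>2) else (\<lambda>t. (cmod (f (p k) t))\<^sup>2))" for p k
  have hi: "integrable u01 (h p k)" for p k
    unfolding h_def using f'2 by (auto intro!: continuous_integrable_u01 continuous_intros c)
  have Hi: "integrable ucube (\<lambda>x. \<Prod>k\<in>UNIV. h p k (x $ k))" for p by (rule integral_prod_ucube(1)[OF hi])
  have He: "(\<integral>x. (\<Prod>k\<in>UNIV. h p k (x $ k)) \<partial>ucube) \<le> S" for p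
  proof -
    have "(\<integral>x. (\<Prod>k\<in>UNIV. h p k (x $ k)) \<partial>ucube) = (\<Prod>k\<in>UNIV. \<integral>t. h p k t \<partial>u01)" by (rule integral_prod_ucube(2)[OF hi])
    also have "\<dots> = (\<integral>t. h p i t \<partial>u01) * (\<Prod>k\<in>UNIV - {i}. \<integral>t. h p k t \<partial>u01)" by (rule prod.remove) auto
    also have "(\<Prod>k\<in>UNIV - {i}. \<integral>t. h p k t \<partial>u01) = 1" by (rule prod.neutral) (auto simp: h_def n1)
    finally show ?thesis using S by (simp add: h_def)
  qed
  have pt: "(cmod (slater_grad f f' i x))\<^sup>2 \<le> fact CARD('n) * (\<Sum>p\<in>?P. \<Prod>k\<in>UNIV. h p k (x $ k))" for x
  proof -
    let ?a = "\<lambda>p. cmod (of_int (sign p) * (f' (p i) (x $ i) * (\<Prod>k\<in>UNIV - {i}. f (p k) (x $ k))))"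
    have "cmod (slater_grad f f' i x) \<le> (\<Sum>p\<in>?P. ?a p)" unfolding slater_grad_def by (rule norm_sum)
    then have "(cmod (slater_grad f f' i x))\<^sup>2 \<le> (\<Sum>p\<in>?P. ?a p)\<^sup>2" by (rule power_mono) simp
    also have "\<dots> \<le> (\<Sum>p\<in>?P. (?a p)\<^sup>2) * card ?P" by (rule sum_squared_le_sum_of_squares)
    also have "(\<Sum>p\<in>?P. (?a p)\<^sup>2) = (\<Sum>p\<in>?P. \<Prod>k\<in>UNIV. h p k (x $ k))"
    proof (rule sum.cong[OF refl])
      fix p
      have "(\<Prod>k\<in>UNIV. h p k (x $ k)) = h p i (x $ i) * (\<Prod>k\<in>UNIV - {i}. h p k (x $ k))" by (rule prod.remove) auto
      also have "(\<Prod>k\<in>UNIV - {i}. h p k (x $ k)) = (\<Prod>k\<in>UNIV - {i}. (cmod (f (p k) (x $ k)))\<^sup>2)"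
        by (rule prod.cong) (auto simp: h_def)
      finally show "(?a p)\<^sup>2 = (\<Prod>k\<in>UNIV. h p k (x $ k))"
        by (simp add: h_def norm_mult power_mult_distrib sign_def prod_norm[symmetric] prod_power_distrib)
    qed
    finally show ?thesis by (simp add: cardP mult.commute)
  qed
  have bi: "integrable ucube (\<lambda>x. fact CARD('n) * (\<Sum>p\<in>?P. \<Prod>k\<in>UNIV. h p k (x $ k)))"
    by (intro integrable_mult_right Bochner_Integration.integrable_sum Hi)
  show I: "integrable ucube (\<lambda>x. (cmod (slater_grad f f' i x))\<^sup>2)"
  proof (rule Bochner_Integration.integrable_bound[OF bi])
    show "AE x in ucube. norm ((cmod (slater_grad f f' i x))\<^sup>2) \<le> norm (fact CARD('n) * (\<Sum>p\<in>?P. \<Prod>k\<in>UNIV. h p k (x $ k)))"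
      using pt by (intro AE_I2) (auto intro: order_trans[OF _ abs_ge_self])
    show "(\<lambda>x. (cmod (slater_grad f f' i x))\<^sup>2) \<in> borel_measurable ucube" using m by measurable
  qed
  have "(\<integral>x. (cmod (slater_grad f f' i x))\<^sup>2 \<partial>ucube) \<le> (\<integral>x. fact CARD('n) * (\<Sum>p\<in>?P. \<Prod>k\<in>UNIV. h p k (x $ k)) \<partial>ucube)"
    using pt by (intro integral_mono I bi) auto
  also have "\<dots> = fact CARD('n) * (\<Sum>p\<in>?P. \<integral>x. (\<Prod>k\<in>UNIV. h p k (x $ k)) \<partial>ucube)"
    by (simp only: integral_mult_right_zero Bochner_Integration.integral_sum[OF Hi])
  also have "\<dots> \<le> fact CARD('n) * (\<Sum>p\<in>?P. S)" by (intro mult_left_mono sum_mono He) auto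
  also have "\<dots> = (fact CARD('n))\<^sup>2 * S" by (simp add: cardP power2_eq_square)
  finally show "(\<integral>x. (cmod (slater_grad f f' i x))\<^sup>2 \<partial>ucube) \<le> (fact CARD('n))\<^sup>2 * S" .
qed


text \<open>All spins point up. That spin state is invariant under relabelling of the particles, so
  the determinant in space carries the whole antisymmetry.\<close>

lemma slater_state_with_density:
  fixes f f' :: "'n::finite \<Rightarrow> real \<Rightarrow> complex"
  assumes c: "\<And>k. continuous_on UNIV (f k)" and ac: "\<And>k. ac_pair (f k) (f' k)" and per: "\<And>k. f k 0 = f k 1"
    and f'm: "\<And>k. f' k \<in> borel_measurable borel"
    and f'2: "\<And>k. integrable u01 (\<lambda>t. (cmod (f' k t))\<^sup>2)" and S: "\<And>k. (\<integral>t. (cmod (f' k t))\<^sup>2 \<partial>u01) \<le> S"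
    and orth: "\<And>a b. (\<integral>t. f a t * cnj (f b t) \<partial>u01) = (if a = b then 1 else 0)"
  shows "\<exists>\<Psi> :: 'n wf. \<Psi> \<in> Wset \<and> kin \<Psi> \<le> real CARD('n) * fact CARD('n) * S \<and>
    (\<forall>t. dens \<Psi> t = (\<Sum>a\<in>UNIV. (cmod (f a t))\<^sup>2))"
proof -
  let ?P = "{p. p permutes (UNIV :: 'n set)}" and ?F = "fact CARD('n) :: real"
  have cardP: "card ?P = fact CARD('n)" by (rule card_permutations) auto
  \<comment> \<open>The determinant has squared norm \<open>fact CARD('n)\<close>, one unit for each
    permutation on the diagonal.\<close>
  define z where "z = complex_of_real (1 / sqrt ?F)"
  have z2: "(cmod z)\<^sup>2 = 1 / ?F" by (simp add: z_def power_divide norm_divide)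
  define up where "up = (\<lambda>_ :: 'n. True)"
  define \<Psi> :: "'n wf" where "\<Psi> x \<sigma> = (if \<sigma> = up then z * slater f x else 0)" for x \<sigma>
  define \<Gamma> :: "'n \<Rightarrow> 'n wf" where "\<Gamma> i x \<sigma> = (if \<sigma> = up then z * slater_grad f f' i x else 0)" for i x \<sigma>
  have n1: "(\<integral>t. (cmod (f k t))\<^sup>2 \<partial>u01) = 1" for k
  proof -
    have "complex_of_real (\<integral>t. (cmod (f k t))\<^sup>2 \<partial>u01) = (\<integral>t. f k t * cnj (f k t) \<partial>u01)"
      unfolding complex_norm_square[symmetric] by (rule integral_complex_of_real[symmetric])
    then show ?thesis using orth[of k k] by simp
  qed
  have f'i: "integrable u01 (f' k)" for k
  proof (rule Bochner_Integration.integrable_bound[where f = "\<lambda>t. 1 + (cmod (f' k t))\<^sup>2"])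
    have "s \<le> 1 + s\<^sup>2" for s :: real
      using sum_squares_bound[of s 1] zero_le_power2[of s] by (smt (verit) mult_1_right one_power2)
    then show "AE t in u01. norm (f' k t) \<le> norm (1 + (cmod (f' k t))\<^sup>2)" by simp
  qed (use f'm f'2 in \<open>auto cong: measurable_cong_sets\<close>)
  note gb = slater_grad_bound[of f f' S, OF c f'm f'2 S n1]
  have sc: "continuous_on UNIV (slater f)" by (rule slater_continuous[OF c])
  have sm: "slater f \<in> borel_measurable borel" by (rule borel_measurable_continuous_onI[OF sc])
  have s2: "integrable ucube (\<lambda>x. (cmod (slater f x))\<^sup>2)"
  proof (subst integrable_uni_iff)
    show "(\<lambda>x. (cmod (slater f x))\<^sup>2) absolutely_integrable_on cube"
      unfolding cube_def by (intro absolutely_integrable_continuous continuous_intros continuous_on_subset[OF sc]) simp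
  qed (use sm in auto)
  have Lz: "L2c (\<lambda>x. z * u x)" if "u \<in> borel_measurable borel" "integrable ucube (\<lambda>x. (cmod (u x))\<^sup>2)" for u :: "real^'n \<Rightarrow> complex"
    using that by (intro L2cI) (auto simp: norm_mult power_mult_distrib)
  have L0: "L2c (\<lambda>x :: real^'n. 0)" by (rule L2cI) auto
  have \<Psi>L: "L2c (\<lambda>x. \<Psi> x \<sigma>)" for \<sigma> using Lz[OF sm s2] L0 by (cases "\<sigma> = up") (simp_all add: \<Psi>_def)
  have \<Gamma>L: "L2c (\<lambda>x. \<Gamma> i x \<sigma>)" for i \<sigma> using Lz[OF gb(1,2)] L0 by (cases "\<sigma> = up") (simp_all add: \<Gamma>_def)
  have \<Psi>w: "weak_pderiv i (\<lambda>x. \<Psi> x \<sigma>) (\<lambda>x. \<Gamma> i x \<sigma>)" for i \<sigma>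
  proof (cases "\<sigma> = up")
    case True
    show ?thesis
      unfolding weak_pderiv_def
    proof (intro allI impI)
      fix \<phi> :: "real^'n \<Rightarrow> real" and d assume t: "testN \<phi> d"
      have e: "integral cube (\<lambda>x. of_real (d i x) * slater f x) = - integral cube (\<lambda>x. of_real (\<phi> x) * slater_grad f f' i x)"
        using slater_weak_pderiv[of f f' i, OF c ac per f'i] t unfolding weak_pderiv_def by blast
      have "integral cube (\<lambda>x. of_real (d i x) * \<Psi> x \<sigma>) = integral cube (\<lambda>x. z * (of_real (d i x) * slater f x))"
        using True by (simp add: \<Psi>_def mult_ac)
      also have "\<dots> = z * integral cube (\<lambda>x. of_real (d i x) * slater f x)" by (rule integral_mult_right)
      also have "\<dots> = - (z * integral cube (\<lambda>x. of_real (\<phi> x) * slater_grad f f' i x))" by (simp only: e mult_minus_right)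
      also have "z * integral cube (\<lambda>x. of_real (\<phi> x) * slater_grad f f' i x) = integral cube (\<lambda>x. z * (of_real (\<phi> x) * slater_grad f f' i x))"
        by (rule integral_mult_right[symmetric])
      also have "\<dots> = integral cube (\<lambda>x. of_real (\<phi> x) * \<Gamma> i x \<sigma>)"
        using True by (simp add: \<Gamma>_def mult_ac)
      finally show "integral cube (\<lambda>x. of_real (d i x) * \<Psi> x \<sigma>) = - integral cube (\<lambda>x. of_real (\<phi> x) * \<Gamma> i x \<sigma>)" .
    qed
  next
    case False
    then show ?thesis by (simp add: \<Psi>_def \<Gamma>_def weak_pderiv_def)
  qed
  have "antisym_wf \<Psi>"
    unfolding antisym_wf_def
  proof (intro allI impI)
    fix i j :: 'n and x :: "real^'n" and \<sigma> assume ij: "i \<noteq> j"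
    have inv: "transp i j (transp i j k) = k" for k by (auto simp: transp_def)
    have "\<sigma> \<circ> transp i j = up \<longleftrightarrow> \<sigma> = up"
      unfolding up_def fun_eq_iff comp_def by (metis inv)
    then show "\<Psi> (\<chi> k. x $ transp i j k) (\<sigma> \<circ> transp i j) = - \<Psi> x \<sigma>"
      by (simp add: \<Psi>_def slater_antisym[OF ij])
  qed
  then have H1: "H1wf \<Psi>" unfolding H1wf_def using \<Psi>L \<Gamma>L \<Psi>w by blast
  have line: "integral cube (\<lambda>y. (cmod (\<Psi> (\<chi> k. if k = i then t else y $ k) \<sigma>))\<^sup>2)
      = (if \<sigma> = up then (1 / ?F) * (\<Sum>p\<in>?P. (cmod (f (p i) t))\<^sup>2) else 0)" for i t \<sigma>
  proof (cases "\<sigma> = up")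
    case True
    note sl = slater_line_density[of f, OF c orth, of i t]
    have "integral cube (\<lambda>y. (cmod (\<Psi> (\<chi> k. if k = i then t else y $ k) \<sigma>))\<^sup>2) = integral cube (\<lambda>y. (1 / ?F) * (cmod (slater f (vupd i y t)))\<^sup>2)"
      using True by (simp add: \<Psi>_def norm_mult power_mult_distrib z2 vupd_def)
    also have "\<dots> = (1 / ?F) * integral cube (\<lambda>y. (cmod (slater f (vupd i y t)))\<^sup>2)" by (rule integral_mult_right)
    also have "integral cube (\<lambda>y. (cmod (slater f (vupd i y t)))\<^sup>2) = (\<Sum>p\<in>?P. (cmod (f (p i) t))\<^sup>2)"
      using integral_uni_eq[OF sl(1) cube_borel] sl(2) by simp
    finally show ?thesis using True by simp
  next
    case False
    then show ?thesis by (simp add: \<Psi>_def)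
  qed
  have dens: "dens \<Psi> t = (\<Sum>a\<in>UNIV. (cmod (f a t))\<^sup>2)" for t
  proof -
    have "dens \<Psi> t = (\<Sum>i\<in>UNIV. (1 / ?F) * (\<Sum>p\<in>?P. (cmod (f (p i) t))\<^sup>2))"
      unfolding dens_def line by simp
    also have "\<dots> = (1 / ?F) * (\<Sum>p\<in>?P. \<Sum>i\<in>UNIV. (cmod (f (p i) t))\<^sup>2)"
      unfolding sum_distrib_left[symmetric] by (subst sum.swap) simp
    \<comment> \<open>A permutation visits every orbital exactly once, so the sum over particles no
      longer depends on \<open>p\<close>.\<close>
    also have "\<dots> = (1 / ?F) * (\<Sum>p\<in>?P. \<Sum>a\<in>UNIV. (cmod (f a t))\<^sup>2)"
    proof -
      have "(\<Sum>i\<in>UNIV. (cmod (f (p i) t))\<^sup>2) = (\<Sum>a\<in>UNIV. (cmod (f a t))\<^sup>2)" if "p \<in> ?P" for p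
      proof -
        have "bij p" using that permutes_bij by blast
        then show ?thesis by (rule sum.reindex_bij_betw)
      qed
      then show ?thesis by (intro arg_cong[where f = "\<lambda>x. (1 / ?F) * x"]) (rule sum.cong[OF refl])
    qed
    also have "\<dots> = (\<Sum>a\<in>UNIV. (cmod (f a t))\<^sup>2)" by (simp add: cardP)
    finally show ?thesis .
  qed
  have "norm2_wf \<Psi> = 1"
  proof -
    \<comment> \<open>Any particle serves: the norm is the integral of the line density in its
      coordinate.\<close>
    obtain i :: 'n where True by simp
    have sq: "integral cube (\<lambda>x. (cmod (\<Psi> x \<sigma>))\<^sup>2) = (if \<sigma> = up then (1 / ?F) * (\<integral>x. (cmod (slater f x))\<^sup>2 \<partial>ucube) else 0)" for \<sigma>
    proof (cases "\<sigma> = up")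
      case True
      have "integral cube (\<lambda>x. (cmod (\<Psi> x \<sigma>))\<^sup>2) = integral cube (\<lambda>x. (1 / ?F) * (cmod (slater f x))\<^sup>2)"
        using True by (simp add: \<Psi>_def norm_mult power_mult_distrib z2)
      also have "\<dots> = (1 / ?F) * integral cube (\<lambda>x. (cmod (slater f x))\<^sup>2)" by (rule integral_mult_right)
      finally show ?thesis using True integral_uni_eq[OF s2 cube_borel] by simp
    qed (simp add: \<Psi>_def)
    have ci: "integrable u01 (\<lambda>t. (cmod (f a t))\<^sup>2)" for a
      by (intro continuous_integrable_u01 continuous_intros c)
    have "(\<integral>x. (cmod (slater f x))\<^sup>2 \<partial>ucube) = (\<integral>t. (\<Sum>p\<in>?P. (cmod (f (p i) t))\<^sup>2) \<partial>u01)"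
      unfolding integral_vupd(2)[OF s2, of i] slater_line_density(2)[of f, OF c orth] ..
    also have "\<dots> = (\<Sum>p\<in>?P. \<integral>t. (cmod (f (p i) t))\<^sup>2 \<partial>u01)" by (rule Bochner_Integration.integral_sum[OF ci])
    also have "\<dots> = ?F" by (simp add: n1 cardP)
    finally show ?thesis unfolding norm2_wf_def sq by simp
  qed
  then have W: "\<Psi> \<in> Wset" using H1 by (simp add: Wset_def)
  have grad: "integral cube (\<lambda>x. (cmod (grad i \<Psi> x \<sigma>))\<^sup>2) \<le> (if \<sigma> = up then ?F * S else 0)" for i \<sigma>
  proof -
    let ?g = "SOME g. L2c g \<and> weak_pderiv i (\<lambda>y. \<Psi> y \<sigma>) g"
    have "L2c ?g \<and> weak_pderiv i (\<lambda>y. \<Psi> y \<sigma>) ?g"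
      by (rule someI[of _ "\<lambda>x. \<Gamma> i x \<sigma>"]) (use \<Gamma>L \<Psi>w in blast)
    then have "AE x in ucube. ?g x = \<Gamma> i x \<sigma>"
      by (intro weak_pderiv_unique[OF _ \<Gamma>L _ \<Psi>w]) auto
    then have "AE x in ucube. (cmod (grad i \<Psi> x \<sigma>))\<^sup>2 = (cmod (\<Gamma> i x \<sigma>))\<^sup>2"
      by eventually_elim (simp add: grad_def)
    then have e: "integral cube (\<lambda>x. (cmod (grad i \<Psi> x \<sigma>))\<^sup>2) = integral cube (\<lambda>x. (cmod (\<Gamma> i x \<sigma>))\<^sup>2)"
      by (rule integral_cong_AE_uni) simp
    show ?thesis
    proof (cases "\<sigma> = up")
      case True
      have "integral cube (\<lambda>x. (cmod (\<Gamma> i x \<sigma>))\<^sup>2) = integral cube (\<lambda>x. (1 / ?F) * (cmod (slater_grad f f' i x))\<^sup>2)"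
        using True by (simp add: \<Gamma>_def norm_mult power_mult_distrib z2)
      also have "\<dots> = (1 / ?F) * integral cube (\<lambda>x. (cmod (slater_grad f f' i x))\<^sup>2)" by (rule integral_mult_right)
      also have "\<dots> = (1 / ?F) * (\<integral>x. (cmod (slater_grad f f' i x))\<^sup>2 \<partial>ucube)"
        unfolding integral_uni_eq[OF gb(2) cube_borel] ..
      also have "\<dots> \<le> (1 / ?F) * (?F\<^sup>2 * S)" by (intro mult_left_mono gb(3)) simp
      also have "\<dots> = ?F * S" by (simp add: power2_eq_square)
      finally show ?thesis using True e by simp
    next
      case False
      then show ?thesis using e by (simp add: \<Gamma>_def)
    qed
  qed
  \<comment> \<open>Any index shows that \<open>S\<close> is non-negative, which later allows the
    factor 1/2 of the kinetic energy to be dropped.\<close>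
  have S0: "0 \<le> S" using S[of undefined] by (rule order_trans[rotated]) simp
  have "kin \<Psi> \<le> 1/2 * (\<Sum>i\<in>(UNIV :: 'n set). \<Sum>\<sigma>\<in>UNIV. if \<sigma> = up then ?F * S else 0)"
    unfolding kin_def by (intro mult_left_mono sum_mono grad) simp
  also have "\<dots> = 1/2 * (CARD('n) * (?F * S))" by simp
  also have "\<dots> \<le> real CARD('n) * fact CARD('n) * S" using S0 by simp
  finally show ?thesis using W dens by blast
qed

section \<open>Orbitals with a prescribed density\<close>

lemma ac_pair_cong:
  assumes "ac_pair w g" "\<And>t. t \<in> {0..1} \<Longrightarrow> w t = v t"
  shows "ac_pair v g"
  using assms ac_pair_eq[OF assms(1)] unfolding ac_pair_def by (metis atLeastAtMost_iff order_refl zero_le_one)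

lemma L2b_bounded_mult:
  assumes g: "L2b g" and h: "h \<in> borel_measurable borel" "\<And>x. \<bar>h x\<bar> \<le> B"
  shows "L2b (\<lambda>x. h x * g x)"
proof -
  have "integrable u01 (\<lambda>x. (h x)\<^sup>2 *\<^sub>R (g x)\<^sup>2)"
  proof (rule integrable_bounded_mult[OF L2b_square[OF g]])
    show "(\<lambda>x. (h x)\<^sup>2) \<in> borel_measurable u01" using h(1) by measurable
    show "\<bar>(h x)\<^sup>2\<bar> \<le> B\<^sup>2" for x using power_mono[OF h(2)[of x], of 2] by simp
  qed
  then show ?thesis using g h(1) by (simp add: L2b_def power_mult_distrib borel_measurable_times)
qed


text \<open>Constant continuation beyond the unit interval: continuity on the whole line yields
  Borel measurability, and the values that matter are unchanged.\<close>

lemma continuous_on_clamp: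
  fixes r :: "real \<Rightarrow> 'b::topological_space"
  assumes "continuous_on {0..1} r"
  shows "continuous_on UNIV (\<lambda>t. r (max 0 (min 1 t)))"
  by (rule continuous_on_compose2[OF assms]) (auto intro!: continuous_intros)

text \<open>The orbitals \<open>sqrt (r / N) * exp (2 \<pi> \<i> k \<theta>)\<close> with \<open>\<theta> = (1 / N) * \<integral>\<^sub>0\<^sup>t r\<close> (Harriman): the change of
  variables \<open>\<theta>\<close> turns them into the Fourier basis.\<close>
lemma harriman_orbitals:
  fixes r g :: "real \<Rightarrow> real" and N :: nat
  assumes ac: "ac_pair r g" and g: "L2b g" and per: "r 0 = r 1" and m: "m > 0"
    and rm: "\<And>t. t \<in> {0..1} \<Longrightarrow> m \<le> r t \<and> r t \<le> M"
    and g2: "(\<integral>t. (g t)\<^sup>2 \<partial>u01) \<le> R" and rN: "integral {0..1} r = real N" and N: "N > 0"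
  shows "\<exists>\<phi> \<phi>'. (\<forall>k. continuous_on UNIV (\<phi> k) \<and> ac_pair (\<phi> k) (\<phi>' k) \<and> \<phi> k 0 = \<phi> k 1 \<and>
      \<phi>' k \<in> borel_measurable borel \<and> integrable u01 (\<lambda>t. (cmod (\<phi>' k t))\<^sup>2) \<and>
      (k \<le> N \<longrightarrow> (\<integral>t. (cmod (\<phi>' k t))\<^sup>2 \<partial>u01) \<le> R / (2 * m) + 2 * M * (2 * pi * M)\<^sup>2) \<and>
      (\<forall>t\<in>{0..1}. (cmod (\<phi> k t))\<^sup>2 = r t / N)) \<and>
      (\<forall>k l. (\<integral>t. \<phi> k t * cnj (\<phi> l t) \<partial>u01) = (if k = l then 1 else 0))"
proof -
  define cl :: "real \<Rightarrow> real" where "cl t = max 0 (min 1 t)" for t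
  have cl: "cl t \<in> {0..1}" for t by (auto simp: cl_def)
  have cl_id: "cl t = t" if "t \<in> {0..1}" for t using that by (auto simp: cl_def)
  define rc where "rc t = r (cl t)" for t
  have rc: "m \<le> rc t" "rc t \<le> M" "rc t > 0" for t using rm[OF cl[of t]] m by (auto simp: rc_def)
  have rc_id: "rc t = r t" if "t \<in> {0..1}" for t by (simp add: rc_def cl_id[OF that])
  have M: "M > 0" using rc[of 0] by simp
  have rcc: "continuous_on UNIV rc"
    unfolding rc_def cl_def by (rule continuous_on_clamp[OF ac_pair_continuous[OF ac]])
  have acr: "ac_pair rc g" by (rule ac_pair_cong[OF ac]) (simp add: rc_id)
  define \<theta>0 where "\<theta>0 t = integral {0..t} rc / N" for t
  have rci: "integral {0..1} rc = real N"
    unfolding rN[symmetric] by (rule Henstock_Kurzweil_Integration.integral_cong) (simp add: rc_id)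
  have \<theta>0d: "(\<theta>0 has_vector_derivative rc t / N) (at t within {0..1})" if "t \<in> {0..1}" for t
  proof -
    have "((\<lambda>t. integral {0..t} rc) has_vector_derivative rc t) (at t within {0..1})"
      by (rule integral_has_vector_derivative[OF continuous_on_subset[OF rcc] that]) simp
    from has_vector_derivative_divide[OF this, of "real N"] show ?thesis unfolding \<theta>0_def[abs_def] .
  qed
  have \<theta>0c: "continuous_on {0..1} \<theta>0"
    using \<theta>0d has_vector_derivative_continuous unfolding continuous_on_eq_continuous_within by blast
  have \<theta>01: "\<theta>0 0 = 0" "\<theta>0 1 = 1" using N by (simp_all add: \<theta>0_def rci)
  define \<theta> where "\<theta> t = \<theta>0 (cl t)" for t
  have \<theta>c: "continuous_on UNIV \<theta>" unfolding \<theta>_def cl_def by (rule continuous_on_clamp[OF \<theta>0c])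
  have \<theta>d: "(\<theta> has_vector_derivative rc t / N) (at t within {0..1})" if "t \<in> {0..1}" for t
    by (rule has_vector_derivative_transform[OF that _ \<theta>0d[OF that]]) (simp add: \<theta>_def cl_id)
  have \<theta>1: "\<theta> 0 = 0" "\<theta> 1 = 1" using \<theta>01 cl_id[of 0] cl_id[of 1] by (simp_all add: \<theta>_def)
  \<comment> \<open>\<open>c\<close> is kept general because the product of one orbital with the
    conjugate of another leads to the difference \<open>w k - w l\<close>.\<close>
  define e where "e c t = exp (c * complex_of_real (\<theta> t))" for c :: complex and t
  have ed: "(e c has_vector_derivative c * complex_of_real (rc t / N) * e c t) (at t within {0..1})" if "t \<in> {0..1}" for c t
  proof -
    have "((\<lambda>t. c * complex_of_real (\<theta> t)) has_vector_derivative c * complex_of_real (rc t / N)) (at t within {0..1})"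
      by (intro has_vector_derivative_mult_right has_vector_derivative_of_real
          has_real_derivative_iff_has_vector_derivative[THEN iffD2, OF \<theta>d[OF that]])
    from field_vector_diff_chain_within[OF this, of exp "exp (c * complex_of_real (\<theta> t))"]
    show ?thesis by (simp add: o_def e_def[abs_def] DERIV_exp has_field_derivative_at_within)
  qed
  have ec: "continuous_on UNIV (e c)" for c unfolding e_def by (intro continuous_intros \<theta>c)
  have ed_cont: "continuous_on UNIV (\<lambda>t. c * complex_of_real (rc t / N) * e c t)" for c
    by (intro continuous_intros rcc ec) (use N in simp)
  have ace: "ac_pair (e c) (\<lambda>t. c * complex_of_real (rc t / N) * e c t)" for c
    by (rule ac_pair_C1[OF continuous_on_subset[OF ed_cont] ed]) simp_all
  define w where "w k = \<i> * complex_of_real (2 * pi * real k)" for k :: nat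
  have e01: "e (w k) 0 = 1" "e (w k) 1 = 1" for k
  proof -
    show "e (w k) 0 = 1" by (simp add: e_def \<theta>1)
    have "exp (w k) = 1" unfolding w_def using exp_2pi_1_int[of "int k"] by (simp add: mult_ac)
    then show "e (w k) 1 = 1" by (simp add: e_def \<theta>1)
  qed
  have en: "cmod (e (w k) t) = 1" for k t by (simp add: e_def w_def)
  define s where "s t = sqrt (rc t) / sqrt N" for t
  define s' where "s' t = g t / (2 * sqrt (rc t)) / sqrt N" for t
  have sc: "continuous_on UNIV s" unfolding s_def by (intro continuous_intros rcc) (use N in simp)
  have acs: "ac_pair s s'"
  proof -
    have "ac_pair (\<lambda>t. sqrt (rc t)) (\<lambda>t. g t / (2 * sqrt (rc t)))" by (rule ac_pair_sqrt[OF acr rc(3)])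
    from ac_pair_lincomb[OF this this, of "1 / sqrt N" 0] show ?thesis by (simp add: s_def[abs_def] s'_def[abs_def] mult_ac)
  qed
  have s2: "(s t)\<^sup>2 = rc t / N" for t using rc(3)[of t] by (simp add: s_def power_divide less_imp_le)
  have s'2: "(s' t)\<^sup>2 = (g t)\<^sup>2 / (4 * rc t * N)" for t
    using rc(3)[of t] by (simp add: s'_def power_divide power_mult_distrib less_imp_le)
  define \<phi> where "\<phi> k t = complex_of_real (s t) * e (w k) t" for k t
  define \<phi>' where "\<phi>' k t = complex_of_real (s' t) * e (w k) t + complex_of_real (s t) * (w k * complex_of_real (rc t / N) * e (w k) t)" for k t
  have 1: "continuous_on UNIV (\<phi> k)" for k unfolding \<phi>_def by (intro continuous_intros sc ec)
  have 2: "ac_pair (\<phi> k) (\<phi>' k)" for k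
    unfolding \<phi>_def \<phi>'_def by (rule ac_pair_mult[OF ac_pair_bounded_linear[OF acs bounded_linear_of_real] ace])
  have 3: "\<phi> k 0 = \<phi> k 1" for k using per rc_id[of 0] rc_id[of 1] by (simp add: \<phi>_def e01 s_def)
  have [measurable]: "g \<in> borel_measurable borel" "rc \<in> borel_measurable borel" "e c \<in> borel_measurable borel" for c
    using L2b_measurable[OF g] borel_measurable_continuous_onI[OF rcc] borel_measurable_continuous_onI[OF ec] by auto
  have 4[measurable]: "\<phi>' k \<in> borel_measurable borel" for k unfolding \<phi>'_def s'_def s_def by measurable
  have 7: "(cmod (\<phi> k t))\<^sup>2 = r t / N" if "t \<in> {0..1}" for k t
    by (simp add: \<phi>_def norm_mult en s2 rc_id[OF that])
  \<comment> \<open>The derivative is split by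
    \<open>(a + b)\<^sup>2 \<le> 2 * a\<^sup>2 + 2 * b\<^sup>2\<close>: its amplitude part is
    controlled by \<open>g\<close> and the lower bound \<open>m\<close>, its phase part by the upper
    bound \<open>M\<close> and the frequency.\<close>
  have bound: "(cmod (\<phi>' k t))\<^sup>2 \<le> 1 / (2 * m) * (g t)\<^sup>2 + 2 * M * (2 * pi * (k * M / N))\<^sup>2" for k t
  proof -
    have sq: "(a + b)\<^sup>2 \<le> 2 * a\<^sup>2 + 2 * b\<^sup>2" for a b :: real
      using sum_squares_bound[of a b] by (simp add: power2_sum)
    have N1: "1 \<le> real N" using N by simp
    have "cmod (\<phi>' k t) \<le> \<bar>s' t\<bar> + \<bar>s t\<bar> * (cmod (w k) * (rc t / N))"
      unfolding \<phi>'_def by (rule norm_triangle_le) (use rc(3)[of t] in \<open>simp add: norm_mult en norm_divide\<close>)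
    then have "(cmod (\<phi>' k t))\<^sup>2 \<le> (\<bar>s' t\<bar> + \<bar>s t\<bar> * (cmod (w k) * (rc t / N)))\<^sup>2" by (rule power_mono) simp
    also have "\<dots> \<le> 2 * (s' t)\<^sup>2 + 2 * ((s t)\<^sup>2 * (cmod (w k) * (rc t / N))\<^sup>2)"
      using sq[of "\<bar>s' t\<bar>" "\<bar>s t\<bar> * (cmod (w k) * (rc t / N))"] by (simp only: power_mult_distrib power2_abs)
    also have "\<dots> \<le> 1 / (2 * m) * (g t)\<^sup>2 + 2 * (M * (2 * pi * (k * M / N))\<^sup>2)"
    proof (rule add_mono)
      have "m * 1 \<le> rc t * N" using rc(1,3)[of t] N1 m by (intro mult_mono) auto
      then have "(g t)\<^sup>2 / (2 * (rc t * N)) \<le> (g t)\<^sup>2 / (2 * m)" using m rc(3)[of t] N by (intro divide_left_mono) auto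
      then show "2 * (s' t)\<^sup>2 \<le> 1 / (2 * m) * (g t)\<^sup>2" by (simp add: s'2 mult_ac)
      have "rc t / N \<le> rc t" using rc(3)[of t] N1 by (simp add: divide_le_eq)
      then have "(s t)\<^sup>2 \<le> M" using rc(2)[of t] by (simp add: s2)
      moreover have "(cmod (w k) * (rc t / N))\<^sup>2 \<le> (2 * pi * (k * M / N))\<^sup>2"
      proof (rule power_mono)
        have "cmod (w k) * (rc t / N) = 2 * pi * (k * rc t / N)" by (simp add: w_def norm_mult)
        also have "\<dots> \<le> 2 * pi * (k * M / N)"
          using rc(2)[of t] by (intro mult_left_mono divide_right_mono) auto
        finally show "cmod (w k) * (rc t / N) \<le> 2 * pi * (k * M / N)" .
      qed (use rc(3)[of t] in simp)
      ultimately show "2 * ((s t)\<^sup>2 * (cmod (w k) * (rc t / N))\<^sup>2) \<le> 2 * (M * (2 * pi * (k * M / N))\<^sup>2)"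
        using M by (intro mult_left_mono mult_mono) auto
    qed
    finally show ?thesis by simp
  qed
  have bi: "integrable u01 (\<lambda>t. 1 / (2 * m) * (g t)\<^sup>2 + 2 * M * (2 * pi * (k * M / N))\<^sup>2)" for k :: nat
    using L2b_square[OF g] by (intro Bochner_Integration.integrable_add integrable_mult_right) auto
  have 5: "integrable u01 (\<lambda>t. (cmod (\<phi>' k t))\<^sup>2)" for k
  proof (rule Bochner_Integration.integrable_bound[OF bi])
    show "AE t in u01. norm ((cmod (\<phi>' k t))\<^sup>2) \<le> norm (1 / (2 * m) * (g t)\<^sup>2 + 2 * M * (2 * pi * (k * M / N))\<^sup>2)"
      using bound[of k] by (intro AE_I2) (auto intro: order_trans[OF _ abs_ge_self])
  qed measurable
  have 6: "(\<integral>t. (cmod (\<phi>' k t))\<^sup>2 \<partial>u01) \<le> R / (2 * m) + 2 * M * (2 * pi * M)\<^sup>2" if k: "k \<le> N" for k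
  proof -
    have "(\<integral>t. (cmod (\<phi>' k t))\<^sup>2 \<partial>u01) \<le> (\<integral>t. 1 / (2 * m) * (g t)\<^sup>2 + 2 * M * (2 * pi * (k * M / N))\<^sup>2 \<partial>u01)"
      using bound[of k] by (intro integral_mono 5 bi) auto
    also have "\<dots> = 1 / (2 * m) * (\<integral>t. (g t)\<^sup>2 \<partial>u01) + 2 * M * (2 * pi * (k * M / N))\<^sup>2"
      using L2b_square[OF g] by (simp add: u01.prob_space[simplified])
    also have "\<dots> \<le> 1 / (2 * m) * R + 2 * M * (2 * pi * M)\<^sup>2"
    proof (intro add_mono mult_left_mono g2 power_mono)
      \<comment> \<open>The restriction \<open>k \<le> N\<close> makes the bound the same for all
        orbitals; the frequency is compensated by the factor \<open>1 / N\<close> in the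
        phase.\<close>
      show "real k * M / real N \<le> M" using k N M by (simp add: divide_le_eq mult.commute)
    qed (use m M in auto)
    finally show ?thesis by simp
  qed
  have 8: "(\<integral>t. \<phi> k t * cnj (\<phi> l t) \<partial>u01) = (if k = l then 1 else 0)" for k l
  proof -
    let ?c = "w k - w l"
    have pt: "\<phi> k t * cnj (\<phi> l t) = complex_of_real (rc t / N) * e ?c t" for t
    proof -
      have "e (w k) t * cnj (e (w l) t) = e ?c t"
        by (simp add: e_def w_def exp_cnj mult_exp_exp left_diff_distrib)
      moreover have "complex_of_real (s t) * complex_of_real (s t) = complex_of_real (rc t / N)"
        using s2[of t] by (simp only: of_real_mult[symmetric] power2_eq_square)
      moreover have "\<phi> k t * cnj (\<phi> l t) = (complex_of_real (s t) * complex_of_real (s t)) * (e (w k) t * cnj (e (w l) t))"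
        by (simp add: \<phi>_def mult_ac)
      ultimately show ?thesis by (simp only:)
    qed
    have cont: "continuous_on UNIV (\<lambda>t. \<phi> k t * cnj (\<phi> l t))" by (intro continuous_intros 1)
    have I: "(\<integral>t. \<phi> k t * cnj (\<phi> l t) \<partial>u01) = integral {0..1} (\<lambda>t. complex_of_real (rc t / N) * e ?c t)"
      using integral_uni_eq[OF continuous_integrable_u01[OF cont]] by (simp only: pt) simp
    show ?thesis
    proof (cases "k = l")
      case True
      have "integral {0..1} (\<lambda>t. complex_of_real (rc t / N) * e ?c t) = integral {0..1} (\<lambda>t. complex_of_real (rc t / N))"
        using True by (simp add: e_def)
      also have "\<dots> = complex_of_real (integral {0..1} (\<lambda>t. rc t / N))"
      proof -
        have "continuous_on {0..1} (\<lambda>t. rc t / N)"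
          by (intro continuous_intros continuous_on_subset[OF rcc]) (use N in auto)
        from integral_linear[OF integrable_continuous_interval[OF this] bounded_linear_of_real]
        show ?thesis by (simp only: o_def)
      qed
      also have "\<dots> = 1" using N by (simp add: rci)
      finally show ?thesis using True I by simp
    next
      case False
      have c0: "?c \<noteq> 0"
        using False by (simp add: w_def)
      \<comment> \<open>The weight \<open>rc t / N\<close> is the derivative of the phase, so the
        integrand is an exact derivative, and \<open>e ?c\<close> takes the same value 1 at both
        ends.\<close>
      have "integral {0..1} (\<lambda>t. ?c * complex_of_real (rc t / N) * e ?c t) = e ?c 1 - e ?c 0"
        by (rule ac_pair_integral[OF ace])
      also have "e ?c 1 - e ?c 0 = 0"
        using e01(2)[of k] e01(2)[of l] by (simp add: e_def \<theta>1 exp_diff)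
      finally have "?c * integral {0..1} (\<lambda>t. complex_of_real (rc t / N) * e ?c t) = 0"
        by (simp only: mult.assoc integral_mult_right)
      then show ?thesis using c0 I False by simp
    qed
  qed
  show ?thesis
    by (rule exI[of _ \<phi>], rule exI[of _ \<phi>']) (use 1 2 3 4 5 6 7 8 in blast)
qed

text \<open>Every orbital has the same density \<open>r / N\<close>, so any N of them add up to
  \<open>r\<close>; the frequencies serve only to make them orthogonal. An enumeration of the
  particle labels selects frequencies below N.\<close>

lemma density_realization:
  fixes r g :: "real \<Rightarrow> real"
  assumes ac: "ac_pair r g" and g: "L2b g" and per: "r 0 = r 1" and m: "m > 0"
    and rm: "\<And>t. t \<in> {0..1} \<Longrightarrow> m \<le> r t \<and> r t \<le> M"
    and g2: "(\<integral>t. (g t)\<^sup>2 \<partial>u01) \<le> R" and rN: "integral {0..1} r = real CARD('n::finite)"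
  shows "\<exists>\<Psi> :: 'n wf. \<Psi> \<in> Wset \<and>
    kin \<Psi> \<le> real CARD('n) * fact CARD('n) * (R / (2 * m) + 2 * M * (2 * pi * M)\<^sup>2) \<and> (\<forall>t\<in>{0..1}. dens \<Psi> t = r t)"
proof -
  have N: "CARD('n) > 0" by simp
  obtain \<phi> \<phi>' where \<phi>: "\<And>k. continuous_on UNIV (\<phi> k)" "\<And>k. ac_pair (\<phi> k) (\<phi>' k)" "\<And>k. \<phi> k 0 = \<phi> k 1"
      "\<And>k. \<phi>' k \<in> borel_measurable borel" "\<And>k. integrable u01 (\<lambda>t. (cmod (\<phi>' k t))\<^sup>2)"
      "\<And>k. k \<le> CARD('n) \<Longrightarrow> (\<integral>t. (cmod (\<phi>' k t))\<^sup>2 \<partial>u01) \<le> R / (2 * m) + 2 * M * (2 * pi * M)\<^sup>2"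
      "\<And>k t. t \<in> {0..1} \<Longrightarrow> (cmod (\<phi> k t))\<^sup>2 = r t / CARD('n)"
      "\<And>k l. (\<integral>t. \<phi> k t * cnj (\<phi> l t) \<partial>u01) = (if k = l then 1 else 0)"
    using harriman_orbitals[OF ac g per m rm g2 rN N] by blast
  obtain n :: "'n \<Rightarrow> nat" where n: "bij_betw n UNIV {0..<CARD('n)}"
    using ex_bij_betw_finite_nat[of "UNIV :: 'n set"] by auto
  have ninj: "n a = n b \<longleftrightarrow> a = b" for a b using bij_betw_imp_inj_on[OF n] by (simp add: inj_eq)
  have nle: "n a \<le> CARD('n)" for a using bij_betwE[OF n] by (auto intro: less_imp_le)
  have "\<exists>\<Psi> :: 'n wf. \<Psi> \<in> Wset \<and> kin \<Psi> \<le> real CARD('n) * fact CARD('n) * (R / (2 * m) + 2 * M * (2 * pi * M)\<^sup>2) \<and>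
      (\<forall>t. dens \<Psi> t = (\<Sum>a\<in>UNIV. (cmod (\<phi> (n a) t))\<^sup>2))"
    by (rule slater_state_with_density[where f = "\<lambda>a. \<phi> (n a)" and f' = "\<lambda>a. \<phi>' (n a)"])
       (simp_all only: \<phi>(1-5,8) \<phi>(6)[OF nle] ninj)
  moreover have "(\<Sum>a\<in>(UNIV :: 'n set). (cmod (\<phi> (n a) t))\<^sup>2) = r t" if "t \<in> {0..1}" for t
    using \<phi>(7)[OF that] by simp
  ultimately show ?thesis by (metis (no_types, lifting))
qed

section \<open>Positive densities, bounds on the interaction, and the conclusion\<close>

text \<open>A closed set that contains almost every point of an open interval contains all of it,
  and the end points follow by closure.\<close>

lemma continuous_AE_lower_bound:
  fixes r :: "real \<Rightarrow> real"
  assumes c: "continuous_on {0..1} r" and ae: "AE t in u01. m \<le> r t" and t: "t \<in> {0..1}"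
  shows "m \<le> r t"
proof -
  let ?C = "{t \<in> {0..1}. m \<le> r t}"
  have C: "closed ?C" by (intro continuous_on_closed_Collect_le c) auto
  have "AE t in lborel. t \<in> {0..1} \<longrightarrow> m \<le> r t" using ae by (simp add: AE_uni_iff)
  then have "AE t in lborel. t \<in> {0<..<1} \<longrightarrow> t \<in> ?C" by eventually_elim auto
  then have "AE t\<in>{0<..<1} in lebesgue. t \<in> ?C" by (rule AE_completion)
  then have "{0<..<1} \<subseteq> ?C"
    using mem_closed_if_AE_lebesgue_open[OF open_greaterThanLessThan C] by blast
  then have "closure {0<..<1} \<subseteq> ?C" by (rule closure_minimal[OF _ C])
  then show ?thesis using t by auto
qed

lemma admissible_W_bounds:
  fixes W :: "'n::finite wf \<Rightarrow> 'n wf \<Rightarrow> complex"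
  assumes "admissible_W W"
  obtains a b where "0 \<le> a" "\<And>\<Psi>. \<Psi> \<in> Wset \<Longrightarrow> 0 \<le> Re (W \<Psi> \<Psi>)"
    "\<And>\<Psi>. \<Psi> \<in> Wset \<Longrightarrow> Re (W \<Psi> \<Psi>) \<le> a * kin \<Psi> + b"
proof -
  have "\<forall>\<Psi>. H1wf \<Psi> \<longrightarrow> 0 \<le> Re (W \<Psi> \<Psi>)" using assms unfolding admissible_W_def by (elim conjE)
  moreover have "\<exists>a b. 0 \<le> a \<and> a < 1 \<and> 0 \<le> b \<and> (\<forall>\<Psi>\<in>Wset. cmod (W \<Psi> \<Psi>) \<le> a * kin \<Psi> + b)"
    using assms unfolding admissible_W_def by (elim conjE)
  ultimately show ?thesis using that
    by (metis (no_types, lifting) Wset_def complex_Re_le_cmod mem_Collect_eq order_trans)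
qed

text \<open>Valid for arbitrary \<open>\<Psi>\<close>: where the square of a chosen gradient is not
  integrable, its integral has the default value 0.\<close>

lemma kin_nonneg: "0 \<le> kin \<Psi>"
proof -
  have "0 \<le> integral cube (\<lambda>x. (cmod (u x))\<^sup>2)" for u :: "real^'n::finite \<Rightarrow> complex"
    by (cases "(\<lambda>x. (cmod (u x))\<^sup>2) integrable_on cube")
       (auto intro: Henstock_Kurzweil_Integration.integral_nonneg simp: not_integrable_integral)
  then show ?thesis unfolding kin_def by (intro mult_nonneg_nonneg sum_nonneg) auto
qed

text \<open>Positivity is given for one continuous version and absolute continuity for another. They
  agree almost everywhere, so the positive minimum of the first is a lower bound for the second on
  the whole interval.\<close>

lemma Xpos_representative:
  assumes "\<rho> \<in> Xpos N"
  obtains r k m M where "L2b k" "ac_pair r k" "r 0 = r 1" "AE x in u01. \<rho> x = r x" "AE x in u01. dr \<rho> x = k x"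
    "integral {0..1} r = real N" "m > 0" "\<And>t. t \<in> {0..1} \<Longrightarrow> m \<le> r t \<and> r t \<le> M"
proof -
  have X: "\<rho> \<in> Xset N" using assms by (simp add: Xpos_def)
  obtain k r where k: "L2b k" "ac_pair r k" "r 0 = r 1" "AE x in u01. \<rho> x = r x" "AE x in u01. dr \<rho> x = k x"
    "integral {0..1} r = real N" using H1r_representative[OF X] by metis
  obtain r' where r': "continuous_on {0..1} r'" "negligible {x \<in> {0..1}. \<rho> x \<noteq> r' x}" "\<forall>x\<in>{0..1}. 0 < r' x"
    using assms by (auto simp: Xpos_def)
  have ae: "AE x in u01. \<rho> x = r' x"
    using r'(2) negligible_iff_AE_uni[of "{0..1}" "\<lambda>x. \<rho> x = r' x"] by simp
  obtain x0 where x0: "x0 \<in> {0..1}" "\<And>t. t \<in> {0..1} \<Longrightarrow> r' x0 \<le> r' t"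
    using continuous_attains_inf[OF compact_Icc _ r'(1)] by auto
  have rc: "continuous_on {0..1} r" by (rule ac_pair_continuous[OF k(2)])
  have "AE t in u01. r' x0 \<le> r t"
    using ae k(4) AE_u01 by eventually_elim (use x0(2) in force)
  then have lower: "r' x0 \<le> r t" if "t \<in> {0..1}" for t by (rule continuous_AE_lower_bound[OF rc _ that])
  obtain x1 where x1: "\<forall>t\<in>{0..1}. r t \<le> r x1"
    using continuous_attains_sup[OF compact_Icc _ rc] by auto
  show ?thesis by (rule that[OF k]) (use r'(3) x0(1) lower x1 in auto)
qed

text \<open>The chain rule multiplies the L2 derivative of the density by
  \<open>1 / (2 * sqrt r)\<close>, which is bounded because \<open>r\<close> stays above
  \<open>m\<close>.\<close>

lemma Xpos_subset_Iset:
  assumes "\<rho> \<in> Xpos N" shows "\<rho> \<in> Iset N"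
proof -
  obtain k r m M where k: "L2b k" "ac_pair r k" "r 0 = r 1" "AE x in u01. \<rho> x = r x" "AE x in u01. dr \<rho> x = k x"
    and "integral {0..1} r = real N" and m: "m > 0" "\<And>t. t \<in> {0..1} \<Longrightarrow> m \<le> r t \<and> r t \<le> M"
    by (rule Xpos_representative[OF assms]) (rule that)
  have X: "\<rho> \<in> Xset N" using assms by (simp add: Xpos_def)
  have ac: "ac_pair (\<lambda>t. sqrt (r t)) (\<lambda>t. k t / (2 * sqrt (r t)))"
    by (rule ac_pair_sqrt[OF k(2)]) (use m in force)
  \<comment> \<open>Clamping the argument makes the multiplier Borel and bounded on the whole line,
    as \<open>L2b_bounded_mult\<close> requires.\<close>
  let ?rc = "\<lambda>t. r (max 0 (min 1 t))"
  have rm: "m \<le> ?rc t" for t using m(2)[of "max 0 (min 1 t)"] by auto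
  have rcm: "?rc \<in> borel_measurable borel"
    by (rule borel_measurable_continuous_onI[OF continuous_on_clamp[OF ac_pair_continuous[OF k(2)]]])
  have "L2b (\<lambda>t. (1 / (2 * sqrt (?rc t))) * k t)"
  proof (rule L2b_bounded_mult[OF k(1)])
    show "(\<lambda>t. 1 / (2 * sqrt (?rc t))) \<in> borel_measurable borel" using rcm by measurable
    show "\<bar>1 / (2 * sqrt (?rc t))\<bar> \<le> 1 / (2 * sqrt m)" for t
      using rm[of t] m(1) by (simp add: frac_le)
  qed
  then have "L2r (\<lambda>t. (1 / (2 * sqrt (?rc t))) * k t)" by (rule L2b_L2r)
  then have L: "L2r (\<lambda>t. k t / (2 * sqrt (r t)))"
  proof (rule L2r_cong_AE)
    show "AE t in u01. (1 / (2 * sqrt (?rc t))) * k t = k t / (2 * sqrt (r t))"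
      using AE_u01 by eventually_elim (simp add: less_imp_le)
  qed
  have "weak_deriv1 (\<lambda>x. sqrt (\<rho> x)) (\<lambda>t. k t / (2 * sqrt (r t)))"
  proof (rule weak_deriv1_cong_AE[OF ac_pair_weak_deriv1[OF ac]])
    show "AE x in u01. sqrt (r x) = sqrt (\<rho> x)" using k(4) by eventually_elim simp
  qed (simp_all add: k(3))
  moreover have "negligible {x \<in> {0..1}. \<rho> x < 0}"
  proof -
    have "AE x in u01. \<not> \<rho> x < 0" using k(4) AE_u01
    proof eventually_elim
      case (elim x)
      then show ?case using m(1) m(2)[of x] by simp
    qed
    then show ?thesis using negligible_iff_AE_uni[of "{0..1}" "\<lambda>x. \<not> \<rho> x < 0"] by simp
  qed
  moreover have "\<rho> absolutely_integrable_on {0..1}"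
    by (rule L2r_absolutely_integrable) (use X in \<open>auto simp: Xset_def H1r_def\<close>)
  ultimately show ?thesis using L X by (auto simp: Iset_def Xset_def)
qed

theorem theorem5:
  fixes W :: "'n::finite wf \<Rightarrow> 'n wf \<Rightarrow> complex" and \<rho> :: "real \<Rightarrow> real"
  assumes "admissible_W W"
    and "\<rho> \<in> Xpos CARD('n)"
  shows "\<rho> \<in> Iset CARD('n) \<and> subdiff W \<rho> \<noteq> {}"
proof
  show "\<rho> \<in> Iset CARD('n)" by (rule Xpos_subset_Iset[OF assms(2)])
  obtain k r m M where k: "L2b k" "ac_pair r k" "r 0 = r 1" "AE x in u01. \<rho> x = r x" "AE x in u01. dr \<rho> x = k x"
    and rN: "integral {0..1} r = real CARD('n)" and m: "m > 0" and rm: "\<And>t. t \<in> {0..1} \<Longrightarrow> m \<le> r t \<and> r t \<le> M"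
    by (rule Xpos_representative[OF assms(2)]) (rule that)
  obtain a b where ab: "0 \<le> a" "\<And>\<Psi>. \<Psi> \<in> Wset \<Longrightarrow> 0 \<le> Re (W \<Psi> \<Psi>)"
    "\<And>\<Psi>. \<Psi> \<in> Wset \<Longrightarrow> Re (W \<Psi> \<Psi>) \<le> a * kin \<Psi> + b"
    by (rule admissible_W_bounds[OF assms(1)]) (rule that)
  \<comment> \<open>\<open>?R\<close> bounds the squared norm of \<open>k + (m / 4) * h\<close>, and
    \<open>?C\<close> is the kinetic energy granted by \<open>density_realization\<close> for
    densities between \<open>m / 2\<close> and \<open>M + m / 2\<close>.\<close>
  let ?R = "2 * (\<integral>t. (k t)\<^sup>2 \<partial>u01) + 2 * (m / 4)\<^sup>2"
  let ?C = "real CARD('n) * fact CARD('n) * (?R / (2 * (m / 2)) + 2 * (M + m / 2) * (2 * pi * (M + m / 2))\<^sup>2)"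
  show "subdiff W \<rho> \<noteq> {}"
  \<comment> \<open>\<open>H - \<mu>\<close> below is at most 2 in absolute value, so the step
    \<open>m / 4\<close> moves the density by at most \<open>m / 2\<close>. The constant
    \<open>C\<close> adds the form bound \<open>a * kin \<Psi> + b\<close> to the kinetic
    energy.\<close>
  proof (rule subdiff_nonempty_if_locally_bounded[where \<delta> = "m / 4" and C = "(1 + a) * ?C + b"])
    show "\<rho> \<in> Xset CARD('n)" using assms(2) by (simp add: Xpos_def)
    show "dens \<Psi> \<in> Xset CARD('n)" if "\<Psi> \<in> Wset" for \<Psi> :: "'n wf" by (rule dens_in_Xset[OF that])
    show "0 \<le> kin \<Psi> + Re (W \<Psi> \<Psi>)" if "\<Psi> \<in> Wset" for \<Psi> using kin_nonneg[of \<Psi>] ab(2)[OF that] by simp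
    show "m / 4 > 0" using m by simp
    fix h assume h: "L2b h" "(\<integral>x. h x \<partial>u01) = 0" "(\<integral>x. (h x)\<^sup>2 \<partial>u01) \<le> 1"
    have ha: "h absolutely_integrable_on {0..1}" by (rule integrable_uniD[OF L2b_integrable[OF h(1)]]) simp
    define H where "H t = integral {0..t} h" for t
    have H: "ac_pair H h" using ha by (simp add: ac_pair_def H_def)
    have H01: "H 0 = 0" "H 1 = 0" using integral_uni_eq[OF L2b_integrable[OF h(1)]] h(2) by (simp_all add: H_def)
    \<comment> \<open>The primitive is bounded by the L1 norm of \<open>h\<close>, and on a
      probability space that is at most the L2 norm.\<close>
    have H1: "\<bar>H t\<bar> \<le> 1" if t: "t \<in> {0..1}" for t
    proof -
      have hi: "(\<lambda>x. \<bar>h x\<bar>) integrable_on {0..1}" using ha by (auto simp: absolutely_integrable_on_def)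
      have hs: "(\<lambda>x. \<bar>h x\<bar>) integrable_on {0..t}" by (rule integrable_on_subinterval[OF hi]) (use t in auto)
      have "norm (H t) \<le> integral {0..t} (\<lambda>x. \<bar>h x\<bar>)"
        unfolding H_def using t by (intro integral_norm_bound_integral hs ac_pair_integrable[OF H]) auto
      also have "\<dots> \<le> integral {0..1} (\<lambda>x. \<bar>h x\<bar>)" using t by (intro integral_subset_le hs hi) auto
      also have "\<dots> = (\<integral>x. \<bar>h x\<bar> \<partial>u01)"
        by (rule integral_uni_eq[OF integrable_abs[OF L2b_integrable[OF h(1)]], symmetric]) simp
      also have "\<dots> \<le> 1"
      proof (rule power2_le_imp_le)
        show "(\<integral>x. \<bar>h x\<bar> \<partial>u01)\<^sup>2 \<le> 1\<^sup>2" using order_trans[OF L2b_L1_le[OF h(1)] h(3)] by simp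
      qed simp
      finally show ?thesis by simp
    qed
    define \<mu> where "\<mu> = integral {0..1} H"
    have Hi: "H integrable_on {0..1}" by (rule integrable_continuous_interval[OF ac_pair_continuous[OF H]])
    have \<mu>: "\<bar>\<mu>\<bar> \<le> 1"
    proof -
      have "norm (integral {0..1} H) \<le> integral {0..1} (\<lambda>x::real. 1::real)"
        using H1 by (intro integral_norm_bound_integral Hi) auto
      then show ?thesis by (simp add: \<mu>_def)
    qed
    \<comment> \<open>Subtracting the mean \<open>\<mu>\<close> preserves the number of particles
      and does not affect the derivative.\<close>
    define r2 where "r2 t = 1 * r t + (m / 4) * (H t - \<mu>)" for t
    define g where "g t = 1 * k t + (m / 4) * h t" for t
    have "ac_pair (\<lambda>t. H t - \<mu>) h" using ha by (simp add: ac_pair_def H_def)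
    then have ac: "ac_pair r2 g" unfolding r2_def g_def by (rule ac_pair_lincomb[OF k(2)])
    have gL: "L2b g" unfolding g_def by (rule L2b_lincomb[OF k(1) h(1)])
    have "\<exists>\<Psi> :: 'n wf. \<Psi> \<in> Wset \<and> kin \<Psi> \<le> ?C \<and> (\<forall>t\<in>{0..1}. dens \<Psi> t = r2 t)"
    proof (rule density_realization[OF ac gL])
      show "r2 0 = r2 1" by (simp add: r2_def k(3) H01)
      show "m / 2 > 0" using m by simp
      show "m / 2 \<le> r2 t \<and> r2 t \<le> M + m / 2" if t: "t \<in> {0..1}" for t
      proof -
        have "\<bar>(m / 4) * (H t - \<mu>)\<bar> \<le> (m / 4) * 2"
          unfolding abs_mult using H1[OF t] \<mu> m by (intro mult_mono) auto
        then show ?thesis using rm[OF t] unfolding r2_def by (auto simp: abs_le_iff)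
      qed
      have "(\<integral>t. (g t)\<^sup>2 \<partial>u01) \<le> (\<integral>t. 2 * (k t)\<^sup>2 + 2 * (m / 4)\<^sup>2 * (h t)\<^sup>2 \<partial>u01)"
      proof (rule integral_mono)
        show "integrable u01 (\<lambda>t. 2 * (k t)\<^sup>2 + 2 * (m / 4)\<^sup>2 * (h t)\<^sup>2)"
          using L2b_square[OF k(1)] L2b_square[OF h(1)] by (intro Bochner_Integration.integrable_add integrable_mult_right)
        show "(g t)\<^sup>2 \<le> 2 * (k t)\<^sup>2 + 2 * (m / 4)\<^sup>2 * (h t)\<^sup>2" for t
        proof -
          have "(k t + (m / 4) * h t)\<^sup>2 \<le> 2 * (k t)\<^sup>2 + 2 * ((m / 4) * h t)\<^sup>2"
            using sum_squares_bound[of "k t" "(m / 4) * h t"] unfolding power2_sum by linarith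
          then show ?thesis unfolding g_def mult_1 by (simp only: power_mult_distrib mult.assoc)
        qed
      qed (rule L2b_square[OF gL])
      also have "\<dots> = 2 * (\<integral>t. (k t)\<^sup>2 \<partial>u01) + 2 * (m / 4)\<^sup>2 * (\<integral>t. (h t)\<^sup>2 \<partial>u01)"
        using L2b_square[OF k(1)] L2b_square[OF h(1)] by (simp del: power_divide)
      also have "\<dots> \<le> ?R" using h(3) mult_left_mono[OF h(3), of "2 * (m / 4)\<^sup>2"] by simp
      finally show "(\<integral>t. (g t)\<^sup>2 \<partial>u01) \<le> ?R" .
      have "integral {0..1} r2 = integral {0..1} r + (m / 4) * (\<mu> - \<mu>)"
      proof -
        have ri: "r integrable_on {0..1}" by (rule integrable_continuous_interval[OF ac_pair_continuous[OF k(2)]])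
        have "((\<lambda>t. 1 * r t + (m / 4) * (H t - \<mu>)) has_integral 1 * integral {0..1} r + (m / 4) * (\<mu> - \<mu>)) {0..1}"
          using has_integral_const_real[of \<mu> 0 1] unfolding \<mu>_def
          by (intro has_integral_add has_integral_mult_right has_integral_diff integrable_integral ri Hi) simp
        then show ?thesis unfolding r2_def by (simp add: integral_unique)
      qed
      then show "integral {0..1} r2 = real CARD('n)" by (simp add: rN)
    qed
    then obtain \<Psi> :: "'n wf" where \<Psi>: "\<Psi> \<in> Wset" "kin \<Psi> \<le> ?C" "\<And>t. t \<in> {0..1} \<Longrightarrow> dens \<Psi> t = r2 t" by blast
    have "Re (W \<Psi> \<Psi>) \<le> a * ?C + b" using ab(3)[OF \<Psi>(1)] mult_left_mono[OF \<Psi>(2) ab(1)] by linarith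
    then have "kin \<Psi> + Re (W \<Psi> \<Psi>) \<le> ?C + (a * ?C + b)" using \<Psi>(2) by linarith
    also have "\<dots> = (1 + a) * ?C + b" by (simp only: distrib_right mult_1 add.assoc)
    finally have 1: "kin \<Psi> + Re (W \<Psi> \<Psi>) \<le> (1 + a) * ?C + b" .
    have "AE t in u01. r2 t = dens \<Psi> t" using AE_u01 by eventually_elim (simp add: \<Psi>(3))
    moreover have "r2 0 = r2 1" by (simp add: r2_def k(3) H01)
    ultimately have "weak_deriv1 (dens \<Psi>) g"
      by (intro weak_deriv1_cong_AE[OF ac_pair_weak_deriv1[OF ac]]) auto
    from dr_eqI[OF L2b_L2r[OF gL] this] k(5)
    have "AE x in u01. dr (dens \<Psi>) x = dr \<rho> x + m / 4 * h x" by eventually_elim (simp add: g_def)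
    then show "\<exists>\<Psi>\<in>Wset. kin \<Psi> + Re (W \<Psi> \<Psi>) \<le> (1 + a) * ?C + b \<and> (AE x in u01. dr (dens \<Psi>) x = dr \<rho> x + m / 4 * h x)"
      using 1 \<Psi>(1) by blast
  qed
qed

end
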